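(* Every MBQC-form ZX-diagram which has Pauli flow can be transformed, by a finite sequence of applications of the rules (IO), (PF), (ZL), (LC), (E$_{ZX}$), (SN) listed in the context in which every intermediate diagram has Pauli flow, into an MBQC-form ZX-diagram which has extended causal flow (and the same interpretation up to a non-zero scalar).
   Context: **MBQC-form diagrams.** An MBQC-form ZX-diagram $D$ consists of a finite simple undirected graph $G=(V,E)$, sets $I,O\subseteq V$ of inputs and outputs (each ordered; $I\cap O$ may be non-empty), and for each $v\in V\setminus O$ a measurement effect $e_v$, a non-zero row vector on $\mathbb C^2$ considered up to non-zero scalar, of one of the forms (angles mod $2\pi$): $XY(\alpha)=\langle 0|+e^{i\alpha}\langle 1|$; $YZ(\alpha)=\langle +|+e^{i\alpha}\langle -|$; $XZ(\alpha)=YZ(\alpha)\circ\mathrm{diag}(1,i)$. Its interpretation, up to non-zero scalar, is the linear map $\llbracket D\rrbracket:(\mathbb C^2)^{\otimes I}\to(\mathbb C^2)^{\otimes O}$, $|x\rangle\mapsto\sum_{y\in\{0,1\}^V,\ y|_I=x}(-1)^{|\{\{u,v\}\in E:\,y_u=y_v=1\}|}\big(\prod_{v\in V\setminus O}e_v|y_v\rangle\big)\,|y|_O\rangle$. Diagrams are considered up to isomorphism respecting inputs and outputs and up to non-zero scalars; disconnected components without inputs and outputs (scalars) may be dropped or added. **Flow.** A labelled open graph is $(G,I,O,\lambda)$ with $\lambda:V\setminus O\to\{X,Y,Z,XY,XZ,YZ\}$. Write $\overline S=V\setminus S$, $N_G(v)$ for the neighbourhood, $N_G[v]=N_G(v)\cup\{v\}$,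 $\mathrm{Odd}_G(S)$ for the set of vertices with an odd number of neighbours in $S$, and $\mathrm{Odd}_G[S]=\mathrm{Odd}_G(S)\,\triangle\,S$. For $c:\overline O\to\mathcal P(\overline I)$ let $R_c$ be the set of pairs $(u,v)$ with $v\neq u$ such that: $v\in c(u)$ and $\lambda(v)\notin\{X,Y\}$; or $v\in\mathrm{Odd}_G(c(u))$ and $\lambda(v)\notin\{Y,Z\}$; or $v\in\mathrm{Odd}_G[c(u)]$ and $\lambda(v)=Y$ (conditions of the form "$\lambda(v)\notin\dots$" count as satisfied for $v\in O$). Let $\prec_c$ be the transitive closure of $R_c$. The labelled open graph has *Pauli flow* if there is $p:\overline O\to\mathcal P(\overline I)$ such that $\prec_p$ is a strict partial order and for all $u\in\overline O$: $\lambda(u)=XY\Rightarrow u\notin p(u)\wedge u\in\mathrm{Odd}_G(p(u))$; $\lambda(u)=XZ\Rightarrow u\in p(u)\wedge u\in\mathrm{Odd}_G(p(u))$; $\lambda(u)=YZ\Rightarrow u\in p(u)\wedge u\notin\mathrm{Odd}_G(p(u))$; $\lambda(u)=X\Rightarrow u\in\mathrm{Odd}_G(p(u))$; $\lambda(u)=Z\Rightarrow u\in p(u)$; $\lambda(u)=Y\Rightarrow u\in\mathrm{Odd}_G[p(u)]$. If $\lambda$ takes values in $\{XY,YZ\}$, it has *extended causal flow* $f$ if $f:\overline O\to\overline I$ (identify $f(v)$ with $\{f(v)\}$), $\prec_f$ is a strict partial order, and $\lambda(v)=XY\Rightarrow f(v)\in N_G(v)$, $\lambda(v)=YZ\Rightarrow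 f(v)=v$. A diagram $D$ *has Pauli flow* if $(G,I,O,\lambda)$ does, where $\lambda(v)=X$ if $e_v=XY(0)$ or $XY(\pi)$ up to scalar, $\lambda(v)=Y$ if $e_v=XY(\pm\pi/2)$ up to scalar, $\lambda(v)=Z$ if $e_v=YZ(0)$ or $YZ(\pi)$ up to scalar, and otherwise $\lambda(v)$ is the plane containing $e_v$. It has extended causal flow if for some labelling by $XY,YZ$ with each $e_v$ of the form given by its label, the labelled open graph has extended causal flow. **Rules.** - (IO), both directions. Input version: an input $c$ is replaced by a path $a - b - c$, where $a,b$ are new vertices with effects $XY(0)$, edges $\{a,b\},\{b,c\}$ are added, and $a$ replaces $c$ as input. Output version: for an output $c$ (possibly also an input, which it then remains), add new vertices $b,o$ and edges $\{c,b\},\{b,o\}$; $c$ and $b$ get effect $XY(0)$ and $o$ replaces $c$ as output. - (PF). If $z\notin I\cup O$ has effect $YZ(\alpha)$ and exactly one neighbour $v$, where $v\notin O$ has effect $XY(\beta)$, replace these effects by $YZ(\alpha')$ and $XY(\alpha-\alpha'+\beta)$, for any $\alpha'\in\mathbb R$. - (ZL), both directions. Delete a vertex $z\notin I\cup O$ with effect $YZ(a\pi)$, $a\in\{0,1\}$, together with its incident edges, and replace $e_w$ by $e_w\circ\mathrm{diag}(1,-1)^a$ for all $w\in N_G(z)$ (if $a=1$, neighbours must be non-outputs). Conversely, insert such a vertex with any set of neighbours. - (LC). For $u\notin I$ with $N_G[u]\cap O=\emptyset$: replace $G$ by the local complement $G*u$ (complement the edges among $N_G(u)$), replace $e_u$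 by $e_u\circ(|+\rangle\langle+|-i|-\rangle\langle-|)$, and $e_w$ by $e_w\circ\mathrm{diag}(1,i)$ for $w\in N_G(u)$. - (E$_{ZX}$), left to right. If $a,b\notin O$ are adjacent with effects $XY(\alpha_1)$, $XY(\alpha_2)$, and $D$ has an extended causal flow $g$ with $g(a)=b$ or $g(b)=a$ (where $a,b$ are labelled $XY$), remove the edge $\{a,b\}$, add new vertices $x,y,t$ and edges $\{a,x\},\{x,y\},\{y,t\},\{t,b\}$, give $a,b$ effect $XY(0)$ and $x,y,t$ effects $XY(\beta_1),XY(\beta_2),XY(\beta_3)$. Here, with $z=-\sin\frac{\alpha_1+\alpha_2}{2}+i\cos\frac{\alpha_1-\alpha_2}{2}$ and $z'=\cos\frac{\alpha_1+\alpha_2}{2}-i\sin\frac{\alpha_1-\alpha_2}{2}$: if $z'=0$, $(\beta_1,\beta_2,\beta_3)=(2\arg z,0,0)$; if $z=0$, $(2\arg z',\pi,0)$; otherwise $\beta_1=\arg z+\arg z'$, $\beta_2=2\arg(i+|z/z'|)$, $\beta_3=\arg z-\arg z'$ (mod $2\pi$). - (SN), left to right. If for $n\ge1$ distinct vertices $v_1,\dots,v_n$ there are $2^n-1$ further distinct vertices $g_s\notin I\cup O$, $s\in\{0,1\}^n\setminus\{0\cdots0\}$, with $N_G(g_s)=\{v_k: s_k=1\}$ and effect $YZ\big((-1)^{|s|-1}\tfrac{2\pi}{2^{n-1}}\big)$, where $|s|$ is the Hamming weight, delete all the $g_s$. *)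

theory Defs
  imports "HOL-Analysis.Analysis" "HOL-Library.Infinite_Typeclass"
begin

section \<open>Measurement effects\<close>

text \<open>Row vectors on the qubit space are indexed by computational basis states, with
  \<^term>\<open>False\<close> for 0 and \<^term>\<open>True\<close> for 1; composition of an effect with an operator is
  the vector-matrix product \<^term>\<open>e v* M\<close>.\<close>

type_synonym qvec = "complex ^ bool"
type_synonym qmat = "complex ^ bool ^ bool"

definition prop_to :: "qvec \<Rightarrow> qvec \<Rightarrow> bool"  (infix "\<propto>" 50) where
  "e \<propto> f \<longleftrightarrow> (\<exists>c. c \<noteq> 0 \<and> e = c *s f)"

definition plus_vec :: qvec where
  "plus_vec = (\<chi> y. 1 / of_real (sqrt 2))"

definition minus_vec :: qvec where
  "minus_vec = (\<chi> y. (if y then - 1 else 1) / of_real (sqrt 2))"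

definition diag1 :: "complex \<Rightarrow> qmat" where
  "diag1 c = (\<chi> i j. if i = j then (if i then c else 1) else 0)"

definition outer :: "qvec \<Rightarrow> qvec \<Rightarrow> qmat" where
  "outer v w = (\<chi> i j. v $ i * cnj (w $ j))"

text \<open>The operator $|+\rangle\langle+| - i |-\rangle\langle-|$.\<close>

definition lc_op :: qmat where
  "lc_op = outer plus_vec plus_vec - outer (\<i> *s minus_vec) minus_vec"

definition XY :: "real \<Rightarrow> qvec" where
  "XY \<alpha> = (\<chi> y. if y then cis \<alpha> else 1)"

definition YZ :: "real \<Rightarrow> qvec" where
  "YZ \<alpha> = plus_vec + cis \<alpha> *s minus_vec"

definition XZ :: "real \<Rightarrow> qvec" where
  "XZ \<alpha> = YZ \<alpha> v* diag1 \<i>"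

definition is_effect :: "qvec \<Rightarrow> bool" where
  "is_effect e \<longleftrightarrow> (\<exists>\<alpha>. e \<propto> XY \<alpha> \<or> e \<propto> YZ \<alpha> \<or> e \<propto> XZ \<alpha>)"


section \<open>Open graphs and diagrams\<close>

text \<open>Edges are two-element sets of vertices; inputs and outputs are ordered, hence lists.
  The fields of a diagram are only meaningful up to \<open>mbqc_iso\<close> below; in particular the values
  of \<open>eff\<close> outside the non-output vertices carry no information.\<close>

record 'v open_graph =
  verts :: "'v set"
  edges :: "'v set set"
  inputs :: "'v list"
  outputs :: "'v list"

record 'v mbqc = "'v open_graph" +
  eff :: "'v \<Rightarrow> qvec"

definition ins :: "('v, 'm) open_graph_scheme \<Rightarrow> 'v set" where
  "ins G = set (inputs G)"

definition outs :: "('v, 'm) open_graph_scheme \<Rightarrow> 'v set" where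
  "outs G = set (outputs G)"

definition is_open_graph :: "('v, 'm) open_graph_scheme \<Rightarrow> bool" where
  "is_open_graph G \<longleftrightarrow>
     finite (verts G) \<and>
     (\<forall>e\<in>edges G. \<exists>u\<in>verts G. \<exists>v\<in>verts G. u \<noteq> v \<and> e = {u, v}) \<and>
     distinct (inputs G) \<and> ins G \<subseteq> verts G \<and>
     distinct (outputs G) \<and> outs G \<subseteq> verts G"

definition is_mbqc :: "'v mbqc \<Rightarrow> bool" where
  "is_mbqc D \<longleftrightarrow> is_open_graph D \<and> (\<forall>v\<in>verts D - outs D. is_effect (eff D v))"

definition nbrs :: "('v, 'm) open_graph_scheme \<Rightarrow> 'v \<Rightarrow> 'v set" where
  "nbrs G v = {w \<in> verts G. {v, w} \<in> edges G}"

definition odd_nbrs :: "('v, 'm) open_graph_scheme \<Rightarrow> 'v set \<Rightarrow> 'v set" where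
  "odd_nbrs G S = {v \<in> verts G. odd (card (nbrs G v \<inter> S))}"

definition odd_nbrs_closed :: "('v, 'm) open_graph_scheme \<Rightarrow> 'v set \<Rightarrow> 'v set" where
  "odd_nbrs_closed G S = sym_diff (odd_nbrs G S) S"


section \<open>Interpretation\<close>

text \<open>The interpretation is given by its matrix in the computational basis: \<^term>\<open>interp D x z\<close>
  is the coefficient of the output basis state \<^term>\<open>z\<close> in the image of the input basis state
  \<^term>\<open>x\<close>, both being bit lists ordered like \<^term>\<open>inputs D\<close> and \<^term>\<open>outputs D\<close>. It is 0 on lists
  of the wrong length.\<close>

definition interp :: "'v mbqc \<Rightarrow> bool list \<Rightarrow> bool list \<Rightarrow> complex" where
  "interp D x z =
     (\<Sum>y \<in> {y \<in> verts D \<rightarrow>\<^sub>E (UNIV :: bool set). map y (inputs D) = x \<and> map y (outputs D) = z}.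
        (- 1) ^ card {e \<in> edges D. \<forall>v\<in>e. y v} *
        (\<Prod>v \<in> verts D - outs D. eff D v $ y v))"

definition same_interp :: "'v mbqc \<Rightarrow> 'v mbqc \<Rightarrow> bool" where
  "same_interp D D' \<longleftrightarrow>
     length (inputs D) = length (inputs D') \<and> length (outputs D) = length (outputs D') \<and>
     (\<exists>c. c \<noteq> 0 \<and> (\<forall>x z. interp D' x z = c * interp D x z))"


section \<open>Flow\<close>

datatype label = LX | LY | LZ | LXY | LXZ | LYZ

definition flow_rel ::
    "('v, 'm) open_graph_scheme \<Rightarrow> ('v \<Rightarrow> label) \<Rightarrow> ('v \<Rightarrow> 'v set) \<Rightarrow> ('v \<times> 'v) set" where
  "flow_rel G l c = {(u, v). u \<in> verts G - outs G \<and> v \<in> verts G \<and> v \<noteq> u \<and>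
     (v \<in> c u \<and> (v \<in> outs G \<or> l v \<notin> {LX, LY}) \<or>
      v \<in> odd_nbrs G (c u) \<and> (v \<in> outs G \<or> l v \<notin> {LY, LZ}) \<or>
      v \<in> odd_nbrs_closed G (c u) \<and> v \<notin> outs G \<and> l v = LY)}"

text \<open>A transitive closure is a strict partial order iff it is irreflexive.\<close>

definition flow_ordered ::
    "('v, 'm) open_graph_scheme \<Rightarrow> ('v \<Rightarrow> label) \<Rightarrow> ('v \<Rightarrow> 'v set) \<Rightarrow> bool" where
  "flow_ordered G l c \<longleftrightarrow> irrefl ((flow_rel G l c)\<^sup>+)"

definition pauli_flow ::
    "('v, 'm) open_graph_scheme \<Rightarrow> ('v \<Rightarrow> label) \<Rightarrow> ('v \<Rightarrow> 'v set) \<Rightarrow> bool" where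
  "pauli_flow G l p \<longleftrightarrow>
     (\<forall>u \<in> verts G - outs G. p u \<subseteq> verts G - ins G) \<and>
     flow_ordered G l p \<and>
     (\<forall>u \<in> verts G - outs G.
        (l u = LXY \<longrightarrow> u \<notin> p u \<and> u \<in> odd_nbrs G (p u)) \<and>
        (l u = LXZ \<longrightarrow> u \<in> p u \<and> u \<in> odd_nbrs G (p u)) \<and>
        (l u = LYZ \<longrightarrow> u \<in> p u \<and> u \<notin> odd_nbrs G (p u)) \<and>
        (l u = LX \<longrightarrow> u \<in> odd_nbrs G (p u)) \<and>
        (l u = LZ \<longrightarrow> u \<in> p u) \<and>
        (l u = LY \<longrightarrow> u \<in> odd_nbrs_closed G (p u)))"

definition ext_causal_flow ::
    "('v, 'm) open_graph_scheme \<Rightarrow> ('v \<Rightarrow> label) \<Rightarrow> ('v \<Rightarrow> 'v) \<Rightarrow> bool" where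
  "ext_causal_flow G l f \<longleftrightarrow>
     (\<forall>v \<in> verts G - outs G. l v \<in> {LXY, LYZ}) \<and>
     (\<forall>v \<in> verts G - outs G. f v \<in> verts G - ins G) \<and>
     flow_ordered G l (\<lambda>v. {f v}) \<and>
     (\<forall>v \<in> verts G - outs G.
        (l v = LXY \<longrightarrow> f v \<in> nbrs G v) \<and>
        (l v = LYZ \<longrightarrow> f v = v))"

definition pauli_label :: "qvec \<Rightarrow> label" where
  "pauli_label e =
     (if e \<propto> XY 0 \<or> e \<propto> XY pi then LX
      else if e \<propto> XY (pi / 2) \<or> e \<propto> XY (- pi / 2) then LY
      else if e \<propto> YZ 0 \<or> e \<propto> YZ pi then LZ
      else if \<exists>\<alpha>. e \<propto> XY \<alpha> then LXY
      else if \<exists>\<alpha>. e \<propto> XZ \<alpha> then LXZ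
      else LYZ)"

definition has_pauli_flow :: "'v mbqc \<Rightarrow> bool" where
  "has_pauli_flow D \<longleftrightarrow> (\<exists>p. pauli_flow D (\<lambda>v. pauli_label (eff D v)) p)"

definition planar_labelling :: "'v mbqc \<Rightarrow> ('v \<Rightarrow> label) \<Rightarrow> bool" where
  "planar_labelling D l \<longleftrightarrow>
     (\<forall>v \<in> verts D - outs D.
        l v = LXY \<and> (\<exists>\<alpha>. eff D v \<propto> XY \<alpha>) \<or>
        l v = LYZ \<and> (\<exists>\<alpha>. eff D v \<propto> YZ \<alpha>))"

definition has_ext_causal_flow :: "'v mbqc \<Rightarrow> bool" where
  "has_ext_causal_flow D \<longleftrightarrow> (\<exists>l f. planar_labelling D l \<and> ext_causal_flow D l f)"


section \<open>Identification of diagrams\<close>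

definition mbqc_iso :: "'v mbqc \<Rightarrow> 'v mbqc \<Rightarrow> bool" where
  "mbqc_iso D D' \<longleftrightarrow> (\<exists>\<phi>.
     bij_betw \<phi> (verts D) (verts D') \<and>
     edges D' = (\<lambda>e. \<phi> ` e) ` edges D \<and>
     inputs D' = map \<phi> (inputs D) \<and>
     outputs D' = map \<phi> (outputs D) \<and>
     (\<forall>v \<in> verts D - outs D. eff D' (\<phi> v) \<propto> eff D v))"

text \<open>A set \<^term>\<open>C\<close> of vertices that is a union of connected components without inputs and outputs
  is dropped. Its interpretation is a number, which is required to be non-zero because diagrams are
  identified up to non-zero scalars only.\<close>

definition drop_scalar :: "'v mbqc \<Rightarrow> 'v mbqc \<Rightarrow> bool" where
  "drop_scalar D D' \<longleftrightarrow> (\<exists>C.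
     C \<subseteq> verts D \<and> C \<inter> (ins D \<union> outs D) = {} \<and>
     (\<forall>e \<in> edges D. e \<subseteq> C \<or> e \<inter> C = {}) \<and>
     interp \<lparr>verts = C, edges = {e \<in> edges D. e \<subseteq> C}, inputs = [], outputs = [], eff = eff D\<rparr> [] [] \<noteq> 0 \<and>
     D' = D\<lparr>verts := verts D - C, edges := {e \<in> edges D. e \<inter> C = {}}\<rparr>)"


section \<open>Rewrite rules\<close>

definition rule_IO_input :: "'v mbqc \<Rightarrow> 'v mbqc \<Rightarrow> bool" where
  "rule_IO_input D D' \<longleftrightarrow> (\<exists>a b c.
     c \<in> ins D \<and> a \<notin> verts D \<and> b \<notin> verts D \<and> a \<noteq> b \<and>
     D' = D\<lparr>verts := verts D \<union> {a, b},
            edges := edges D \<union> {{a, b}, {b, c}},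
            inputs := map (\<lambda>v. if v = c then a else v) (inputs D),
            eff := (eff D)(a := XY 0, b := XY 0)\<rparr>)"

definition rule_IO_output :: "'v mbqc \<Rightarrow> 'v mbqc \<Rightarrow> bool" where
  "rule_IO_output D D' \<longleftrightarrow> (\<exists>b c o'.
     c \<in> outs D \<and> b \<notin> verts D \<and> o' \<notin> verts D \<and> b \<noteq> o' \<and>
     D' = D\<lparr>verts := verts D \<union> {b, o'},
            edges := edges D \<union> {{c, b}, {b, o'}},
            outputs := map (\<lambda>v. if v = c then o' else v) (outputs D),
            eff := (eff D)(c := XY 0, b := XY 0)\<rparr>)"

definition rule_PF :: "'v mbqc \<Rightarrow> 'v mbqc \<Rightarrow> bool" where
  "rule_PF D D' \<longleftrightarrow> (\<exists>z v \<alpha> \<alpha>' \<beta>.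
     z \<in> verts D \<and> z \<notin> ins D \<union> outs D \<and> eff D z \<propto> YZ \<alpha> \<and>
     nbrs D z = {v} \<and> v \<notin> outs D \<and> eff D v \<propto> XY \<beta> \<and>
     D' = D\<lparr>eff := (eff D)(z := YZ \<alpha>', v := XY (\<alpha> - \<alpha>' + \<beta>))\<rparr>)"

definition rule_ZL :: "'v mbqc \<Rightarrow> 'v mbqc \<Rightarrow> bool" where
  "rule_ZL D D' \<longleftrightarrow> (\<exists>z. \<exists>a \<in> {0, 1 :: nat}.
     z \<in> verts D \<and> z \<notin> ins D \<union> outs D \<and> eff D z \<propto> YZ (real a * pi) \<and>
     (a = 1 \<longrightarrow> nbrs D z \<inter> outs D = {}) \<and>
     D' = D\<lparr>verts := verts D - {z},
            edges := {e \<in> edges D. z \<notin> e},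
            eff := (\<lambda>w. if w \<in> nbrs D z then eff D w v* diag1 ((- 1) ^ a) else eff D w)\<rparr>)"

definition rule_LC :: "'v mbqc \<Rightarrow> 'v mbqc \<Rightarrow> bool" where
  "rule_LC D D' \<longleftrightarrow> (\<exists>u.
     u \<in> verts D \<and> u \<notin> ins D \<and> insert u (nbrs D u) \<inter> outs D = {} \<and>
     D' = D\<lparr>edges := sym_diff (edges D) {{v, w} | v w. v \<in> nbrs D u \<and> w \<in> nbrs D u \<and> v \<noteq> w},
            eff := (\<lambda>w. if w = u then eff D u v* lc_op
                        else if w \<in> nbrs D u then eff D w v* diag1 \<i>
                        else eff D w)\<rparr>)"

text \<open>The Euler angles are determined modulo $2\pi$, so the choice of the branch of
  \<^term>\<open>Arg\<close> is immaterial.\<close>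

definition euler_angles :: "real \<Rightarrow> real \<Rightarrow> real \<times> real \<times> real" where
  "euler_angles \<alpha>1 \<alpha>2 =
     (let z = Complex (- sin ((\<alpha>1 + \<alpha>2) / 2)) (cos ((\<alpha>1 - \<alpha>2) / 2));
          z' = Complex (cos ((\<alpha>1 + \<alpha>2) / 2)) (- sin ((\<alpha>1 - \<alpha>2) / 2))
      in if z' = 0 then (2 * Arg z, 0, 0)
         else if z = 0 then (2 * Arg z', pi, 0)
         else (Arg z + Arg z', 2 * Arg (\<i> + of_real (cmod (z / z'))), Arg z - Arg z'))"

definition rule_E :: "'v mbqc \<Rightarrow> 'v mbqc \<Rightarrow> bool" where
  "rule_E D D' \<longleftrightarrow> (\<exists>a b x y t \<alpha>1 \<alpha>2 \<beta>1 \<beta>2 \<beta>3 l g.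
     a \<in> verts D - outs D \<and> b \<in> verts D - outs D \<and> {a, b} \<in> edges D \<and> a \<noteq> b \<and>
     eff D a \<propto> XY \<alpha>1 \<and> eff D b \<propto> XY \<alpha>2 \<and>
     planar_labelling D l \<and> ext_causal_flow D l g \<and>
     l a = LXY \<and> l b = LXY \<and> (g a = b \<or> g b = a) \<and>
     {x, y, t} \<inter> verts D = {} \<and> distinct [x, y, t] \<and>
     (\<beta>1, \<beta>2, \<beta>3) = euler_angles \<alpha>1 \<alpha>2 \<and>
     D' = D\<lparr>verts := verts D \<union> {x, y, t},
            edges := edges D - {{a, b}} \<union> {{a, x}, {x, y}, {y, t}, {t, b}},
            eff := (eff D)(a := XY 0, b := XY 0, x := XY \<beta>1, y := XY \<beta>2, t := XY \<beta>3)\<rparr>)"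

text \<open>The index $s \in \{0,1\}^n \setminus \{0 \cdots 0\}$ is represented by the non-empty set
  \<^term>\<open>S\<close> of those vertices $v_k$ with $s_k = 1$, and $n$ is the cardinality of the set \<^term>\<open>W\<close>
  of all the $v_k$.\<close>

definition rule_SN :: "'v mbqc \<Rightarrow> 'v mbqc \<Rightarrow> bool" where
  "rule_SN D D' \<longleftrightarrow> (\<exists>W g. let \<S> = Pow W - {{}} in
     W \<subseteq> verts D \<and> card W \<ge> 1 \<and>
     inj_on g \<S> \<and> g ` \<S> \<subseteq> verts D - W - ins D - outs D \<and>
     (\<forall>S \<in> \<S>. nbrs D (g S) = S \<and>
        eff D (g S) \<propto> YZ ((- 1) ^ (card S - 1) * (2 * pi / 2 ^ (card W - 1)))) \<and>
     D' = D\<lparr>verts := verts D - g ` \<S>,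
            edges := {e \<in> edges D. e \<inter> g ` \<S> = {}}\<rparr>)"


section \<open>Pauli-flow-preserving rewriting\<close>

text \<open>Isomorphism is symmetric; the remaining identification and the rules (IO) and (ZL) are used
  in both directions.\<close>

definition rewrite_step :: "'v mbqc \<Rightarrow> 'v mbqc \<Rightarrow> bool" where
  "rewrite_step D D' \<longleftrightarrow>
     mbqc_iso D D' \<or> drop_scalar D D' \<or> drop_scalar D' D \<or>
     rule_IO_input D D' \<or> rule_IO_input D' D \<or>
     rule_IO_output D D' \<or> rule_IO_output D' D \<or>
     rule_PF D D' \<or>
     rule_ZL D D' \<or> rule_ZL D' D \<or>
     rule_LC D D' \<or>
     rule_E D D' \<or>
     rule_SN D D'"

definition pauli_flow_step :: "'v mbqc \<Rightarrow> 'v mbqc \<Rightarrow> bool" where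
  "pauli_flow_step D D' \<longleftrightarrow>
     is_mbqc D \<and> has_pauli_flow D \<and> is_mbqc D' \<and> has_pauli_flow D' \<and> rewrite_step D D'"

end

theory Submission
  imports Defs
begin

text \<open>Only isomorphisms and the rules (IO), (ZL) and (LC) are needed. Angles play no role: each rule is
  sound and changes the flow labels in a way that depends on the labels only, so it suffices to
  rewrite labelled graphs. Three derived rewrites do the work: pivoting, adding the neighbourhood of an
  X-measured vertex to that of another vertex (a row operation), and splitting a vertex into a wire.

  After extending all outputs, the diagram consists of a head and of a tail that contains the outputs
  and carries an extended causal flow. The head is first brought into the XY plane, without
  Y-measured vertices other than inputs. A Pauli flow can be focused: Pauli-measured vertices then
  need no correction by other vertices. Hence the last vertex of the head that is not Pauli-measured
  (or any vertex, if all are) is the only one of the head with an odd number of neighbours in its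
  correction set, which consists of X-measured vertices. If the set meets the frontier of the tail, row
  operations produce a frontier vertex whose only neighbour in the head is this vertex, and the vertex
  becomes the next one on that wire; otherwise a pivot turns it into a phase gadget on the tail. Two
  adjacent X-measured vertices of the head are deleted by a pivot. So the head can be exhausted.\<close>

section \<open>Bloch vectors of measurement effects\<close>

text \<open>Every diagram on the way must have Pauli flow. The flow is therefore carried through
  each rule together with an explicit rank function, and this is sealed into \<open>reach\<close>
  once and for all; derived rewrites inherit it. The shape of the rest comes from side conditions.
  (LC), and (ZL) with a sign, act on neighbours, which must be measured; behind the fresh wires the
  outputs are out of reach of all later rewrites. (LC) is not allowed at inputs; these are made X-
  or Y-measured, a property that (LC) at other vertices keeps. A head in the XY plane without Y
  makes corrections linear: X-measured vertices ignore X-parts, and inputs never carry one, so a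
  focused correction set shows on the Pauli-measured vertices of the head only through its odd
  neighbourhood, and row operations act on it as in Gaussian elimination. Termination needs a
  weight, since rotating a YZ-measured vertex into the XY plane costs an extra vertex.\<close>

definition bloch_x :: "qvec \<Rightarrow> real" where "bloch_x e = Re (e $ False * cnj (e $ True))"
definition bloch_y :: "qvec \<Rightarrow> real" where "bloch_y e = Im (e $ False * cnj (e $ True))"
text \<open>\<open>bloch_x\<close> and \<open>bloch_y\<close> are half the usual Bloch coordinates,
  \<open>bloch_z\<close> is a full one. Only their vanishing matters: an effect lies in a plane if
  one coordinate vanishes and is a Pauli effect if two do.\<close>

definition bloch_z :: "qvec \<Rightarrow> real" where "bloch_z e = (cmod (e $ False))\<^sup>2 - (cmod (e $ True))\<^sup>2"

lemmas bloch_defs = bloch_x_def bloch_y_def bloch_z_def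

lemma qvec_eq_iff: "(e :: qvec) = f \<longleftrightarrow> e $ False = f $ False \<and> e $ True = f $ True"
  by (auto simp: vec_eq_iff) (metis (full_types))

lemma sum_bool: "(\<Sum>b\<in>UNIV. g b) = g False + g True" for g :: "bool \<Rightarrow> 'a :: comm_monoid_add"
  by (simp add: UNIV_bool add.commute)

lemma diag1_apply [simp]:
  "(e v* diag1 c) $ False = e $ False" "(e v* diag1 c) $ True = c * e $ True"
  by (simp_all add: vector_matrix_mult_def diag1_def sum_bool)

lemma lc_op_apply [simp]:
  "(e v* lc_op) $ False = ((1 - \<i>) * e $ False + (1 + \<i>) * e $ True) / 2"
  "(e v* lc_op) $ True = ((1 + \<i>) * e $ False + (1 - \<i>) * e $ True) / 2"
proof -
  have s: "complex_of_real (sqrt 2) * complex_of_real (sqrt 2) = 2"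
    by (metis of_real_mult of_real_numeral real_sqrt_mult_self abs_numeral)
  show "(e v* lc_op) $ False = ((1 - \<i>) * e $ False + (1 + \<i>) * e $ True) / 2"
       "(e v* lc_op) $ True = ((1 + \<i>) * e $ False + (1 - \<i>) * e $ True) / 2"
    by (simp_all add: vector_matrix_mult_def lc_op_def outer_def plus_vec_def minus_vec_def sum_bool s
        divide_simps)
qed

lemma prop_to_refl [simp]: "e \<propto> e"
  unfolding prop_to_def by (rule exI[of _ 1]) simp

section \<open>Planes and Pauli axes as vanishing Bloch coordinates\<close>

lemma prop_to_XY: "e \<propto> XY \<alpha> \<longleftrightarrow> e $ False \<noteq> 0 \<and> e $ True = cis \<alpha> * e $ False"
  by (auto simp: prop_to_def XY_def qvec_eq_iff)

lemma YZ_apply: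
  "YZ \<alpha> $ False = (1 + cis \<alpha>) / of_real (sqrt 2)" "YZ \<alpha> $ True = (1 - cis \<alpha>) / of_real (sqrt 2)"
  by (simp_all add: YZ_def plus_vec_def minus_vec_def add_divide_distrib diff_divide_distrib)

lemma prop_to_YZ:
  "e \<propto> YZ \<alpha> \<longleftrightarrow> e $ False + e $ True \<noteq> 0 \<and> e $ False - e $ True = cis \<alpha> * (e $ False + e $ True)"
proof
  assume "e \<propto> YZ \<alpha>"
  then obtain c where c: "c \<noteq> 0" "e = c *s YZ \<alpha>" by (auto simp: prop_to_def)
  have "YZ \<alpha> $ False + YZ \<alpha> $ True = 2 / of_real (sqrt 2)"
       "YZ \<alpha> $ False - YZ \<alpha> $ True = 2 * cis \<alpha> / of_real (sqrt 2)"
    by (simp_all add: YZ_apply flip: add_divide_distrib diff_divide_distrib)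
  then have "e $ False + e $ True = c * (2 / of_real (sqrt 2))"
       "e $ False - e $ True = c * (2 * cis \<alpha> / of_real (sqrt 2))"
    using c(2) by (simp_all flip: distrib_left right_diff_distrib)
  with c(1) show "e $ False + e $ True \<noteq> 0 \<and> e $ False - e $ True = cis \<alpha> * (e $ False + e $ True)"
    by simp
next
  assume *: "e $ False + e $ True \<noteq> 0 \<and> e $ False - e $ True = cis \<alpha> * (e $ False + e $ True)"
  let ?s = "e $ False + e $ True"
  have "?s * (1 + cis \<alpha>) = 2 * e $ False" "?s * (1 - cis \<alpha>) = 2 * e $ True"
    using * by algebra+
  then have "e = (?s * of_real (sqrt 2) / 2) *s YZ \<alpha>"
    by (simp add: qvec_eq_iff YZ_apply)
  then show "e \<propto> YZ \<alpha>" unfolding prop_to_def using * by (intro exI[of _ "?s * of_real (sqrt 2) / 2"]) auto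
qed

lemma prop_to_XZ:
  "e \<propto> XZ \<alpha> \<longleftrightarrow> e $ False - \<i> * e $ True \<noteq> 0 \<and>
     e $ False + \<i> * e $ True = cis \<alpha> * (e $ False - \<i> * e $ True)"
proof -
  \<comment> \<open>Composing with diag(1,-i) undoes the diag(1,i) in \<open>XZ\<close> and reduces
    the claim to the YZ plane.\<close>
  let ?d = "(\<chi> y. if y then - \<i> * e $ True else e $ False) :: qvec"
  have "e \<propto> XZ \<alpha> \<longleftrightarrow> ?d \<propto> YZ \<alpha>"
  proof
    assume "e \<propto> XZ \<alpha>"
    then obtain c where "c \<noteq> 0" "e = c *s XZ \<alpha>" by (auto simp: prop_to_def)
    then show "?d \<propto> YZ \<alpha>" unfolding prop_to_def
      by (intro exI[of _ c]) (simp add: qvec_eq_iff XZ_def mult.left_commute[of c \<i>])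
  next
    assume "?d \<propto> YZ \<alpha>"
    then obtain c where c: "c \<noteq> 0" "?d = c *s YZ \<alpha>" by (auto simp: prop_to_def)
    then have t: "- \<i> * e $ True = c * YZ \<alpha> $ True" and f: "e $ False = c * YZ \<alpha> $ False"
      by (simp_all add: qvec_eq_iff)
    have "e $ True = \<i> * (- \<i> * e $ True)" by simp
    also have "\<dots> = c * (\<i> * YZ \<alpha> $ True)" unfolding t by (rule mult.left_commute)
    finally have "e = c *s XZ \<alpha>"
      unfolding qvec_eq_iff XZ_def by (simp only: f diag1_apply vector_smult_component)
    with c show "e \<propto> XZ \<alpha>" unfolding prop_to_def by blast
  qed
  also have "\<dots> \<longleftrightarrow> e $ False - \<i> * e $ True \<noteq> 0 \<and>
     e $ False + \<i> * e $ True = cis \<alpha> * (e $ False - \<i> * e $ True)"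
    by (simp add: prop_to_YZ)
  finally show ?thesis .
qed

text \<open>This is where angles disappear: membership in a plane becomes an equality of moduli, a
  quadratic equation in the components.\<close>

lemma ex_cis: "(\<exists>\<alpha>. a \<noteq> 0 \<and> b = cis \<alpha> * a) \<longleftrightarrow> (a \<noteq> 0 \<or> b \<noteq> 0) \<and> cmod a = cmod b"
proof
  assume "(a \<noteq> 0 \<or> b \<noteq> 0) \<and> cmod a = cmod b"
  then have a: "a \<noteq> 0" and n: "cmod (b / a) = 1" by (auto simp: norm_divide)
  from n have "b / a = cis (Arg (b / a))"
    using cis_Arg[of "b / a"] by (cases "b / a = 0") (simp_all add: sgn_eq)
  then show "\<exists>\<alpha>. a \<noteq> 0 \<and> b = cis \<alpha> * a" using a by (auto simp: field_simps)
qed (auto simp: norm_mult)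

lemma norm_eq_iff_sq: "cmod a = cmod b \<longleftrightarrow> (Re a)\<^sup>2 + (Im a)\<^sup>2 = (Re b)\<^sup>2 + (Im b)\<^sup>2"
  by (simp add: cmod_def)

lemma in_XY: "(\<exists>\<alpha>. e \<propto> XY \<alpha>) \<longleftrightarrow> e \<noteq> 0 \<and> bloch_z e = 0"
  unfolding prop_to_XY ex_cis by (auto simp: qvec_eq_iff bloch_defs)

lemma in_YZ: "(\<exists>\<alpha>. e \<propto> YZ \<alpha>) \<longleftrightarrow> e \<noteq> 0 \<and> bloch_x e = 0"
proof -
  have 1: "(e $ False + e $ True \<noteq> 0 \<or> e $ False - e $ True \<noteq> 0) \<longleftrightarrow> e \<noteq> 0"
    by (auto simp: qvec_eq_iff)
  have 2: "cmod (e $ False + e $ True) = cmod (e $ False - e $ True) \<longleftrightarrow> bloch_x e = 0"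
    by (simp add: norm_eq_iff_sq bloch_defs) (simp add: power2_eq_square algebra_simps, linarith)
  show ?thesis unfolding prop_to_YZ ex_cis 1 2 ..
qed

lemma in_XZ: "(\<exists>\<alpha>. e \<propto> XZ \<alpha>) \<longleftrightarrow> e \<noteq> 0 \<and> bloch_y e = 0"
proof -
  have 1: "(e $ False - \<i> * e $ True \<noteq> 0 \<or> e $ False + \<i> * e $ True \<noteq> 0) \<longleftrightarrow> e \<noteq> 0"
    by (auto simp: qvec_eq_iff)
  have 2: "cmod (e $ False - \<i> * e $ True) = cmod (e $ False + \<i> * e $ True) \<longleftrightarrow> bloch_y e = 0"
    by (simp add: norm_eq_iff_sq bloch_defs) (auto simp add: power2_eq_square algebra_simps)
  show ?thesis unfolding prop_to_XZ ex_cis 1 2 ..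
qed

lemma is_effect_bloch:
  "is_effect e \<longleftrightarrow> e \<noteq> 0 \<and> (bloch_x e = 0 \<or> bloch_y e = 0 \<or> bloch_z e = 0)"
  unfolding is_effect_def ex_disj_distrib in_XY in_YZ in_XZ by blast

lemma is_X_iff: "e \<propto> XY 0 \<or> e \<propto> XY pi \<longleftrightarrow> e \<noteq> 0 \<and> bloch_y e = 0 \<and> bloch_z e = 0"
proof -
  obtain a b c d where e: "e $ False = Complex a b" "e $ True = Complex c d" by (metis complex.exhaust)
  \<comment> \<open>Seen as vectors of the real plane, the two components are parallel
    (\<open>bloch_y\<close> vanishes) and of equal length (\<open>bloch_z\<close> vanishes), so they
    are equal or opposite.\<close>
  have "(c = a \<and> d = b) \<or> (c = -a \<and> d = -b)"
    if "b * c - a * d = 0" and sq: "a\<^sup>2 + b\<^sup>2 = c\<^sup>2 + d\<^sup>2" "a \<noteq> 0 \<or> b \<noteq> 0 \<or> c \<noteq> 0 \<or> d \<noteq> 0"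
  proof -
    have "(a - c) * (a + c) * (a\<^sup>2 + b\<^sup>2) = 0" "(b - d) * (b + d) * (a\<^sup>2 + b\<^sup>2) = 0"
      using that(1,2) by algebra+
    moreover have nz: "a\<^sup>2 + b\<^sup>2 \<noteq> 0" using sq by (metis sum_power2_eq_zero_iff)
    ultimately have "c = a \<or> c = -a" "d = b \<or> d = -b" by auto
    then show ?thesis using that(1) nz by auto
  qed
  moreover have "e \<propto> XY 0 \<or> e \<propto> XY pi \<longleftrightarrow> (a \<noteq> 0 \<or> b \<noteq> 0) \<and> ((c = a \<and> d = b) \<or> (c = -a \<and> d = -b))"
    unfolding prop_to_XY by (auto simp: e complex_eq_iff)
  moreover have "e \<noteq> 0 \<and> bloch_y e = 0 \<and> bloch_z e = 0 \<longleftrightarrow>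
      (a \<noteq> 0 \<or> b \<noteq> 0 \<or> c \<noteq> 0 \<or> d \<noteq> 0) \<and> b * c - a * d = 0 \<and> a\<^sup>2 + b\<^sup>2 = c\<^sup>2 + d\<^sup>2"
    by (auto simp: e qvec_eq_iff bloch_defs cmod_power2 complex_eq_iff)
  ultimately show ?thesis by (smt (verit, best) mult.commute mult_minus_left mult_minus_right power2_minus)
qed

lemma is_Y_iff: "e \<propto> XY (pi/2) \<or> e \<propto> XY (- pi/2) \<longleftrightarrow> e \<noteq> 0 \<and> bloch_x e = 0 \<and> bloch_z e = 0"
proof -
  obtain a b c d where e: "e $ False = Complex a b" "e $ True = Complex c d" by (metis complex.exhaust)
  \<comment> \<open>Here the components are orthogonal and of equal length, so one is a quarter turn
    of the other.\<close>
  have "(c = -b \<and> d = a) \<or> (c = b \<and> d = -a)"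
    if "a * c + b * d = 0" and sq: "a\<^sup>2 + b\<^sup>2 = c\<^sup>2 + d\<^sup>2" "a \<noteq> 0 \<or> b \<noteq> 0 \<or> c \<noteq> 0 \<or> d \<noteq> 0"
  proof -
    have "(b - c) * (b + c) * (a\<^sup>2 + b\<^sup>2) = 0" "(a - d) * (a + d) * (a\<^sup>2 + b\<^sup>2) = 0"
      using that(1,2) by algebra+
    moreover have nz: "a\<^sup>2 + b\<^sup>2 \<noteq> 0" using sq by (metis sum_power2_eq_zero_iff)
    ultimately have "c = b \<or> c = -b" "d = a \<or> d = -a" by auto
    then show ?thesis using that(1) nz by auto
  qed
  moreover have m: "cis (- pi / 2) = - \<i>" by (simp add: cis.code complex_eq_iff)
  have "e \<propto> XY (pi/2) \<or> e \<propto> XY (- pi/2) \<longleftrightarrow> (a \<noteq> 0 \<or> b \<noteq> 0) \<and> ((c = -b \<and> d = a) \<or> (c = b \<and> d = -a))"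
    unfolding prop_to_XY m by (auto simp: e complex_eq_iff)
  moreover have "e \<noteq> 0 \<and> bloch_x e = 0 \<and> bloch_z e = 0 \<longleftrightarrow>
      (a \<noteq> 0 \<or> b \<noteq> 0 \<or> c \<noteq> 0 \<or> d \<noteq> 0) \<and> a * c + b * d = 0 \<and> a\<^sup>2 + b\<^sup>2 = c\<^sup>2 + d\<^sup>2"
    by (auto simp: e qvec_eq_iff bloch_defs cmod_power2 complex_eq_iff)
  ultimately show ?thesis by (smt (verit, best) mult.commute mult_minus_left mult_minus_right power2_minus)
qed

lemma is_Z_iff: "e \<propto> YZ 0 \<or> e \<propto> YZ pi \<longleftrightarrow> e \<noteq> 0 \<and> bloch_x e = 0 \<and> bloch_y e = 0"
proof -
  have "bloch_x e = 0 \<and> bloch_y e = 0 \<longleftrightarrow> e $ False * cnj (e $ True) = 0"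
    by (simp only: bloch_defs complex_eq_iff zero_complex.sel)
  also have "\<dots> \<longleftrightarrow> e $ False = 0 \<or> e $ True = 0" by simp
  finally have "bloch_x e = 0 \<and> bloch_y e = 0 \<longleftrightarrow> e $ False = 0 \<or> e $ True = 0" .
  moreover have "e \<propto> YZ 0 \<longleftrightarrow> e $ False \<noteq> 0 \<and> e $ True = 0"
    unfolding prop_to_YZ by (auto simp: algebra_simps)
  moreover have "e \<propto> YZ pi \<longleftrightarrow> e $ True \<noteq> 0 \<and> e $ False = 0"
    unfolding prop_to_YZ by (auto simp: algebra_simps)
  ultimately show ?thesis by (auto simp: qvec_eq_iff)
qed

lemma bloch_zero: "bloch_x e = 0 \<Longrightarrow> bloch_y e = 0 \<Longrightarrow> bloch_z e = 0 \<Longrightarrow> e = 0"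
proof -
  assume *: "bloch_x e = 0" "bloch_y e = 0" "bloch_z e = 0"
  then have "e $ False * cnj (e $ True) = 0"
    by (simp only: bloch_defs complex_eq_iff zero_complex.sel)
  then show "e = 0" using *(3) by (auto simp: bloch_z_def qvec_eq_iff)
qed

text \<open>The label depends only on which coordinates vanish. Hence an operator that permutes the
  coordinates up to non-zero factors permutes the labels, whatever the angles are.\<close>

lemma pauli_label_bloch:
  assumes "is_effect e"
  shows "pauli_label e =
     (if bloch_y e = 0 \<and> bloch_z e = 0 then LX
      else if bloch_x e = 0 \<and> bloch_z e = 0 then LY
      else if bloch_x e = 0 \<and> bloch_y e = 0 then LZ
      else if bloch_z e = 0 then LXY
      else if bloch_y e = 0 then LXZ else LYZ)"
  using assms unfolding pauli_label_def is_X_iff is_Y_iff is_Z_iff in_XY in_XZ is_effect_bloch by simp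

text \<open>The operator at the centre of a local complementation is a quarter turn about the X
  axis, the one at its neighbours about the Z axis. So \<open>lc_self\<close> exchanges the roles of
  Y and Z, and \<open>lc_nbr\<close> those of X and Y.\<close>

fun lc_self :: "label \<Rightarrow> label" where
  "lc_self LX = LX" | "lc_self LY = LZ" | "lc_self LZ = LY"
| "lc_self LXY = LXZ" | "lc_self LXZ = LXY" | "lc_self LYZ = LYZ"

fun lc_nbr :: "label \<Rightarrow> label" where
  "lc_nbr LX = LY" | "lc_nbr LY = LX" | "lc_nbr LZ = LZ"
| "lc_nbr LXY = LXY" | "lc_nbr LXZ = LYZ" | "lc_nbr LYZ = LXZ"

lemma cmod_sq: "(cmod z)\<^sup>2 = Re z * Re z + Im z * Im z"
  by (simp add: cmod_power2 flip: power2_eq_square)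

text \<open>The factors 2 and -1/2 only reflect that \<open>bloch_z\<close> is not halved; up to
  sign the y and z coordinates are exchanged.\<close>

lemma bloch_lc_op: "bloch_x (e v* lc_op) = bloch_x e"
  "bloch_y (e v* lc_op) = bloch_z e / -2" "bloch_z (e v* lc_op) = 2 * bloch_y e"
  unfolding bloch_defs cmod_sq by (simp_all add: field_simps)

lemma bloch_diag_i: "bloch_x (e v* diag1 \<i>) = bloch_y e"
  "bloch_y (e v* diag1 \<i>) = - bloch_x e" "bloch_z (e v* diag1 \<i>) = bloch_z e"
  by (simp_all add: bloch_defs norm_mult)

lemma bloch_diag_sign: "bloch_x (e v* diag1 ((-1) ^ a)) = (-1) ^ a * bloch_x e"
  "bloch_y (e v* diag1 ((-1) ^ a)) = (-1) ^ a * bloch_y e"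
  "bloch_z (e v* diag1 ((-1) ^ a)) = bloch_z e"
  by (cases "even a"; simp add: bloch_defs norm_mult)+

lemma nonzero_lc_op: "e v* lc_op = 0 \<Longrightarrow> e = 0"
proof -
  assume "e v* lc_op = 0"
  then have "(1 - \<i>) * e $ False + (1 + \<i>) * e $ True = 0" "(1 + \<i>) * e $ False + (1 - \<i>) * e $ True = 0"
    by (auto simp: qvec_eq_iff)
  then show "e = 0" by (auto simp: qvec_eq_iff complex_eq_iff)
qed

lemma effect_lc_op:
  assumes "is_effect e"
  shows "is_effect (e v* lc_op)" "pauli_label (e v* lc_op) = lc_self (pauli_label e)"
proof -
  show *: "is_effect (e v* lc_op)"
    using assms nonzero_lc_op[of e] by (auto simp: is_effect_bloch bloch_lc_op)
  show "pauli_label (e v* lc_op) = lc_self (pauli_label e)"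
    using assms[unfolded is_effect_bloch] bloch_zero[of e]
    by (auto simp: pauli_label_bloch[OF assms] pauli_label_bloch[OF *] bloch_lc_op)
qed

lemma effect_diag_i:
  assumes "is_effect e"
  shows "is_effect (e v* diag1 \<i>)" "pauli_label (e v* diag1 \<i>) = lc_nbr (pauli_label e)"
proof -
  show *: "is_effect (e v* diag1 \<i>)"
    using assms by (auto simp: is_effect_bloch bloch_diag_i qvec_eq_iff)
  show "pauli_label (e v* diag1 \<i>) = lc_nbr (pauli_label e)"
    using assms[unfolded is_effect_bloch] bloch_zero[of e]
    by (auto simp: pauli_label_bloch[OF assms] pauli_label_bloch[OF *] bloch_diag_i)
qed

lemma effect_diag_sign:
  assumes "is_effect e"
  shows "is_effect (e v* diag1 ((-1) ^ a))" "pauli_label (e v* diag1 ((-1) ^ a)) = pauli_label e"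
proof -
  show *: "is_effect (e v* diag1 ((-1) ^ a))"
    using assms by (auto simp: is_effect_bloch bloch_diag_sign qvec_eq_iff)
  show "pauli_label (e v* diag1 ((-1) ^ a)) = pauli_label e"
    by (simp add: pauli_label_bloch[OF assms] pauli_label_bloch[OF *] bloch_diag_sign)
qed

lemma is_effect_XY [simp]: "is_effect (XY \<alpha>)" and is_effect_YZ [simp]: "is_effect (YZ \<alpha>)"
  unfolding is_effect_def by (metis prop_to_refl)+

lemma pauli_label_XY0 [simp]: "pauli_label (XY 0) = LX"
  unfolding pauli_label_def by simp

lemma pauli_label_YZ0 [simp]: "pauli_label (YZ 0) = LZ"
proof -
  have "\<not> YZ 0 \<propto> XY \<alpha>" for \<alpha>
    by (auto simp: prop_to_XY YZ_apply)
  then show ?thesis unfolding pauli_label_def by auto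
qed

lemma pauli_label_planes:
  assumes "is_effect e"
  shows "pauli_label e \<in> {LX, LY, LXY} \<Longrightarrow> \<exists>\<alpha>. e \<propto> XY \<alpha>"
    and "pauli_label e = LYZ \<Longrightarrow> \<exists>\<alpha>. e \<propto> YZ \<alpha>"
    and "pauli_label e = LZ \<Longrightarrow> \<exists>a\<in>{0, 1::nat}. e \<propto> YZ (real a * pi)"
proof -
  have *: "e \<noteq> 0" "bloch_x e = 0 \<or> bloch_y e = 0 \<or> bloch_z e = 0"
    using assms by (auto simp: is_effect_bloch)
  show "\<exists>\<alpha>. e \<propto> XY \<alpha>" if "pauli_label e \<in> {LX, LY, LXY}"
    using that * by (auto simp: in_XY pauli_label_bloch[OF assms] split: if_splits)
  show "\<exists>\<alpha>. e \<propto> YZ \<alpha>" if "pauli_label e = LYZ"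
    using that * by (auto simp: in_YZ pauli_label_bloch[OF assms] split: if_splits)
  show "\<exists>a\<in>{0, 1::nat}. e \<propto> YZ (real a * pi)" if "pauli_label e = LZ"
    using that by (auto simp: pauli_label_def split: if_splits)
qed

section \<open>Pauli flow on labelled graphs\<close>

text \<open>Adjacency is a predicate and not a set of edges: local complements, pivots and their
  composites are then Boolean formulas, and identities between them reduce to case
  distinctions.\<close>

definition graph_on :: "'v set \<Rightarrow> ('v \<Rightarrow> 'v \<Rightarrow> bool) \<Rightarrow> bool" where
  "graph_on V E \<longleftrightarrow> finite V \<and> (\<forall>u v. E u v \<longrightarrow> u \<in> V \<and> v \<in> V \<and> u \<noteq> v \<and> E v u)"

lemma graph_onD:
  assumes "graph_on V E"
  shows "finite V" "E u v \<Longrightarrow> u \<in> V" "E u v \<Longrightarrow> v \<in> V" "E u v \<Longrightarrow> E v u" "\<not> E u u"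
  using assms by (auto simp: graph_on_def)

lemma graph_on_sym: "graph_on V E \<Longrightarrow> E u v \<longleftrightarrow> E v u"
  by (auto simp: graph_on_def)

text \<open>Membership of \<open>v\<close> in the odd neighbourhood of \<open>A\<close>; linear in
  \<open>A\<close> over the field with two elements.\<close>

definition par :: "('v \<Rightarrow> 'v \<Rightarrow> bool) \<Rightarrow> 'v set \<Rightarrow> 'v \<Rightarrow> bool" where
  "par E A v \<longleftrightarrow> odd (card {x \<in> A. E v x})"

lemma odd_card_sym_diff:
  assumes "finite A" "finite B"
  shows "odd (card (sym_diff A B)) \<longleftrightarrow> odd (card A) \<noteq> odd (card B)"
proof -
  have "card (sym_diff A B) = card (A - B) + card (B - A)"
    using assms by (intro card_Un_disjoint) auto
  moreover have "card A = card (A - B) + card (A \<inter> B)" "card B = card (B - A) + card (A \<inter> B)"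
    using assms by (metis card_Diff_subset_Int card_Int_Diff add.commute Int_commute finite_Int)+
  ultimately show ?thesis by presburger
qed

lemma par_sym_diff:
  assumes "finite A" "finite B"
  shows "par E (sym_diff A B) v \<longleftrightarrow> par E A v \<noteq> par E B v"
proof -
  have e: "{x \<in> sym_diff A B. E v x} = sym_diff {x \<in> A. E v x} {x \<in> B. E v x}" by auto
  show ?thesis unfolding par_def e by (rule odd_card_sym_diff) (simp_all add: assms)
qed

lemma par_singleton [simp]: "par E {a} v \<longleftrightarrow> E v a"
proof -
  have "{x \<in> {a}. E v x} = (if E v a then {a} else {})" by auto
  then show ?thesis by (simp add: par_def)
qed

lemma par_empty [simp]: "\<not> par E {} v"
  by (simp add: par_def)

lemma par_cong: "(\<And>x. x \<in> A \<Longrightarrow> E v x \<longleftrightarrow> E' v' x) \<Longrightarrow> par E A v \<longleftrightarrow> par E' A v'"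
  unfolding par_def by (metis (mono_tags, lifting) Collect_cong)

lemma par_neq: "finite A \<Longrightarrow> (\<And>x. x \<in> A \<Longrightarrow> F x \<longleftrightarrow> E v x \<noteq> E' v' x) \<Longrightarrow>
  odd (card {x \<in> A. F x}) \<longleftrightarrow> par E A v \<noteq> par E' A v'"
proof -
  assume "finite A" and F: "\<And>x. x \<in> A \<Longrightarrow> F x \<longleftrightarrow> E v x \<noteq> E' v' x"
  have e: "{x \<in> A. F x} = sym_diff {x \<in> A. E v x} {x \<in> A. E' v' x}" by (auto simp: F)
  show ?thesis unfolding par_def e by (rule odd_card_sym_diff) (simp_all add: \<open>finite A\<close>)
qed

text \<open>A Pauli operator is encoded by two bits: \<open>x\<close> for an X-part and \<open>z\<close> for a Z-part.
  \<open>detects\<close> holds if the operator does not fix the effects with the given label, and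
  \<open>flips\<close> if it maps them to orthogonal ones.\<close>

definition detects :: "label \<Rightarrow> bool \<Rightarrow> bool \<Rightarrow> bool" where
  "detects l x z = (case l of LX \<Rightarrow> z | LY \<Rightarrow> x \<noteq> z | LZ \<Rightarrow> x | _ \<Rightarrow> x \<or> z)"

definition flips :: "label \<Rightarrow> bool \<Rightarrow> bool \<Rightarrow> bool" where
  "flips l x z = (case l of LX \<Rightarrow> z | LY \<Rightarrow> x \<noteq> z | LZ \<Rightarrow> x
     | LXY \<Rightarrow> \<not> x \<and> z | LXZ \<Rightarrow> x \<and> z | LYZ \<Rightarrow> x \<and> \<not> z)"

definition hit :: "'v set \<Rightarrow> ('v \<Rightarrow> label) \<Rightarrow> 'v \<Rightarrow> bool \<Rightarrow> bool \<Rightarrow> bool" where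
  "hit O' l v x z = (if v \<in> O' then x \<or> z else detects (l v) x z)"

text \<open>The set \<open>p u\<close> stands for the stabiliser of the graph state with X-parts \<open>p u\<close> and Z-parts on the
  odd neighbourhood of \<open>p u\<close>; acyclicity of the order is replaced by a rank function \<open>h\<close>.\<close>

definition pflow ::
  "'v set \<Rightarrow> ('v \<Rightarrow> 'v \<Rightarrow> bool) \<Rightarrow> 'v set \<Rightarrow> 'v set \<Rightarrow> ('v \<Rightarrow> label) \<Rightarrow> ('v \<Rightarrow> 'v set) \<Rightarrow> ('v \<Rightarrow> nat) \<Rightarrow> bool" where
  "pflow V E I O' l p h \<longleftrightarrow> (\<forall>u \<in> V - O'. p u \<subseteq> V - I \<and> flips (l u) (u \<in> p u) (par E (p u) u) \<and>
     (\<forall>v \<in> V. v \<noteq> u \<longrightarrow> hit O' l v (v \<in> p u) (par E (p u) v) \<longrightarrow> h u < h v))"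

lemma detects_simps [simp]:
  "detects LX x z = z" "detects LZ x z = x" "\<not> detects l False False" "flips LX x z = z" "flips LZ x z = x"
  by (auto simp: detects_def flips_def split: label.splits)

section \<open>Products of Pauli operators\<close>

lemma detects_xor: "\<not> detects l x z \<Longrightarrow> \<not> detects l x' z' \<Longrightarrow> \<not> detects l (x \<noteq> x') (z \<noteq> z')"
  by (cases l) (auto simp: detects_def)

lemma hit_xor: "\<not> hit O' l v x z \<Longrightarrow> \<not> hit O' l v x' z' \<Longrightarrow> \<not> hit O' l v (x \<noteq> x') (z \<noteq> z')"
  using detects_xor by (auto simp: hit_def)

lemma flips_xor: "flips l x z \<Longrightarrow> \<not> detects l x' z' \<Longrightarrow> flips l (x \<noteq> x') (z \<noteq> z')"
  by (cases l) (auto simp: detects_def flips_def)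

lemma flips_detects: "flips l x z \<Longrightarrow> detects l x z"
  by (cases l) (auto simp: detects_def flips_def)

text \<open>For a Pauli label, detection is a linear functional of the two bits, so two detected
  operators have an undetected product. This fails for the planes, which is why focusing concerns
  Pauli-measured vertices.\<close>

lemma detects_pauli_xor:
  "l \<in> {LX, LY, LZ} \<Longrightarrow> detects l x z \<Longrightarrow> detects l x' z' \<Longrightarrow> \<not> detects l (x \<noteq> x') (z \<noteq> z')"
  by (auto simp: detects_def)

section \<open>Local complementation\<close>

definition lc_adj :: "('v \<Rightarrow> 'v \<Rightarrow> bool) \<Rightarrow> 'v \<Rightarrow> 'v \<Rightarrow> 'v \<Rightarrow> bool" where
  "lc_adj E u v w \<longleftrightarrow> E v w \<noteq> (E u v \<and> E u w \<and> v \<noteq> w)"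

definition lc_lab :: "('v \<Rightarrow> 'v \<Rightarrow> bool) \<Rightarrow> 'v \<Rightarrow> ('v \<Rightarrow> label) \<Rightarrow> 'v \<Rightarrow> label" where
  "lc_lab E u l w = (if w = u then lc_self (l w) else if E u w then lc_nbr (l w) else l w)"

text \<open>The new bits are those of the Pauli operator conjugated by the same quarter turn: about
  X the Z-bit is added to the X-bit, about Z the X-bit to the Z-bit. Turning operator and effect
  together preserves what is detected and what is flipped.\<close>

lemma detects_lc:
  assumes "\<not> (self \<and> nbr)"
  shows "detects (if self then lc_self l else if nbr then lc_nbr l else l)
      (if self then x \<noteq> z else x) (if nbr then z \<noteq> x else z) = detects l x z"
    and "flips (if self then lc_self l else if nbr then lc_nbr l else l)
      (if self then x \<noteq> z else x) (if nbr then z \<noteq> x else z) = flips l x z"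
  using assms by (cases l; auto simp: detects_def flips_def)+

text \<open>\<open>A'\<close> encodes the same stabiliser after the local quarter turns: the X-bit
  at \<open>u\<close> picks up the Z-bit there, which is \<open>par E A u\<close>, and this decides
  whether \<open>u\<close> is toggled.\<close>

lemma lc_par:
  fixes u w :: 'v
  assumes g: "graph_on V E" and A: "finite A"
  defines "A' \<equiv> if par E A u then sym_diff A {u} else A"
  shows "par (lc_adj E u) A' w \<longleftrightarrow> (if E u w then par E A w \<noteq> (w \<in> A) else par E A w)"
    and "w \<in> A' \<longleftrightarrow> (if w = u then (u \<in> A) \<noteq> par E A u else w \<in> A)"
proof -
  show "w \<in> A' \<longleftrightarrow> (if w = u then (u \<in> A) \<noteq> par E A u else w \<in> A)" by (auto simp: A'_def)
  have fA': "finite A'" using A by (auto simp: A'_def)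
  have p: "par E A' x \<longleftrightarrow> par E A x \<noteq> (par E A u \<and> E x u)" for x
    using par_sym_diff[OF A, of "{u}"] by (auto simp: A'_def)
  show "par (lc_adj E u) A' w \<longleftrightarrow> (if E u w then par E A w \<noteq> (w \<in> A) else par E A w)"
  proof (cases "E u w")
    case False
    then have "par (lc_adj E u) A' w \<longleftrightarrow> par E A' w" by (intro par_cong) (auto simp: lc_adj_def)
    then show ?thesis using False p[of w] graph_on_sym[OF g, of u w] by auto
  next
    case True
    then have wu: "w \<noteq> u" using g by (auto simp: graph_on_def)
    \<comment> \<open>Row \<open>w\<close> of the complemented graph is the sum of the rows of
      \<open>w\<close> and \<open>u\<close> and of the indicator of \<open>w\<close>; the indicator
      removes the loop and contributes the X-bit at \<open>w\<close>.\<close>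
    have "par (lc_adj E u) A' w \<longleftrightarrow> par E A' w \<noteq> par (\<lambda>v x. E v x \<noteq> (x = w)) A' u"
      unfolding par_def[of "lc_adj E u"]
      using True graph_onD(5)[OF g] by (intro par_neq fA') (auto simp: lc_adj_def)
    also have "par (\<lambda>v x. E v x \<noteq> (x = w)) A' u \<longleftrightarrow> par E A' u \<noteq> par (\<lambda>_ x. x = w) A' w"
      unfolding par_def[of "\<lambda>v x. E v x \<noteq> (x = w)"] by (intro par_neq fA') auto
    also have "par (\<lambda>_ x. x = w) A' w \<longleftrightarrow> w \<in> A"
    proof -
      have "{x \<in> A'. x = w} = (if w \<in> A then {w} else {})" using wu by (auto simp: A'_def)
      then show ?thesis by (simp add: par_def)
    qed
    finally show ?thesis using p[of w] p[of u] True graph_onD(4)[OF g True] graph_onD(5)[OF g, of u] by auto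
  qed
qed

text \<open>The ranks stay the same, because detection is invariant when bits and labels turn
  together, so the new correction sets hit no other vertices than the old ones.\<close>

lemma pflow_lc:
  assumes g: "graph_on V E" and f: "pflow V E I O' l p h"
    and u: "u \<in> V" "u \<notin> I" "u \<notin> O'" "\<And>w. E u w \<Longrightarrow> w \<notin> O'"
  shows "pflow V (lc_adj E u) I O' (lc_lab E u l) (\<lambda>v. if par E (p v) u then sym_diff (p v) {u} else p v) h"
  unfolding pflow_def
proof (intro ballI conjI impI)
  fix v assume v: "v \<in> V - O'"
  have pv: "p v \<subseteq> V - I" and fl: "flips (l v) (v \<in> p v) (par E (p v) v)"
    and ord: "\<And>w. w \<in> V \<Longrightarrow> w \<noteq> v \<Longrightarrow> hit O' l w (w \<in> p v) (par E (p v) w) \<Longrightarrow> h v < h w"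
    using f v by (auto simp: pflow_def)
  have fin: "finite (p v)" using pv graph_onD(1)[OF g] by (meson Diff_subset finite_subset)
  note lp = lc_par[OF g fin, of u]
  let ?A = "if par E (p v) u then sym_diff (p v) {u} else p v"
  show "?A \<subseteq> V - I" using pv u by auto
  have d: "detects (lc_lab E u l w) (w \<in> ?A) (par (lc_adj E u) ?A w) = detects (l w) (w \<in> p v) (par E (p v) w)"
    "flips (lc_lab E u l w) (w \<in> ?A) (par (lc_adj E u) ?A w) = flips (l w) (w \<in> p v) (par E (p v) w)" for w
  proof -
    have X: "w \<in> ?A \<longleftrightarrow> (if w = u then (w \<in> p v) \<noteq> par E (p v) w else w \<in> p v)" by auto
    have nE: "\<not> (w = u \<and> E u w)" using graph_onD(5)[OF g] by auto
    show "detects (lc_lab E u l w) (w \<in> ?A) (par (lc_adj E u) ?A w) = detects (l w) (w \<in> p v) (par E (p v) w)"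
      "flips (lc_lab E u l w) (w \<in> ?A) (par (lc_adj E u) ?A w) = flips (l w) (w \<in> p v) (par E (p v) w)"
      unfolding lc_lab_def lp(1) X by (rule detects_lc[OF nE])+
  qed
  show "flips (lc_lab E u l v) (v \<in> ?A) (par (lc_adj E u) ?A v)" using fl d by simp
  fix w assume w: "w \<in> V" "w \<noteq> v" and h: "hit O' (lc_lab E u l) w (w \<in> ?A) (par (lc_adj E u) ?A w)"
  have "hit O' l w (w \<in> p v) (par E (p v) w)"
  proof (cases "w \<in> O'")
    \<comment> \<open>Outputs have no label that could follow a quarter turn; but neither
      \<open>u\<close> nor a neighbour of \<open>u\<close> is an output, so the bits at
      \<open>w\<close> are unchanged.\<close>
    case True
    then have "w \<noteq> u" "\<not> E u w" using u by auto
    moreover from this have "w \<in> ?A \<longleftrightarrow> w \<in> p v" by auto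
    ultimately show ?thesis using h True unfolding hit_def lp(1) by simp
  next
    case False then show ?thesis using h d unfolding hit_def by simp
  qed
  then show "h v < h w" using ord w by blast
qed

section \<open>Vertices measured in the Z basis\<close>

definition ins_adj :: "('v \<Rightarrow> 'v \<Rightarrow> bool) \<Rightarrow> 'v \<Rightarrow> 'v set \<Rightarrow> 'v \<Rightarrow> 'v \<Rightarrow> bool" where
  "ins_adj E z N v w \<longleftrightarrow> E v w \<or> v = z \<and> w \<in> N \<or> w = z \<and> v \<in> N"

definition del_adj :: "('v \<Rightarrow> 'v \<Rightarrow> bool) \<Rightarrow> 'v \<Rightarrow> 'v \<Rightarrow> 'v \<Rightarrow> bool" where
  "del_adj E z v w \<longleftrightarrow> E v w \<and> v \<noteq> z \<and> w \<noteq> z"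

text \<open>\<open>{z}\<close> corrects \<open>z\<close>, since X flips an effect of label Z, and
  disturbs only \<open>N\<close>; so \<open>z\<close> gets rank 0 and the other ranks are shifted.
  Old correction sets do not contain \<open>z\<close>, and label Z ignores Z-parts, so
  \<open>z\<close> is never hit.\<close>

lemma pflow_ins:
  assumes g: "graph_on V E" and f: "pflow V E I O' l p h"
    and z: "z \<notin> V" "N \<subseteq> V" "I \<subseteq> V" "O' \<subseteq> V"
  shows "pflow (insert z V) (ins_adj E z N) I O' (l(z := LZ)) (p(z := {z})) (\<lambda>v. if v = z then 0 else Suc (h v))"
  unfolding pflow_def
proof (intro ballI)
  fix u assume u: "u \<in> insert z V - O'"
  show "(p(z := {z})) u \<subseteq> insert z V - I \<and>
    flips ((l(z := LZ)) u) (u \<in> (p(z := {z})) u) (par (ins_adj E z N) ((p(z := {z})) u) u) \<and>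
    (\<forall>v\<in>insert z V. v \<noteq> u \<longrightarrow>
        hit O' (l(z := LZ)) v (v \<in> (p(z := {z})) u) (par (ins_adj E z N) ((p(z := {z})) u) v) \<longrightarrow>
        (if u = z then 0 else Suc (h u)) < (if v = z then 0 else Suc (h v)))"
  proof (cases "u = z")
    case True then show ?thesis using z by (auto simp: flips_def)
  next
    case False
    then have uV: "u \<in> V - O'" using u by auto
    then have pu: "p u \<subseteq> V - I" using f by (auto simp: pflow_def)
    have "par (ins_adj E z N) (p u) v = par E (p u) v" if "v \<noteq> z" for v
      using pu z that by (intro par_cong) (auto simp: ins_adj_def)
    note par_old = this
    have zp: "z \<notin> p u" using pu z by auto
    have "(p(z := {z})) u = p u" using False by simp
    moreover have "flips ((l(z := LZ)) u) (u \<in> p u) (par (ins_adj E z N) (p u) u)"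
      using uV f False by (simp add: pflow_def par_old)
    moreover have "(if u = z then 0 else Suc (h u)) < (if v = z then 0 else Suc (h v))"
      if v: "v \<in> insert z V" "v \<noteq> u" and hv: "hit O' (l(z := LZ)) v (v \<in> p u) (par (ins_adj E z N) (p u) v)" for v
    proof -
      have vz: "v \<noteq> z"
        using hv zp z unfolding hit_def by (auto split: if_splits)
      then have "hit O' l v (v \<in> p u) (par E (p u) v)" using hv by (simp add: hit_def par_old split: if_splits)
      then have "h u < h v" using f uV v vz by (auto simp: pflow_def)
      then show ?thesis using vz False by simp
    qed
    ultimately show ?thesis using pu by auto
  qed
qed

text \<open>A vertex measured in a Pauli basis need not be corrected by the others: whenever \<open>p u\<close> affects
  it, multiply by its own correction.\<close>

lemma pflow_focus_step:
  assumes g: "graph_on V E" and f: "pflow V E I O' l p h"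
    and a: "a \<in> V - O'" "l a \<in> {LX, LY, LZ}"
  defines "p' \<equiv> \<lambda>u. if u \<noteq> a \<and> detects (l a) (a \<in> p u) (par E (p u) a) then sym_diff (p u) (p a) else p u"
  shows "pflow V E I O' l p' h"
    and "u \<in> V - O' \<Longrightarrow> u \<noteq> a \<Longrightarrow> \<not> detects (l a) (a \<in> p' u) (par E (p' u) a)"
    and "u \<in> V - O' \<Longrightarrow> v \<noteq> a \<Longrightarrow> \<not> detects (l v) (v \<in> p u) (par E (p u) v) \<Longrightarrow>
      \<not> detects (l v) (v \<in> p a) (par E (p a) v) \<Longrightarrow> \<not> detects (l v) (v \<in> p' u) (par E (p' u) v)"
proof -
  have fin: "finite (p u)" if "u \<in> V - O'" for u
    using f that graph_onD(1)[OF g] unfolding pflow_def by (meson Diff_subset finite_subset)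
  have ord: "h u < h v" if "u \<in> V - O'" "v \<in> V" "v \<noteq> u" "hit O' l v (v \<in> p u) (par E (p u) v)" for u v
    using f that by (auto simp: pflow_def)
  have fl: "flips (l u) (u \<in> p u) (par E (p u) u)" "p u \<subseteq> V - I" if "u \<in> V - O'" for u
    using f that by (auto simp: pflow_def)
  have x: "v \<in> sym_diff (p u) (p a) \<longleftrightarrow> (v \<in> p u) \<noteq> (v \<in> p a)" for u v by auto
  have z: "par E (sym_diff (p u) (p a)) v \<longleftrightarrow> par E (p u) v \<noteq> par E (p a) v" if "u \<in> V - O'" for u v
    by (rule par_sym_diff[OF fin[OF that] fin[OF a(1)]])
  have aO: "a \<notin> O'" using a by auto
  have da: "detects (l a) (a \<in> p a) (par E (p a) a)" using fl(1)[OF a(1)] flips_detects by blast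
  show 2: "\<not> detects (l a) (a \<in> p' u) (par E (p' u) a)" if "u \<in> V - O'" "u \<noteq> a" for u
  proof (cases "detects (l a) (a \<in> p u) (par E (p u) a)")
    case True
    then have e: "p' u = sym_diff (p u) (p a)" using that by (simp add: p'_def)
    show ?thesis unfolding e x z[OF that(1)] by (rule detects_pauli_xor[OF a(2) True da])
  next
    case False then show ?thesis unfolding p'_def by simp
  qed
  show "\<not> detects (l v) (v \<in> p' u) (par E (p' u) v)"
    if "u \<in> V - O'" "v \<noteq> a" "\<not> detects (l v) (v \<in> p u) (par E (p u) v)"
      "\<not> detects (l v) (v \<in> p a) (par E (p a) v)" for u v
  proof (cases "u \<noteq> a \<and> detects (l a) (a \<in> p u) (par E (p u) a)")
    case True
    then have e: "p' u = sym_diff (p u) (p a)" by (simp add: p'_def)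
    show ?thesis unfolding e x z[OF that(1)] by (rule detects_xor[OF that(3,4)])
  next
    case False
    then have "p' u = p u" by (auto simp: p'_def)
    then show ?thesis using that by simp
  qed
  show "pflow V E I O' l p' h"
    unfolding pflow_def
  proof (intro ballI conjI impI)
    fix u assume u: "u \<in> V - O'"
    show "p' u \<subseteq> V - I" using fl(2)[OF u] fl(2)[OF a(1)] unfolding p'_def by auto
    have au: "h u < h a" if "u \<noteq> a" "detects (l a) (a \<in> p u) (par E (p u) a)"
      using ord[OF u _ _ ] a aO that by (auto simp: hit_def)
    have nd: "\<not> detects (l u) (u \<in> p a) (par E (p a) u)" if "u \<noteq> a" "detects (l a) (a \<in> p u) (par E (p u) a)"
      using ord[OF a(1), of u] au[OF that] u that by (auto simp: hit_def)
    show "flips (l u) (u \<in> p' u) (par E (p' u) u)"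
    proof (cases "u \<noteq> a \<and> detects (l a) (a \<in> p u) (par E (p u) a)")
      case True
      then have e: "p' u = sym_diff (p u) (p a)" by (simp add: p'_def)
      show ?thesis unfolding e x z[OF u] by (rule flips_xor[OF fl(1)[OF u] nd]) (use True in auto)
    next
      case False
      then have "p' u = p u" by (auto simp: p'_def)
      then show ?thesis using fl(1)[OF u] by simp
    qed
    fix v assume v: "v \<in> V" "v \<noteq> u" and hv: "hit O' l v (v \<in> p' u) (par E (p' u) v)"
    show "h u < h v"
    proof (cases "u \<noteq> a \<and> detects (l a) (a \<in> p u) (par E (p u) a)")
      case False then show ?thesis using hv ord[OF u v] unfolding p'_def by auto
    next
      case True
      then have e: "p' u = sym_diff (p u) (p a)" by (simp add: p'_def)
      have "v \<noteq> a" using 2[OF u] True hv aO by (auto simp: hit_def)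
      moreover have "hit O' l v (v \<in> p u) (par E (p u) v) \<or> hit O' l v (v \<in> p a) (par E (p a) v)"
        using hv hit_xor[of O' l v "v \<in> p u" "par E (p u) v" "v \<in> p a" "par E (p a) v"]
        unfolding e by (simp only: x z[OF u]) blast
      ultimately show ?thesis using ord[OF u v] ord[OF a(1) v(1)] au True by fastforce
    qed
  qed
qed

text \<open>Focusing on one more vertex \<open>a\<close> does not spoil those treated before: they
  detect neither \<open>p u\<close> nor \<open>p a\<close>, hence not the product.\<close>

lemma pflow_focus:
  assumes g: "graph_on V E" and f: "pflow V E I O' l p h"
    and P: "finite P" "P \<subseteq> V - O'" "\<And>a. a \<in> P \<Longrightarrow> l a \<in> {LX, LY, LZ}"
  shows "\<exists>p'. pflow V E I O' l p' h \<and>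
    (\<forall>a\<in>P. \<forall>u\<in>V - O'. u \<noteq> a \<longrightarrow> \<not> detects (l a) (a \<in> p' u) (par E (p' u) a))"
  using P
proof (induction P)
  case empty then show ?case using f by auto
next
  case (insert a P)
  then obtain p1 where p1: "pflow V E I O' l p1 h"
    and foc: "\<And>b u. b \<in> P \<Longrightarrow> u \<in> V - O' \<Longrightarrow> u \<noteq> b \<Longrightarrow> \<not> detects (l b) (b \<in> p1 u) (par E (p1 u) b)"
    by (metis insert_subset insertCI)
  have a: "a \<in> V - O'" "l a \<in> {LX, LY, LZ}" using insert.prems by auto
  note st = pflow_focus_step[OF g p1 a]
  show ?case
  proof (intro exI conjI ballI impI)
    show "pflow V E I O' l (\<lambda>u. if u \<noteq> a \<and> detects (l a) (a \<in> p1 u) (par E (p1 u) a)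
        then sym_diff (p1 u) (p1 a) else p1 u) h" by (rule st(1))
    fix b u assume b: "b \<in> insert a P" and u: "u \<in> V - O'" "u \<noteq> b"
    show "\<not> detects (l b)
        (b \<in> (if u \<noteq> a \<and> detects (l a) (a \<in> p1 u) (par E (p1 u) a) then sym_diff (p1 u) (p1 a) else p1 u))
        (par E (if u \<noteq> a \<and> detects (l a) (a \<in> p1 u) (par E (p1 u) a) then sym_diff (p1 u) (p1 a) else p1 u) b)"
    proof (cases "b = a")
      case True then show ?thesis using st(2)[OF u(1)] u(2) by simp
    next
      case False
      then have bP: "b \<in> P" using b by simp
      show ?thesis by (rule st(3)[OF u(1) False foc[OF bP u] foc[OF bP a(1) False[symmetric]]])
    qed
  qed
qed

text \<open>Label Z detects exactly the X-part. After focusing on \<open>z\<close>, no other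
  correction set contains \<open>z\<close>, so removing it changes no parity.\<close>

lemma pflow_del:
  assumes g: "graph_on V E" and f: "pflow V E I O' l p h"
    and z: "z \<in> V - O'" "l z = LZ"
  shows "\<exists>p'. pflow (V - {z}) (del_adj E z) I O' l p' h"
proof -
  have "\<exists>p'. pflow V E I O' l p' h \<and>
    (\<forall>a\<in>{z}. \<forall>u\<in>V - O'. u \<noteq> a \<longrightarrow> \<not> detects (l a) (a \<in> p' u) (par E (p' u) a))"
    using z by (intro pflow_focus[OF g f]) auto
  then obtain p' where p': "pflow V E I O' l p' h" and nz: "\<And>u. u \<in> V - O' \<Longrightarrow> u \<noteq> z \<Longrightarrow> z \<notin> p' u"
    using z by (auto simp: detects_def)
  have "par (del_adj E z) (p' u) v = par E (p' u) v" if "u \<in> V - O'" "u \<noteq> z" "v \<noteq> z" for u v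
    using nz[OF that(1,2)] that(3) by (intro par_cong) (auto simp: del_adj_def)
  then have "pflow (V - {z}) (del_adj E z) I O' l p' h"
    using p' nz unfolding pflow_def by auto
  then show ?thesis by blast
qed

section \<open>Extending inputs and outputs\<close>

definition path_adj :: "('v \<Rightarrow> 'v \<Rightarrow> bool) \<Rightarrow> 'v \<Rightarrow> 'v \<Rightarrow> 'v \<Rightarrow> 'v \<Rightarrow> 'v \<Rightarrow> bool" where
  "path_adj E a b c v w \<longleftrightarrow> E v w \<or> {v, w} = {a, b} \<or> {v, w} = {b, c}"

text \<open>\<open>c\<close> was an input, so no old correction set contains it and none puts a
  Z-part on \<open>b\<close>. Being no input any more, \<open>c\<close> may correct
  \<open>b\<close>. The X-part of \<open>{b}\<close> at \<open>b\<close> is invisible to label X, so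
  \<open>a\<close> and \<open>b\<close> can share rank 0.\<close>

lemma pflow_input:
  assumes g: "graph_on V E" and f: "pflow V E I O' l p h"
    and c: "c \<in> I" "a \<notin> V" "b \<notin> V" "a \<noteq> b" "I \<subseteq> V" "O' \<subseteq> V"
  shows "pflow (V \<union> {a, b}) (path_adj E a b c) (insert a (I - {c})) O' (l(a := LX, b := LX))
    (p(a := {b}, b := {c})) (\<lambda>v. if v = a \<or> v = b then 0 else Suc (h v))"
  unfolding pflow_def
proof (intro ballI)
  let ?E = "path_adj E a b c" and ?l = "l(a := LX, b := LX)" and ?p = "p(a := {b}, b := {c})"
  let ?h = "\<lambda>v. if v = a \<or> v = b then 0 else Suc (h v)"
  have cV: "c \<in> V" "c \<noteq> a" "c \<noteq> b" using c by auto
  have nE: "\<not> E v a" "\<not> E v b" "\<not> E a v" "\<not> E b v" for v using g c by (auto simp: graph_on_def)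
  fix u assume u: "u \<in> V \<union> {a, b} - O'"
  consider "u = a" | "u = b" | "u \<in> V - O'" using u by auto
  then show "?p u \<subseteq> V \<union> {a, b} - insert a (I - {c}) \<and> flips (?l u) (u \<in> ?p u) (par ?E (?p u) u) \<and>
    (\<forall>v\<in>V \<union> {a, b}. v \<noteq> u \<longrightarrow> hit O' ?l v (v \<in> ?p u) (par ?E (?p u) v) \<longrightarrow> ?h u < ?h v)"
  proof cases
    case 1
    then show ?thesis using c cV nE by (auto simp: hit_def path_adj_def doubleton_eq_iff)
  next
    case 2
    then show ?thesis using c cV nE by (auto simp: hit_def path_adj_def doubleton_eq_iff)
  next
    case 3
    then have pu: "p u \<subseteq> V - I" using f by (auto simp: pflow_def)
    have ub: "u \<noteq> a" "u \<noteq> b" using 3 c by auto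
    have par_old: "par ?E (p u) v = par E (p u) v" for v
      using pu c cV by (intro par_cong) (auto simp: path_adj_def doubleton_eq_iff)
    have nab: "\<not> par E (p u) b" "\<not> par E (p u) a" using nE by (auto simp: par_def)
    have "?p u = p u" using ub by simp
    moreover have "flips (?l u) (u \<in> p u) (par ?E (p u) u)"
      using 3 f ub by (simp add: pflow_def par_old)
    moreover have "?h u < ?h v"
      if v: "v \<in> V \<union> {a, b}" "v \<noteq> u" and hv: "hit O' ?l v (v \<in> p u) (par ?E (p u) v)" for v
    proof -
      have vab: "v \<noteq> a" "v \<noteq> b"
        using hv nab c pu unfolding par_old hit_def by (auto split: if_splits)
      then have "hit O' l v (v \<in> p u) (par E (p u) v)" using hv by (simp add: hit_def par_old split: if_splits)
      then have "h u < h v" using f 3 v vab by (auto simp: pflow_def)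
      then show ?thesis using vab ub by simp
    qed
    ultimately show ?thesis using pu c by auto
  qed
qed

text \<open>Old correction sets containing \<open>c\<close> now put a Z-part on \<open>b\<close>, so
  \<open>b\<close> needs a rank \<open>H\<close> above all old vertices, and \<open>d\<close> one
  above that. The X-part of \<open>{b}\<close> at \<open>b\<close> is invisible to label X.\<close>

lemma pflow_output:
  assumes g: "graph_on V E" and f: "pflow V E I O' l p h"
    and c: "c \<in> O'" "b \<notin> V" "d \<notin> V" "d \<noteq> b" "I \<subseteq> V" "O' \<subseteq> V"
    and H: "\<And>v. v \<in> V \<Longrightarrow> h v < H"
  shows "pflow (V \<union> {d, b}) (path_adj E d b c) I (insert d (O' - {c})) (l(c := LX, b := LX))
    (p(c := {b}, b := {d})) (h(b := H, d := Suc H))"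
  unfolding pflow_def
proof (intro ballI)
  let ?E = "path_adj E d b c" and ?l = "l(c := LX, b := LX)" and ?p = "p(c := {b}, b := {d})"
  let ?h = "h(b := H, d := Suc H)" and ?O = "insert d (O' - {c})"
  have cV: "c \<in> V" "c \<noteq> d" "c \<noteq> b" using c by auto
  have nE: "\<not> E v d" "\<not> E v b" "\<not> E d v" "\<not> E b v" for v using g c by (auto simp: graph_on_def)
  fix u assume u: "u \<in> V \<union> {d, b} - ?O"
  consider "u = c" | "u = b" | "u \<in> V - O'" "u \<noteq> c" using u by auto
  then show "?p u \<subseteq> V \<union> {d, b} - I \<and> flips (?l u) (u \<in> ?p u) (par ?E (?p u) u) \<and>
    (\<forall>v\<in>V \<union> {d, b}. v \<noteq> u \<longrightarrow> hit ?O ?l v (v \<in> ?p u) (par ?E (?p u) v) \<longrightarrow> ?h u < ?h v)"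
  proof cases
    case 1
    then show ?thesis using c cV nE H[of c]
      by (auto simp: hit_def path_adj_def doubleton_eq_iff split: if_splits)
  next
    case 2
    then show ?thesis using c cV nE by (auto simp: hit_def path_adj_def doubleton_eq_iff)
  next
    case 3
    then have pu: "p u \<subseteq> V - I" using f by (auto simp: pflow_def)
    have par_old: "par ?E (p u) v = par E (p u) v" if "v \<noteq> b" for v
      using pu c cV that by (intro par_cong) (auto simp: path_adj_def doubleton_eq_iff)
    have nd: "\<not> par ?E (p u) d" using par_old[of d] nE c by (auto simp: par_def)
    have ub: "u \<noteq> b" "u \<noteq> d" using 3 c by auto
    have "?p u = p u" using 3 ub by simp
    moreover have "flips (?l u) (u \<in> p u) (par ?E (p u) u)"
      using 3 f ub par_old[OF ub(1)] by (auto simp: pflow_def)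
    moreover have "?h u < ?h v"
      if v: "v \<in> V \<union> {d, b}" "v \<noteq> u" and hv: "hit ?O ?l v (v \<in> p u) (par ?E (p u) v)" for v
    proof -
      have ord: "h u < h v" if "v \<in> V" "hit O' l v (v \<in> p u) (par E (p u) v)"
        using f 3 v that by (auto simp: pflow_def)
      consider "v = d" | "v = b" | "v \<in> V" "v \<noteq> d" "v \<noteq> b" using v c by auto
      then show ?thesis
      proof cases
        case 1 then show ?thesis using hv nd pu c by (auto simp: hit_def)
      next
        case 2 then show ?thesis using H[of u] 3 ub c by auto
      next
        case 3
        have "hit O' l v (v \<in> p u) (par E (p u) v)"
        proof (cases "v = c")
          case True
          then have "par ?E (p u) v" using hv 3 by (simp add: hit_def)
          then show ?thesis using True par_old[OF 3(3)] c(1) by (simp add: hit_def)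
        next
          case False
          then have "v \<in> ?O \<longleftrightarrow> v \<in> O'" "?l v = l v" using 3 by auto
          then show ?thesis using hv par_old[OF 3(3)] by (simp only: hit_def)
        qed
        then show ?thesis using ord 3 ub by auto
      qed
    qed
    ultimately show ?thesis using pu by auto
  qed
qed

lemma open_graphD:
  assumes "is_open_graph D"
  shows "finite (verts D)" "e \<in> edges D \<Longrightarrow> e \<subseteq> verts D" "e \<in> edges D \<Longrightarrow> card e = 2"
    "ins D \<subseteq> verts D" "outs D \<subseteq> verts D" "distinct (inputs D)" "distinct (outputs D)" "finite (edges D)"
proof -
  show fin: "finite (verts D)" and "ins D \<subseteq> verts D" "outs D \<subseteq> verts D" "distinct (inputs D)" "distinct (outputs D)"
    using assms by (auto simp: is_open_graph_def)
  show sub: "e \<subseteq> verts D" if "e \<in> edges D" for e using assms that by (fastforce simp: is_open_graph_def)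
  show "card e = 2" if "e \<in> edges D" for e using assms that by (fastforce simp: is_open_graph_def)
  have "edges D \<subseteq> Pow (verts D)" using sub by blast
  then show "finite (edges D)" using fin by (meson finite_Pow_iff finite_subset)
qed

section \<open>The interpretation as a sum over sets of vertices\<close>

text \<open>The summand of the interpretation, with an assignment of bits encoded by the set
  \<open>Y\<close> of vertices that carry a 1, so that adding or dropping a vertex becomes a set
  operation.\<close>

definition amp :: "'v mbqc \<Rightarrow> 'v set \<Rightarrow> complex" where
  "amp D Y = (- 1) ^ card {e \<in> edges D. e \<subseteq> Y} * (\<Prod>v \<in> verts D - outs D. eff D v $ (v \<in> Y))"

definition selects :: "'v mbqc \<Rightarrow> bool list \<Rightarrow> bool list \<Rightarrow> 'v set \<Rightarrow> bool" where
  "selects D x z Y \<longleftrightarrow> map (\<lambda>v. v \<in> Y) (inputs D) = x \<and> map (\<lambda>v. v \<in> Y) (outputs D) = z"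

lemma interp_amp:
  assumes D: "is_open_graph D"
  shows "interp D x z = (\<Sum>Y\<in>Pow (verts D). if selects D x z Y then amp D Y else 0)"
proof -
  note og = open_graphD[OF D]
  have "interp D x z = (\<Sum>Y\<in>{Y \<in> Pow (verts D). selects D x z Y}. amp D Y)"
    unfolding interp_def
  proof (rule sum.reindex_bij_witness[of _ "\<lambda>Y. restrict (\<lambda>v. v \<in> Y) (verts D)" "\<lambda>y. {v \<in> verts D. y v}"], goal_cases)
    case (1 y) then show ?case by (auto simp: fun_eq_iff PiE_def extensional_def restrict_def)
  next
    case (2 y)
    then have "map (\<lambda>v. v \<in> {v \<in> verts D. y v}) (inputs D) = map y (inputs D)"
      "map (\<lambda>v. v \<in> {v \<in> verts D. y v}) (outputs D) = map y (outputs D)"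
      using og(4,5) by (auto simp: ins_def outs_def)
    then show ?case using 2 by (auto simp: selects_def)
  next
    case (3 Y) then show ?case by auto
  next
    case (4 Y)
    then have "map (restrict (\<lambda>v. v \<in> Y) (verts D)) (inputs D) = map (\<lambda>v. v \<in> Y) (inputs D)"
      "map (restrict (\<lambda>v. v \<in> Y) (verts D)) (outputs D) = map (\<lambda>v. v \<in> Y) (outputs D)"
      using og(4,5) by (auto simp: ins_def outs_def)
    then show ?case using 4 by (auto simp: selects_def)
  next
    case (5 y)
    have "{e \<in> edges D. \<forall>v\<in>e. y v} = {e \<in> edges D. e \<subseteq> {v \<in> verts D. y v}}"
      using og(2) by auto
    moreover have "(\<Prod>v\<in>verts D - outs D. eff D v $ y v) = (\<Prod>v\<in>verts D - outs D. eff D v $ (v \<in> {v \<in> verts D. y v}))"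
      by (intro prod.cong) auto
    ultimately show ?case by (simp add: amp_def)
  qed
  then show ?thesis by (subst (asm) sum.inter_filter) (simp_all add: og(1))
qed

lemma sum_Pow_insert:
  assumes "finite V" "z \<notin> V"
  shows "(\<Sum>Y\<in>Pow (insert z V). F Y) = (\<Sum>Y\<in>Pow V. F Y + (F (insert z Y) :: complex))"
proof -
  have 1: "(\<Sum>Y\<in>Pow (insert z V). F Y) = (\<Sum>Y\<in>Pow V. F Y) + (\<Sum>Y\<in>insert z ` Pow V. F Y)"
    unfolding Pow_insert using assms by (intro sum.union_disjoint) auto
  have "inj_on (insert z) (Pow V)"
  proof (rule inj_onI)
    fix A B assume "A \<in> Pow V" "B \<in> Pow V" "insert z A = insert z B"
    moreover have "z \<notin> A" "z \<notin> B" using calculation assms(2) by auto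
    ultimately show "A = B" by (simp add: insert_ident)
  qed
  then have 2: "(\<Sum>Y\<in>insert z ` Pow V. F Y) = (\<Sum>Y\<in>Pow V. F (insert z Y))"
    by (simp add: sum.reindex)
  show ?thesis unfolding sum.distrib 1 2 by (rule refl)
qed

definition rest_amp :: "'v mbqc \<Rightarrow> 'v \<Rightarrow> 'v set \<Rightarrow> complex" where
  "rest_amp D z Y = (- 1) ^ card {e \<in> edges D. z \<notin> e \<and> e \<subseteq> Y} * (\<Prod>v \<in> verts D - {z} - outs D. eff D v $ (v \<in> Y))"

lemma amp_split:
  assumes D: "is_open_graph D" and z: "z \<in> verts D" "z \<notin> outs D" and Y: "Y \<subseteq> verts D - {z}"
  shows "amp D Y = rest_amp D z Y * eff D z $ False"
    and "amp D (insert z Y) = rest_amp D z Y * (- 1) ^ card (nbrs D z \<inter> Y) * eff D z $ True"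
proof -
  note og = open_graphD[OF D]
  have V: "verts D - outs D = insert z (verts D - {z} - outs D)" using z by auto
  have p: "(\<Prod>v \<in> verts D - outs D. eff D v $ (v \<in> Z)) = eff D z $ (z \<in> Z) * (\<Prod>v \<in> verts D - {z} - outs D. eff D v $ (v \<in> Z))" for Z
    unfolding V using og(1) by (subst prod.insert) auto
  have zY: "z \<notin> Y" using Y by auto
  then have "{e \<in> edges D. e \<subseteq> Y} = {e \<in> edges D. z \<notin> e \<and> e \<subseteq> Y}" by auto
  then show "amp D Y = rest_amp D z Y * eff D z $ False"
    using p[of Y] zY unfolding amp_def rest_amp_def by simp
  have "{e \<in> edges D. e \<subseteq> insert z Y} = {e \<in> edges D. z \<notin> e \<and> e \<subseteq> Y} \<union> (\<lambda>w. {z, w}) ` (nbrs D z \<inter> Y)" (is "?A = ?B \<union> ?C")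
  proof (intro equalityI subsetI)
    fix e assume e: "e \<in> ?A"
    show "e \<in> ?B \<union> ?C"
    proof (cases "z \<in> e")
      case False then show ?thesis using e by auto
    next
      case True
      obtain w where "e = {z, w}" "w \<in> verts D" "w \<noteq> z"
        using D e True unfolding is_open_graph_def by (auto simp: doubleton_eq_iff)
      then show ?thesis using e by (auto simp: nbrs_def)
    qed
  qed (auto simp: nbrs_def)
  moreover have "card (?B \<union> ?C) = card ?B + card ?C"
    using og(8) by (intro card_Un_disjoint finite_imageI) (auto simp: nbrs_def og(1))
  moreover have "card ?C = card (nbrs D z \<inter> Y)"
    by (intro card_image inj_onI) (auto simp: doubleton_eq_iff)
  moreover have "(\<Prod>v \<in> verts D - {z} - outs D. eff D v $ (v \<in> insert z Y)) = (\<Prod>v \<in> verts D - {z} - outs D. eff D v $ (v \<in> Y))"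
    by (intro prod.cong) auto
  ultimately show "amp D (insert z Y) = rest_amp D z Y * (- 1) ^ card (nbrs D z \<inter> Y) * eff D z $ True"
    using p[of "insert z Y"] unfolding amp_def rest_amp_def by (simp add: power_add)
qed

lemma selects_insert:
  "z \<notin> ins D \<Longrightarrow> z \<notin> outs D \<Longrightarrow> selects D x y (insert z Y) \<longleftrightarrow> selects D x y Y"
proof -
  assume "z \<notin> ins D" "z \<notin> outs D"
  then have "map (\<lambda>v. v \<in> insert z Y) (inputs D) = map (\<lambda>v. v \<in> Y) (inputs D)"
    "map (\<lambda>v. v \<in> insert z Y) (outputs D) = map (\<lambda>v. v \<in> Y) (outputs D)"
    by (auto simp: ins_def outs_def)
  then show ?thesis by (simp only: selects_def)
qed

text \<open>Once the bit of \<open>z\<close> is summed out, \<open>z\<close> enters only through the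
  parity of the neighbours that carry a 1. Each soundness proof compares this factor before and
  after the rule.\<close>

lemma interp_split:
  assumes D: "is_open_graph D" and z: "z \<in> verts D" "z \<notin> outs D" "z \<notin> ins D"
  shows "interp D x y = (\<Sum>Y\<in>Pow (verts D - {z}). if selects D x y Y
    then rest_amp D z Y * (eff D z $ False + (- 1) ^ card (nbrs D z \<inter> Y) * eff D z $ True) else 0)"
proof -
  have "interp D x y = (\<Sum>Y\<in>Pow (insert z (verts D - {z})). if selects D x y Y then amp D Y else 0)"
    using interp_amp[OF D] z by (simp add: insert_absorb)
  also have "\<dots> = (\<Sum>Y\<in>Pow (verts D - {z}). (if selects D x y Y then amp D Y else 0) +
      (if selects D x y (insert z Y) then amp D (insert z Y) else 0))"
    using open_graphD(1)[OF D] by (intro sum_Pow_insert) auto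
  also have "\<dots> = (\<Sum>Y\<in>Pow (verts D - {z}). if selects D x y Y
    then rest_amp D z Y * (eff D z $ False + (- 1) ^ card (nbrs D z \<inter> Y) * eff D z $ True) else 0)"
    using z by (intro sum.cong refl) (simp add: selects_insert amp_split[OF D z(1,2)] algebra_simps)
  finally show ?thesis .
qed

lemma prod_if_power:
  assumes "finite A" "N \<subseteq> A"
  shows "(\<Prod>v\<in>A. (if v \<in> N then c else 1) * f v) = c ^ card N * (\<Prod>v\<in>A. f v :: complex)"
proof -
  have "(\<Prod>v\<in>A. if v \<in> N then c else 1) = (\<Prod>v\<in>N. c)"
    using assms by (subst prod.inter_restrict[symmetric]) (auto simp: Int_absorb1)
  then show ?thesis by (simp add: prod.distrib)
qed

section \<open>Soundness of the rules\<close>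

lemma same_interp_refl [simp]: "same_interp D D"
  unfolding same_interp_def by (auto intro: exI[of _ 1])

lemma same_interp_trans: "same_interp D D' \<Longrightarrow> same_interp D' D'' \<Longrightarrow> same_interp D D''"
  unfolding same_interp_def by (metis mult.assoc mult_eq_0_iff)

lemma same_interp_sym: "same_interp D D' \<Longrightarrow> same_interp D' D"
proof -
  assume "same_interp D D'"
  then obtain c where c: "c \<noteq> 0" "\<And>x z. interp D' x z = c * interp D x z"
    and l: "length (inputs D) = length (inputs D')" "length (outputs D) = length (outputs D')"
    unfolding same_interp_def by auto
  then have "interp D x z = inverse c * interp D' x z" for x z by simp
  then show ?thesis unfolding same_interp_def using c(1) l by (metis inverse_nonzero_iff_nonzero)
qed

lemma diag1_one: "e v* diag1 1 = e"
  by (simp add: qvec_eq_iff)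

lemma rule_ZL_sound:
  assumes D: "is_open_graph D" and D': "is_open_graph D'" and R: "rule_ZL D D'"
  shows "same_interp D D'"
proof -
  from R obtain z and a :: nat where a01: "a \<in> {0, 1}" and z0: "z \<in> verts D" "z \<notin> ins D \<union> outs D"
    and ez: "eff D z \<propto> YZ (real a * pi)" and aN0: "a = 1 \<longrightarrow> nbrs D z \<inter> outs D = {}"
    and D'_eq: "D' = D\<lparr>verts := verts D - {z}, edges := {e \<in> edges D. z \<notin> e},
            eff := (\<lambda>w. if w \<in> nbrs D z then eff D w v* diag1 ((- 1) ^ a) else eff D w)\<rparr>"
    unfolding rule_ZL_def by blast
  have a: "a = 0 \<or> a = 1" and z: "z \<in> verts D" "z \<notin> ins D" "z \<notin> outs D"
    and aN: "a = 1 \<Longrightarrow> nbrs D z \<inter> outs D = {}"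
    using a01 z0 aN0 by auto
  have V': "verts D' = verts D - {z}" "inputs D' = inputs D" "outputs D' = outputs D" "outs D' = outs D"
    by (simp_all add: D'_eq outs_def)
  \<comment> \<open>The effect of \<open>z\<close> is a multiple of a basis effect; \<open>k\<close>
    is its only non-zero component and the scalar between the two interpretations.\<close>
  define k where "k = eff D z $ (a = 1)"
  have k: "k \<noteq> 0" "eff D z $ (a \<noteq> 1) = 0"
    using a ez by (auto simp: k_def prop_to_YZ algebra_simps)
  have zN: "z \<notin> nbrs D z" using open_graphD(3)[OF D] by (force simp: nbrs_def)
  have amp': "rest_amp D z Y * (eff D z $ False + (- 1) ^ card (nbrs D z \<inter> Y) * eff D z $ True) = k * amp D' Y"
    if Y: "Y \<subseteq> verts D - {z}" for Y
  proof -
    have e: "{e \<in> edges D'. e \<subseteq> Y} = {e \<in> edges D. z \<notin> e \<and> e \<subseteq> Y}" by (auto simp: D'_eq)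
    show ?thesis
    proof (cases "a = 1")
      case False
      then have "a = 0" using a by auto
      then have "(\<Prod>v\<in>verts D' - outs D'. eff D' v $ (v \<in> Y)) = (\<Prod>v\<in>verts D - {z} - outs D. eff D v $ (v \<in> Y))"
        unfolding V' by (intro prod.cong) (auto simp: D'_eq diag1_one)
      then have "amp D' Y = rest_amp D z Y" unfolding amp_def rest_amp_def e by simp
      then show ?thesis using False k by (simp add: k_def)
    next
      case True
      have "(\<Prod>v\<in>verts D' - outs D'. eff D' v $ (v \<in> Y)) =
          (\<Prod>v\<in>verts D - {z} - outs D. (if v \<in> nbrs D z \<inter> Y then - 1 else 1) * eff D v $ (v \<in> Y))"
        unfolding V' by (intro prod.cong) (auto simp: D'_eq True)
      also have "\<dots> = (- 1) ^ card (nbrs D z \<inter> Y) * (\<Prod>v\<in>verts D - {z} - outs D. eff D v $ (v \<in> Y))"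
        using open_graphD(1)[OF D] aN[OF True] zN by (intro prod_if_power) (auto simp: nbrs_def)
      finally have "amp D' Y = (- 1) ^ card (nbrs D z \<inter> Y) * rest_amp D z Y"
        unfolding amp_def rest_amp_def e by simp
      then show ?thesis using True k by (simp add: k_def)
    qed
  qed
  have "interp D x y = k * interp D' x y" for x y
    unfolding interp_split[OF D z(1,3,2)] interp_amp[OF D'] V' sum_distrib_left
    by (intro sum.cong refl) (auto simp: amp' selects_def V')
  then have "same_interp D' D" unfolding same_interp_def using k V' by auto
  then show ?thesis by (rule same_interp_sym)
qed

text \<open>Among \<open>k\<close> neighbours that carry a 1, local complementation toggles
  \<open>k choose 2\<close> edges, and each of these neighbours gains a factor i. The product
  depends only on the parity of \<open>k\<close>: two more neighbours add \<open>2 * k + 1\<close>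
  pairs, whose sign cancels the square of i.\<close>

lemma sign_choose_two: "(- 1) ^ (k choose 2) * \<i> ^ k = (if even k then 1 else \<i>)"
proof (induction k rule: nat_less_induct)
  case (1 k)
  show ?case
  proof (cases "k < 2")
    case True then show ?thesis by (auto simp: less_2_cases_iff binomial_eq_0)
  next
    case False
    then obtain j where j: "k = Suc (Suc j)" by (metis add_2_eq_Suc le_Suc_ex not_less)
    have "Suc (Suc j) choose 2 = (j choose 2) + 2 * j + 1" by (simp add: numeral_2_eq_2)
    then show ?thesis using 1[rule_format, of j] by (simp add: j power_add)
  qed
qed

lemma rule_LC_sound:
  assumes D: "is_open_graph D" and D': "is_open_graph D'" and R: "rule_LC D D'"
  shows "same_interp D D'"
proof -
  from R obtain u where u: "u \<in> verts D" "u \<notin> ins D" and uO: "insert u (nbrs D u) \<inter> outs D = {}"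
    and D'_eq: "D' = D\<lparr>edges := sym_diff (edges D) {{v, w} | v w. v \<in> nbrs D u \<and> w \<in> nbrs D u \<and> v \<noteq> w},
            eff := (\<lambda>w. if w = u then eff D u v* lc_op
                        else if w \<in> nbrs D u then eff D w v* diag1 \<i>
                        else eff D w)\<rparr>"
    unfolding rule_LC_def by auto
  define K where "K = {{v, w} | v w. v \<in> nbrs D u \<and> w \<in> nbrs D u \<and> v \<noteq> w}"
  have V': "verts D' = verts D" "inputs D' = inputs D" "outputs D' = outputs D" "outs D' = outs D" "ins D' = ins D"
    by (simp_all add: D'_eq outs_def ins_def)
  have uN: "u \<notin> nbrs D u" using open_graphD(3)[OF D] by (force simp: nbrs_def)
  have uK: "u \<notin> e" if "e \<in> K" for e using that uN by (auto simp: K_def)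
  have E': "edges D' = sym_diff (edges D) K" by (simp add: D'_eq K_def)
  have "{u, w} \<in> edges D' \<longleftrightarrow> {u, w} \<in> edges D" for w using uK[of "{u, w}"] unfolding E' by auto
  then have N': "nbrs D' u = nbrs D u" by (simp add: nbrs_def V')
  have uO': "u \<notin> outs D" using uO by auto
  have fN: "finite (nbrs D u)" using open_graphD(1)[OF D] by (simp add: nbrs_def)
  have rest: "rest_amp D' u Y = (- 1) ^ (card (nbrs D u \<inter> Y) choose 2) * \<i> ^ card (nbrs D u \<inter> Y) * rest_amp D u Y"
    if Y: "Y \<subseteq> verts D - {u}" for Y
  proof -
    let ?A = "{e \<in> edges D. u \<notin> e \<and> e \<subseteq> Y}" and ?B = "{B. B \<subseteq> nbrs D u \<inter> Y \<and> card B = 2}"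
    have KB: "{e \<in> K. e \<subseteq> Y} = ?B" unfolding K_def
      by (auto simp: card_2_iff)
    have "{e \<in> edges D'. u \<notin> e \<and> e \<subseteq> Y} = sym_diff ?A {e \<in> K. e \<subseteq> Y}"
      unfolding E' using uK by auto
    then have ed: "{e \<in> edges D'. u \<notin> e \<and> e \<subseteq> Y} = sym_diff ?A ?B" unfolding KB .
    have fB: "finite ?B" using fN by simp
    have "odd (card (sym_diff ?A ?B)) \<longleftrightarrow> odd (card ?A) \<noteq> odd (card ?B)"
      using open_graphD(8)[OF D] fB by (intro odd_card_sym_diff) auto
    moreover have "card ?B = (card (nbrs D u \<inter> Y) choose 2)" using fN by (intro n_subsets) auto
    ultimately have sgn: "(- 1 :: complex) ^ card (sym_diff ?A ?B) = (- 1) ^ card ?A * (- 1) ^ (card (nbrs D u \<inter> Y) choose 2)"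
      by (auto simp: uminus_power_if)
    have "(\<Prod>v\<in>verts D' - {u} - outs D'. eff D' v $ (v \<in> Y)) =
        (\<Prod>v\<in>verts D - {u} - outs D. (if v \<in> nbrs D u \<inter> Y then \<i> else 1) * eff D v $ (v \<in> Y))"
      unfolding V' by (intro prod.cong) (auto simp: D'_eq)
    also have "\<dots> = \<i> ^ card (nbrs D u \<inter> Y) * (\<Prod>v\<in>verts D - {u} - outs D. eff D v $ (v \<in> Y))"
      using open_graphD(1)[OF D] uO uN by (intro prod_if_power) (auto simp: nbrs_def)
    finally show ?thesis unfolding rest_amp_def ed sgn by simp
  qed
  have key: "rest_amp D' u Y * (eff D' u $ False + (- 1) ^ card (nbrs D' u \<inter> Y) * eff D' u $ True)
    = rest_amp D u Y * (eff D u $ False + (- 1) ^ card (nbrs D u \<inter> Y) * eff D u $ True)"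
    if Y: "Y \<subseteq> verts D - {u}" for Y
  proof -
    define k where "k = card (nbrs D u \<inter> Y)"
    define f t where "f = eff D u $ False" and "t = eff D u $ True"
    have eu: "eff D' u $ False = ((1 - \<i>) * f + (1 + \<i>) * t) / 2" "eff D' u $ True = ((1 + \<i>) * f + (1 - \<i>) * t) / 2"
      by (simp_all add: D'_eq f_def t_def)
    \<comment> \<open>\<open>lc_op\<close> compensates exactly the phase 1 or i left by the
      neighbours, so the interpretations agree with scalar 1.\<close>
    have "(if even k then 1 else \<i>) * (eff D' u $ False + (- 1) ^ k * eff D' u $ True) = f + (- 1) ^ k * t"
      unfolding eu by (cases "even k") (simp_all add: field_simps)
    then show ?thesis unfolding rest[OF Y] N' f_def[symmetric] t_def[symmetric] k_def[symmetric] sign_choose_two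
      by simp
  qed
  have "interp D' x y = interp D x y" for x y
    unfolding interp_split[OF D u(1) uO' u(2)] interp_split[OF D' u(1)[folded V'(1)] uO'[folded V'(4)] u(2)[folded V'(5)]]
    unfolding V'(1) by (intro sum.cong refl) (auto simp: key selects_def V')
  then show ?thesis unfolding same_interp_def by (auto simp: V' intro: exI[of _ 1])
qed

text \<open>Summing over the middle vertex \<open>b\<close> of a new path forces its ends \<open>c\<close> and \<open>d\<close> to agree.\<close>

lemma path_sound:
  assumes D: "is_open_graph D" and D': "is_open_graph D'"
    and bd: "b \<notin> verts D" "d \<notin> verts D" "b \<noteq> d" "c \<in> verts D"
    and V': "verts D' = verts D \<union> {b, d}" and E': "edges D' = edges D \<union> {{b, d}, {b, c}}"
    and b: "b \<notin> ins D'" "b \<notin> outs D'" "eff D' b = XY 0"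
    and sel: "\<And>Y x y. Y \<subseteq> verts D \<Longrightarrow> selects D' x y (if c \<in> Y then insert d Y else Y) \<longleftrightarrow> selects D x y Y"
    and prd: "\<And>Y. Y \<subseteq> verts D \<Longrightarrow>
       (\<Prod>v\<in>verts D' - {b} - outs D'. eff D' v $ (v \<in> (if c \<in> Y then insert d Y else Y))) =
       (\<Prod>v\<in>verts D - outs D. eff D v $ (v \<in> Y))"
    and len: "length (inputs D') = length (inputs D)" "length (outputs D') = length (outputs D)"
  shows "same_interp D D'"
proof -
  have Vb: "verts D' - {b} = insert d (verts D)" using V' bd by auto
  have Nb: "nbrs D' b = {c, d}"
    using bd open_graphD(2)[OF D] by (auto simp: nbrs_def E' V' doubleton_eq_iff)
  let ?\<psi> = "\<lambda>Y. if c \<in> Y then insert d Y else Y"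
  have rest: "rest_amp D' b (?\<psi> Y) = amp D Y" if Y: "Y \<subseteq> verts D" for Y
  proof -
    have "{e \<in> edges D'. b \<notin> e \<and> e \<subseteq> ?\<psi> Y} = {e \<in> edges D. e \<subseteq> Y}"
      using Y bd open_graphD(2)[OF D] unfolding E' by (auto split: if_splits)
    then show ?thesis unfolding rest_amp_def amp_def prd[OF Y] by simp
  qed
  have "interp D' x y = 2 * interp D x y" for x y
  proof -
    let ?G = "\<lambda>Y. if selects D' x y Y then rest_amp D' b Y * (eff D' b $ False + (- 1) ^ card (nbrs D' b \<inter> Y) * eff D' b $ True) else 0"
    have card: "card ({c, d} \<inter> Y) = (if c \<in> Y then 1 else 0) + (if d \<in> Y then 1 else 0)" for Y
      using bd by (cases "c \<in> Y"; cases "d \<in> Y") (auto simp: card_insert_if)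
    \<comment> \<open>With m the number of ones among \<open>c\<close> and \<open>d\<close>, the
      factor is 1 + (-1)^m: it is 2 if they agree and 0 otherwise. Hence the scalar 2 below.\<close>
    have eb: "eff D' b $ False + (- 1) ^ card (nbrs D' b \<inter> Y) * eff D' b $ True = (if c \<in> Y \<longleftrightarrow> d \<in> Y then 2 else 0)" for Y
      unfolding b(3) Nb card by (simp add: XY_def)
    have "interp D' x y = (\<Sum>Y\<in>Pow (verts D' - {b}). ?G Y)"
      using V' by (intro interp_split[OF D' _ b(2,1)]) simp
    also have "\<dots> = (\<Sum>Y\<in>Pow (verts D). ?G Y + ?G (insert d Y))"
      unfolding Vb by (rule sum_Pow_insert[OF open_graphD(1)[OF D] bd(2)])
    also have "\<dots> = (\<Sum>Y\<in>Pow (verts D). 2 * (if selects D x y Y then amp D Y else 0))"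
    proof (intro sum.cong refl)
      fix Y assume "Y \<in> Pow (verts D)"
      then have Y: "Y \<subseteq> verts D" "d \<notin> Y" using bd by auto
      show "?G Y + ?G (insert d Y) = 2 * (if selects D x y Y then amp D Y else 0)"
        using sel[OF Y(1), of x y] rest[OF Y(1)] Y(2) bd unfolding eb by (cases "c \<in> Y") auto
    qed
    finally show ?thesis unfolding interp_amp[OF D] by (simp add: sum_distrib_left)
  qed
  then show ?thesis unfolding same_interp_def using len by (auto intro: exI[of _ 2])
qed

lemma XY0_apply [simp]: "XY 0 $ b = 1" by (simp add: XY_def)

lemma rule_IO_input_sound:
  assumes D: "is_open_graph D" and D': "is_open_graph D'" and R: "rule_IO_input D D'"
  shows "same_interp D D'"
proof -
  from R obtain a b c where c: "c \<in> ins D" "a \<notin> verts D" "b \<notin> verts D" "a \<noteq> b"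
    and D'_eq: "D' = D\<lparr>verts := verts D \<union> {a, b},
            edges := edges D \<union> {{a, b}, {b, c}},
            inputs := map (\<lambda>v. if v = c then a else v) (inputs D),
            eff := (eff D)(a := XY 0, b := XY 0)\<rparr>"
    unfolding rule_IO_input_def by auto
  note og = open_graphD[OF D]
  show ?thesis
  proof (rule path_sound[OF D D', of b a c])
    show "b \<notin> ins D'" "b \<notin> outs D'" using c og(4,5) by (auto simp: D'_eq ins_def outs_def)
    fix Y assume Y: "Y \<subseteq> verts D"
    let ?\<psi> = "if c \<in> Y then insert a Y else Y"
    show "selects D' x y ?\<psi> \<longleftrightarrow> selects D x y Y" for x y
    proof -
      have "map (\<lambda>v. v \<in> ?\<psi>) (inputs D') = map (\<lambda>v. v \<in> Y) (inputs D)"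
        using c og(4) Y by (auto simp: D'_eq ins_def)
      moreover have "map (\<lambda>v. v \<in> ?\<psi>) (outputs D') = map (\<lambda>v. v \<in> Y) (outputs D)"
        using c og(5) Y by (auto simp: D'_eq outs_def)
      ultimately show ?thesis by (simp only: selects_def)
    qed
    have "verts D' - {b} - outs D' = insert a (verts D - outs D)" using c og(5) by (auto simp: D'_eq outs_def)
    then have "(\<Prod>v\<in>verts D' - {b} - outs D'. eff D' v $ (v \<in> ?\<psi>)) = (\<Prod>v\<in>verts D - outs D. eff D' v $ (v \<in> ?\<psi>))"
      using c og(1) by (simp add: D'_eq)
    also have "\<dots> = (\<Prod>v\<in>verts D - outs D. eff D v $ (v \<in> Y))"
    proof (intro prod.cong refl)
      fix v assume v: "v \<in> verts D - outs D"
      then have "v \<in> ?\<psi> \<longleftrightarrow> v \<in> Y" using c by auto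
      then show "eff D' v $ (v \<in> ?\<psi>) = eff D v $ (v \<in> Y)" using v c by (auto simp: D'_eq)
    qed
    finally show "(\<Prod>v\<in>verts D' - {b} - outs D'. eff D' v $ (v \<in> ?\<psi>)) = (\<Prod>v\<in>verts D - outs D. eff D v $ (v \<in> Y))" .
  qed (use c og(4)[THEN subsetD] in \<open>simp_all add: D'_eq insert_commute\<close>)
qed

lemma rule_IO_output_sound:
  assumes D: "is_open_graph D" and D': "is_open_graph D'" and R: "rule_IO_output D D'"
  shows "same_interp D D'"
proof -
  from R obtain b c d where c: "c \<in> outs D" "b \<notin> verts D" "d \<notin> verts D" "b \<noteq> d"
    and D'_eq: "D' = D\<lparr>verts := verts D \<union> {b, d},
            edges := edges D \<union> {{c, b}, {b, d}},
            outputs := map (\<lambda>v. if v = c then d else v) (outputs D),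
            eff := (eff D)(c := XY 0, b := XY 0)\<rparr>"
    unfolding rule_IO_output_def by auto
  note og = open_graphD[OF D]
  have cV: "c \<in> verts D" using c og(5) by auto
  show ?thesis
  proof (rule path_sound[OF D D', of b d c])
    show "b \<notin> ins D'" "b \<notin> outs D'" using c og(4,5) by (auto simp: D'_eq ins_def outs_def)
    fix Y assume Y: "Y \<subseteq> verts D"
    let ?\<psi> = "if c \<in> Y then insert d Y else Y"
    show "selects D' x y ?\<psi> \<longleftrightarrow> selects D x y Y" for x y
    proof -
      have "map (\<lambda>v. v \<in> ?\<psi>) (inputs D') = map (\<lambda>v. v \<in> Y) (inputs D)"
        using c og(4) Y by (auto simp: D'_eq ins_def)
      moreover have "map (\<lambda>v. v \<in> ?\<psi>) (outputs D') = map (\<lambda>v. v \<in> Y) (outputs D)"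
        using c og(5) Y by (auto simp: D'_eq outs_def)
      ultimately show ?thesis by (simp only: selects_def)
    qed
    have "outs D' = insert d (outs D - {c})" using c by (auto simp: D'_eq outs_def)
    then have "verts D' - {b} - outs D' = insert c (verts D - outs D)" using c cV by (auto simp: D'_eq)
    \<comment> \<open>\<open>c\<close> is now measured, but both components of \<open>XY 0\<close>
      are 1, so it contributes no factor.\<close>
    then have "(\<Prod>v\<in>verts D' - {b} - outs D'. eff D' v $ (v \<in> ?\<psi>)) = (\<Prod>v\<in>verts D - outs D. eff D' v $ (v \<in> ?\<psi>))"
      using c og(1) by (simp add: D'_eq)
    also have "\<dots> = (\<Prod>v\<in>verts D - outs D. eff D v $ (v \<in> Y))"
    proof (intro prod.cong refl)
      fix v assume v: "v \<in> verts D - outs D"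
      then have "v \<in> ?\<psi> \<longleftrightarrow> v \<in> Y" using c by auto
      then show "eff D' v $ (v \<in> ?\<psi>) = eff D v $ (v \<in> Y)" using v c by (auto simp: D'_eq)
    qed
    finally show "(\<Prod>v\<in>verts D' - {b} - outs D'. eff D' v $ (v \<in> ?\<psi>)) = (\<Prod>v\<in>verts D - outs D. eff D v $ (v \<in> Y))" .
  qed (use c cV in \<open>simp_all add: D'_eq insert_commute\<close>)
qed

section \<open>Flow of diagrams\<close>

definition adj :: "('v, 'm) open_graph_scheme \<Rightarrow> 'v \<Rightarrow> 'v \<Rightarrow> bool" where
  "adj G u v \<longleftrightarrow> {u, v} \<in> edges G"

definition lab :: "'v mbqc \<Rightarrow> 'v \<Rightarrow> label" where
  "lab D v = pauli_label (eff D v)"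

lemma graph_on_adj:
  assumes "is_open_graph D"
  shows "graph_on (verts D) (adj D)"
  unfolding graph_on_def
proof (intro conjI allI impI)
  show "finite (verts D)" using open_graphD(1)[OF assms] .
  fix u v assume a: "adj D u v"
  then show "u \<in> verts D" "v \<in> verts D" "u \<noteq> v" "adj D v u"
    using open_graphD(2,3)[OF assms, of "{u, v}"] by (auto simp: adj_def insert_commute)
qed

lemma odd_nbrs_par:
  assumes "is_open_graph D"
  shows "odd_nbrs D S = {v \<in> verts D. par (adj D) S v}"
proof -
  have "nbrs D v \<inter> S = {x \<in> S. adj D v x}" for v
    using graph_onD(3)[OF graph_on_adj[OF assms]] by (auto simp: nbrs_def adj_def)
  then show ?thesis by (simp add: odd_nbrs_def par_def)
qed

text \<open>The clauses of the flow relation, sorted by the label of \<open>v\<close>, amount to one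
  condition on the Pauli operator that \<open>c u\<close> puts on \<open>v\<close>.\<close>

lemma flow_rel_hit:
  assumes "is_open_graph D"
  shows "(u, v) \<in> flow_rel D l c \<longleftrightarrow>
    u \<in> verts D - outs D \<and> v \<in> verts D \<and> v \<noteq> u \<and> hit (outs D) l v (v \<in> c u) (par (adj D) (c u) v)"
  unfolding flow_rel_def odd_nbrs_closed_def odd_nbrs_par[OF assms] hit_def detects_def
  by (cases "l v") auto

lemma irrefl_trancl_iff_rank:
  assumes "finite R"
  shows "irrefl (R\<^sup>+) \<longleftrightarrow> (\<exists>h :: 'a \<Rightarrow> nat. \<forall>(u, v)\<in>R. h u < h v)"
proof
  assume ir: "irrefl (R\<^sup>+)"
  \<comment> \<open>The rank counts strict predecessors; irreflexivity makes their inclusion along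
    an edge of \<open>R\<close> strict.\<close>
  define h where "h v = card {x. (x, v) \<in> R\<^sup>+}" for v
  have "h u < h v" if uv: "(u, v) \<in> R" for u v
    unfolding h_def
  proof (rule psubset_card_mono)
    have "{x. (x, v) \<in> R\<^sup>+} \<subseteq> Field R" using trancl_subset_Field2[of R] by blast
    then show "finite {x. (x, v) \<in> R\<^sup>+}" using assms by (meson finite_Field finite_subset)
    show "{x. (x, u) \<in> R\<^sup>+} \<subset> {x. (x, v) \<in> R\<^sup>+}"
      using ir uv by (auto simp: irrefl_def intro: trancl_into_trancl)
  qed
  then show "\<exists>h :: 'a \<Rightarrow> nat. \<forall>(u, v)\<in>R. h u < h v" by auto
next
  assume "\<exists>h :: 'a \<Rightarrow> nat. \<forall>(u, v)\<in>R. h u < h v"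
  then obtain h :: "'a \<Rightarrow> nat" where h: "\<And>u v. (u, v) \<in> R \<Longrightarrow> h u < h v" by auto
  have "h u < h v" if "(u, v) \<in> R\<^sup>+" for u v
    using that by induction (auto dest: h intro: less_trans)
  then show "irrefl (R\<^sup>+)" by (auto simp: irrefl_def)
qed

lemma has_pauli_flow_iff:
  fixes D :: "'a mbqc"
  assumes D: "is_open_graph D"
  shows "has_pauli_flow D \<longleftrightarrow> (\<exists>p h. pflow (verts D) (adj D) (ins D) (outs D) (lab D) p h)"
proof -
  have fin: "finite (flow_rel D (lab D) p)" for p
    using open_graphD(1)[OF D] by (rule_tac finite_subset[of _ "verts D \<times> verts D"]) (auto simp: flow_rel_def)
  have "pauli_flow D (lab D) p \<longleftrightarrow> (\<exists>h. pflow (verts D) (adj D) (ins D) (outs D) (lab D) p h)" for p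
  proof -
    have "(\<forall>(u, v)\<in>flow_rel D (lab D) p. h u < h v) \<longleftrightarrow>
        (\<forall>u\<in>verts D - outs D. \<forall>v\<in>verts D. v \<noteq> u \<longrightarrow>
          hit (outs D) (lab D) v (v \<in> p u) (par (adj D) (p u) v) \<longrightarrow> h u < h v)" for h :: "'a \<Rightarrow> nat"
      unfolding Ball_def[of "flow_rel D (lab D) p"] split_paired_All case_prod_conv flow_rel_hit[OF D] by blast
    then have ord: "flow_ordered D (lab D) p \<longleftrightarrow> (\<exists>h :: 'a \<Rightarrow> nat. \<forall>u\<in>verts D - outs D. \<forall>v\<in>verts D. v \<noteq> u \<longrightarrow>
        hit (outs D) (lab D) v (v \<in> p u) (par (adj D) (p u) v) \<longrightarrow> h u < h v)"
      unfolding flow_ordered_def irrefl_trancl_iff_rank[OF fin] by simp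
    have lb: "((l = LXY \<longrightarrow> u \<notin> p u \<and> u \<in> odd_nbrs D (p u)) \<and>
        (l = LXZ \<longrightarrow> u \<in> p u \<and> u \<in> odd_nbrs D (p u)) \<and>
        (l = LYZ \<longrightarrow> u \<in> p u \<and> u \<notin> odd_nbrs D (p u)) \<and>
        (l = LX \<longrightarrow> u \<in> odd_nbrs D (p u)) \<and>
        (l = LZ \<longrightarrow> u \<in> p u) \<and>
        (l = LY \<longrightarrow> u \<in> odd_nbrs_closed D (p u))) \<longleftrightarrow> flips l (u \<in> p u) (par (adj D) (p u) u)"
      if "u \<in> verts D" for u l
      using that unfolding odd_nbrs_closed_def odd_nbrs_par[OF D] flips_def by (cases l) auto
    have "pauli_flow D (lab D) p \<longleftrightarrow> (\<forall>u\<in>verts D - outs D. p u \<subseteq> verts D - ins D) \<and>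
        (\<exists>h :: 'a \<Rightarrow> nat. \<forall>u\<in>verts D - outs D. \<forall>v\<in>verts D. v \<noteq> u \<longrightarrow>
          hit (outs D) (lab D) v (v \<in> p u) (par (adj D) (p u) v) \<longrightarrow> h u < h v) \<and>
        (\<forall>u\<in>verts D - outs D. flips (lab D u) (u \<in> p u) (par (adj D) (p u) u))"
      unfolding pauli_flow_def ord by (intro arg_cong2[of _ _ _ _ "(\<and>)"] refl ball_cong lb) auto
    moreover have "pflow (verts D) (adj D) (ins D) (outs D) (lab D) p h \<longleftrightarrow>
        (\<forall>u\<in>verts D - outs D. p u \<subseteq> verts D - ins D) \<and>
        (\<forall>u\<in>verts D - outs D. flips (lab D u) (u \<in> p u) (par (adj D) (p u) u)) \<and>
        (\<forall>u\<in>verts D - outs D. \<forall>v\<in>verts D. v \<noteq> u \<longrightarrow>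
          hit (outs D) (lab D) v (v \<in> p u) (par (adj D) (p u) v) \<longrightarrow> h u < h v)" for h
      unfolding pflow_def by (simp only: ball_conj_distrib)
    ultimately show ?thesis by (simp only: ex_simps simp_thms conj_ac)
  qed
  then show ?thesis unfolding has_pauli_flow_def lab_def[abs_def] by metis
qed

lemma hit_cong: "(v \<notin> O' \<Longrightarrow> l v = l' v) \<Longrightarrow> hit O' l v x z = hit O' l' v x z"
  by (auto simp: hit_def)

lemma pflow_cong:
  assumes "\<And>v. v \<in> V - O' \<Longrightarrow> l v = l' v"
  shows "pflow V E I O' l p h \<longleftrightarrow> pflow V E I O' l' p h"
proof -
  have "hit O' l v x z = hit O' l' v x z" if "v \<in> V" for v x z
    using assms that by (intro hit_cong) auto
  then show ?thesis unfolding pflow_def using assms by simp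
qed

section \<open>Reachable labelled graphs\<close>

text \<open>The effects hide behind the existential quantifier, so that later arguments see only the
  labelled graph. The derivation, its soundness and the flow are recorded here and need not be
  followed separately.\<close>

definition reach ::
  "'v mbqc \<Rightarrow> 'v list \<Rightarrow> 'v list \<Rightarrow> 'v set \<Rightarrow> ('v \<Rightarrow> 'v \<Rightarrow> bool) \<Rightarrow> ('v \<Rightarrow> label) \<Rightarrow> bool" where
  "reach D0 I O' V E l \<longleftrightarrow> (\<exists>D. pauli_flow_step\<^sup>*\<^sup>* D0 D \<and> same_interp D0 D \<and> is_mbqc D \<and> has_pauli_flow D \<and>
     verts D = V \<and> inputs D = I \<and> outputs D = O' \<and> adj D = E \<and> (\<forall>v \<in> V - set O'. lab D v = l v))"

lemma reachE:
  assumes "reach D0 I O' V E l"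
  obtains D p h where "pauli_flow_step\<^sup>*\<^sup>* D0 D" "same_interp D0 D" "is_mbqc D" "is_open_graph D" "has_pauli_flow D"
    "verts D = V" "inputs D = I" "outputs D = O'" "ins D = set I" "outs D = set O'" "adj D = E"
    "\<And>v. v \<in> V - set O' \<Longrightarrow> lab D v = l v" "\<And>v. v \<in> V - set O' \<Longrightarrow> is_effect (eff D v)"
    "pflow V E (set I) (set O') l p h"
proof -
  from assms obtain D where D: "pauli_flow_step\<^sup>*\<^sup>* D0 D" "same_interp D0 D" "is_mbqc D" "has_pauli_flow D"
    "verts D = V" "inputs D = I" "outputs D = O'" "adj D = E" and l: "\<And>v. v \<in> V - set O' \<Longrightarrow> lab D v = l v"
    unfolding reach_def by auto
  have og: "is_open_graph D" using D by (simp add: is_mbqc_def)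
  have io: "ins D = set I" "outs D = set O'" using D by (simp_all add: ins_def outs_def)
  obtain p h where "pflow V E (set I) (set O') (lab D) p h"
    using D(4) unfolding has_pauli_flow_iff[OF og] D io by auto
  then have "pflow V E (set I) (set O') l p h" using pflow_cong l by metis
  moreover have "is_effect (eff D v)" if "v \<in> V - set O'" for v
    using D(3) that io by (auto simp: is_mbqc_def D)
  ultimately show thesis using that[OF D(1-3) og D(4-7) io D(8) l] by blast
qed

lemma reach_graph:
  assumes "reach D0 I O' V E l"
  shows "graph_on V E" "set I \<subseteq> V" "set O' \<subseteq> V" "\<exists>p h. pflow V E (set I) (set O') l p h"
proof -
  have "graph_on V E \<and> set I \<subseteq> V \<and> set O' \<subseteq> V \<and> (\<exists>p h. pflow V E (set I) (set O') l p h)"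
    using assms
  proof (rule reachE)
    fix D p h
    assume D: "is_open_graph D" "verts D = V" "ins D = set I" "outs D = set O'" "adj D = E"
      and "pflow V E (set I) (set O') l p h"
    then show ?thesis using graph_on_adj[OF D(1)] open_graphD(4,5)[OF D(1)] by auto
  qed
  then show "graph_on V E" "set I \<subseteq> V" "set O' \<subseteq> V" "\<exists>p h. pflow V E (set I) (set O') l p h" by simp_all
qed

lemma reach_cong: "reach D0 I O' V E l \<Longrightarrow> (\<And>v. v \<in> V - set O' \<Longrightarrow> l v = l' v) \<Longrightarrow> E = E' \<Longrightarrow> V = V' \<Longrightarrow>
  reach D0 I O' V' E' l'"
  unfolding reach_def by auto

text \<open>The obligations of a single rule: soundness, the change of labels, and a flow for the
  new labels. Membership in the class of diagrams with Pauli flow follows.\<close>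

lemma reach_step:
  assumes "pauli_flow_step\<^sup>*\<^sup>* D0 D" "same_interp D0 D" "is_mbqc D" "has_pauli_flow D"
    and "rewrite_step D D'" "same_interp D D'" and D': "is_open_graph D'"
    and eff: "\<And>v. v \<in> verts D' - set (outputs D') \<Longrightarrow> is_effect (eff D' v) \<and> lab D' v = l v"
    and fl: "\<exists>p h. pflow (verts D') (adj D') (set (inputs D')) (set (outputs D')) l p h"
  shows "reach D0 (inputs D') (outputs D') (verts D') (adj D') l"
proof -
  have "is_mbqc D'" using D' eff by (simp add: is_mbqc_def outs_def)
  moreover have "has_pauli_flow D'"
    using fl eff unfolding has_pauli_flow_iff[OF D'] ins_def outs_def by (metis pflow_cong)
  ultimately have "pauli_flow_step D D'" using assms by (simp add: pauli_flow_step_def)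
  then have "pauli_flow_step\<^sup>*\<^sup>* D0 D'" using assms(1) by simp
  moreover have "same_interp D0 D'" using assms(2,6) by (rule same_interp_trans)
  ultimately show ?thesis unfolding reach_def using \<open>is_mbqc D'\<close> \<open>has_pauli_flow D'\<close> eff by blast
qed

section \<open>The rules as moves between labelled graphs\<close>

lemma reach_start:
  assumes "is_mbqc D" "has_pauli_flow D"
  shows "reach D (inputs D) (outputs D) (verts D) (adj D) (lab D)"
  unfolding reach_def using assms by (intro exI[of _ D]) auto

lemma reach_lc:
  assumes r: "reach D0 I O' V E l" and u: "u \<in> V" "u \<notin> set I" "u \<notin> set O'" "\<And>w. E u w \<Longrightarrow> w \<notin> set O'"
  shows "reach D0 I O' V (lc_adj E u) (lc_lab E u l)"
  using r
proof (rule reachE)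
  fix D p h
  assume D: "pauli_flow_step\<^sup>*\<^sup>* D0 D" "same_interp D0 D" "is_mbqc D" and og: "is_open_graph D" and D2: "has_pauli_flow D"
    and V: "verts D = V" "inputs D = I" "outputs D = O'" "ins D = set I" "outs D = set O'" "adj D = E"
    and l: "\<And>v. v \<in> V - set O' \<Longrightarrow> lab D v = l v" and e: "\<And>v. v \<in> V - set O' \<Longrightarrow> is_effect (eff D v)"
    and f: "pflow V E (set I) (set O') l p h"
  note g = reach_graph(1)[OF r]
  have N: "nbrs D u = {w. E u w}" using graph_onD(3)[OF g] V by (auto simp: nbrs_def adj_def)
  define D' where "D' = D\<lparr>edges := sym_diff (edges D) {{v, w} | v w. v \<in> nbrs D u \<and> w \<in> nbrs D u \<and> v \<noteq> w},
            eff := (\<lambda>w. if w = u then eff D u v* lc_op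
                        else if w \<in> nbrs D u then eff D w v* diag1 \<i>
                        else eff D w)\<rparr>"
  have V': "verts D' = V" "inputs D' = I" "outputs D' = O'" using V by (simp_all add: D'_def)
  have rule: "rule_LC D D'"
    unfolding rule_LC_def using u V N by (intro exI[of _ u]) (auto simp: D'_def)
  have adj': "adj D' = lc_adj E u"
  proof (intro ext)
    fix v w
    have "{v, w} \<in> {{v, w} | v w. v \<in> nbrs D u \<and> w \<in> nbrs D u \<and> v \<noteq> w} \<longleftrightarrow> E u v \<and> E u w \<and> v \<noteq> w"
      unfolding N by (auto simp: doubleton_eq_iff)
    then show "adj D' v w \<longleftrightarrow> lc_adj E u v w"
      unfolding V(6)[symmetric] by (auto simp: adj_def D'_def lc_adj_def)
  qed
  have og': "is_open_graph D'"
    unfolding is_open_graph_def ins_def outs_def V'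
  proof (intro conjI ballI)
    fix x assume "x \<in> edges D'"
    then consider "x \<in> edges D" | v w where "x = {v, w}" "E u v" "E u w" "v \<noteq> w" by (auto simp: D'_def N)
    then show "\<exists>v\<in>V. \<exists>w\<in>V. v \<noteq> w \<and> x = {v, w}"
    proof cases
      case 1 then show ?thesis using og unfolding is_open_graph_def V by blast
    next
      case 2 then show ?thesis using graph_onD(3)[OF g] by blast
    qed
  qed (use og V in \<open>auto simp: is_open_graph_def\<close>)
  have "reach D0 (inputs D') (outputs D') (verts D') (adj D') (lc_lab E u l)"
  proof (rule reach_step[OF D D2 _ rule_LC_sound[OF og og' rule] og'])
    show "rewrite_step D D'" using rule by (simp add: rewrite_step_def)
    show "is_effect (eff D' v) \<and> lab D' v = lc_lab E u l v" if "v \<in> verts D' - set (outputs D')" for v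
      using that e[of v] l[of v] u effect_lc_op effect_diag_i unfolding V' lab_def lc_lab_def
      by (auto simp: D'_def N)
    show "\<exists>p h. pflow (verts D') (adj D') (set (inputs D')) (set (outputs D')) (lc_lab E u l) p h"
      unfolding V' adj' using pflow_lc[OF g f u] by blast
  qed
  then show ?thesis unfolding V' adj' .
qed

text \<open>The label does not reveal whether \<open>z\<close> is projected on 0 or on 1. In the
  second case (ZL) flips signs at the neighbours, hence the condition that none of them is an
  output.\<close>

lemma reach_del:
  assumes r: "reach D0 I O' V E l" and z: "z \<in> V" "z \<notin> set I" "z \<notin> set O'" "l z = LZ" "\<And>w. E z w \<Longrightarrow> w \<notin> set O'"
  shows "reach D0 I O' (V - {z}) (del_adj E z) l"
  using r
proof (rule reachE)
  fix D p h
  assume D: "pauli_flow_step\<^sup>*\<^sup>* D0 D" "same_interp D0 D" "is_mbqc D" and og: "is_open_graph D" and D2: "has_pauli_flow D"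
    and V: "verts D = V" "inputs D = I" "outputs D = O'" "ins D = set I" "outs D = set O'" "adj D = E"
    and l: "\<And>v. v \<in> V - set O' \<Longrightarrow> lab D v = l v" and e: "\<And>v. v \<in> V - set O' \<Longrightarrow> is_effect (eff D v)"
    and f: "pflow V E (set I) (set O') l p h"
  note g = reach_graph(1)[OF r]
  have N: "nbrs D z = {w. E z w}" using graph_onD(3)[OF g] V by (auto simp: nbrs_def adj_def)
  have zV: "z \<in> V - set O'" using z by simp
  have "\<exists>a\<in>{0, 1::nat}. eff D z \<propto> YZ (real a * pi)"
    using l[OF zV] z(4) by (intro pauli_label_planes(3)[OF e[OF zV]]) (simp add: lab_def)
  then obtain a :: nat where a: "a \<in> {0, 1}" "eff D z \<propto> YZ (real a * pi)" by blast
  define D' where "D' = D\<lparr>verts := verts D - {z},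
            edges := {e \<in> edges D. z \<notin> e},
            eff := (\<lambda>w. if w \<in> nbrs D z then eff D w v* diag1 ((- 1) ^ a) else eff D w)\<rparr>"
  have V': "verts D' = V - {z}" "inputs D' = I" "outputs D' = O'" using V by (simp_all add: D'_def)
  have rule: "rule_ZL D D'"
    unfolding rule_ZL_def using z V N a by (intro exI[of _ z] bexI[of _ a]) (auto simp: D'_def)
  have adj': "adj D' = del_adj E z"
    unfolding V(6)[symmetric] by (intro ext) (auto simp: adj_def D'_def del_adj_def)
  have og': "is_open_graph D'"
    unfolding is_open_graph_def ins_def outs_def V'
  proof (intro conjI ballI)
    fix x assume "x \<in> edges D'"
    then have x: "x \<in> edges D" "z \<notin> x" by (auto simp: D'_def)
    then obtain v w where "v \<in> V" "w \<in> V" "v \<noteq> w" "x = {v, w}" using og unfolding is_open_graph_def V by blast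
    then show "\<exists>v\<in>V - {z}. \<exists>w\<in>V - {z}. v \<noteq> w \<and> x = {v, w}" using x by blast
  qed (use og V z in \<open>auto simp: is_open_graph_def\<close>)
  have "reach D0 (inputs D') (outputs D') (verts D') (adj D') l"
  proof (rule reach_step[OF D D2 _ rule_ZL_sound[OF og og' rule] og'])
    show "rewrite_step D D'" using rule by (simp add: rewrite_step_def)
    show "is_effect (eff D' v) \<and> lab D' v = l v" if "v \<in> verts D' - set (outputs D')" for v
      using that e[of v] l[of v] effect_diag_sign[of "eff D v" a] unfolding V' lab_def
      by (auto simp: D'_def N)
    show "\<exists>p h. pflow (verts D') (adj D') (set (inputs D')) (set (outputs D')) l p h"
      unfolding V' adj' using pflow_del[OF g f _ z(4)] z by blast
  qed
  then show ?thesis unfolding V' adj' .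
qed

text \<open>The inserted effect is always \<open>YZ 0\<close>, which leaves no signs behind, so
  \<open>N\<close> may contain outputs.\<close>

lemma reach_ins:
  assumes r: "reach D0 I O' V E l" and z: "z \<notin> V" "N \<subseteq> V"
  shows "reach D0 I O' (insert z V) (ins_adj E z N) (l(z := LZ))"
  using r
proof (rule reachE)
  fix D p h
  assume D: "pauli_flow_step\<^sup>*\<^sup>* D0 D" "same_interp D0 D" "is_mbqc D" and og: "is_open_graph D" and D2: "has_pauli_flow D"
    and V: "verts D = V" "inputs D = I" "outputs D = O'" "ins D = set I" "outs D = set O'" "adj D = E"
    and l: "\<And>v. v \<in> V - set O' \<Longrightarrow> lab D v = l v" and e: "\<And>v. v \<in> V - set O' \<Longrightarrow> is_effect (eff D v)"
    and f: "pflow V E (set I) (set O') l p h"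
  note g = reach_graph(1)[OF r] and io = reach_graph(2,3)[OF r]
  \<comment> \<open>\<open>rule_ZL\<close> keeps the junk value of \<open>eff\<close> at \<open>z\<close>, which must hence be set in advance.\<close>
  define D1 where "D1 = D\<lparr>eff := (eff D)(z := YZ 0)\<rparr>"
  have V1: "verts D1 = V" "inputs D1 = I" "outputs D1 = O'" "edges D1 = edges D" "outs D1 = set O'" "ins D1 = set I"
    using V by (simp_all add: D1_def ins_def outs_def)
  have adj1: "adj D1 = E" unfolding V(6)[symmetric] by (intro ext) (simp add: adj_def V1)
  have og1: "is_open_graph D1" using og by (simp add: is_open_graph_def D1_def ins_def outs_def)
  have "interp D1 x y = interp D x y" for x y
    unfolding interp_def V1 V using z by (intro sum.cong refl arg_cong2[of _ _ _ _ "(*)"] prod.cong) (auto simp: D1_def)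
  then have si: "same_interp D D1" unfolding same_interp_def V1 V by (auto intro: exI[of _ 1])
  have "mbqc_iso D D1"
    unfolding mbqc_iso_def by (rule exI[of _ id]) (use z V in \<open>auto simp: D1_def\<close>)
  then have rw: "rewrite_step D D1" by (simp add: rewrite_step_def)
  have is1: "is_mbqc D1" using og1 e z by (auto simp: is_mbqc_def V1) (auto simp: D1_def)
  have "lab D1 v = l v" if "v \<in> V - set O'" for v using that z l[OF that] by (auto simp: lab_def D1_def)
  then have "has_pauli_flow D1"
    unfolding has_pauli_flow_iff[OF og1] V1 adj1 using f pflow_cong[of V "set O'" "lab D1" l] by blast
  note st1 = this
  have D1s: "pauli_flow_step\<^sup>*\<^sup>* D0 D1" "same_interp D0 D1"
    using D D2 is1 st1 rw si
    by (auto simp: pauli_flow_step_def intro: rtranclp.rtrancl_into_rtrancl same_interp_trans)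
  define D' where "D' = D1\<lparr>verts := insert z V, edges := edges D1 \<union> (\<lambda>w. {z, w}) ` N\<rparr>"
  have V': "verts D' = insert z V" "inputs D' = I" "outputs D' = O'" "ins D' = set I" "outs D' = set O'"
    by (simp_all add: D'_def V1 ins_def outs_def)
  have adj': "adj D' = ins_adj E z N"
  proof (intro ext)
    fix v w
    have "{v, w} \<in> (\<lambda>w. {z, w}) ` N \<longleftrightarrow> v = z \<and> w \<in> N \<or> w = z \<and> v \<in> N" by (auto simp: doubleton_eq_iff)
    moreover have "edges D' = edges D \<union> (\<lambda>w. {z, w}) ` N" by (simp add: D'_def V1)
    ultimately show "adj D' v w \<longleftrightarrow> ins_adj E z N v w"
      unfolding V(6)[symmetric] adj_def ins_adj_def by simp
  qed
  have ze: "z \<notin> e" if "e \<in> edges D" for e using open_graphD(2)[OF og that] z V by auto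
  have og': "is_open_graph D'"
    unfolding is_open_graph_def V'
  proof (intro conjI ballI)
    fix x assume "x \<in> edges D'"
    then consider "x \<in> edges D" | w where "x = {z, w}" "w \<in> N" by (auto simp: D'_def V1)
    then show "\<exists>v\<in>insert z V. \<exists>w\<in>insert z V. v \<noteq> w \<and> x = {v, w}"
    proof cases
      case 1 then show ?thesis using og unfolding is_open_graph_def V by blast
    next
      case 2 then show ?thesis using z by (intro bexI[of _ z] bexI[of _ w]) auto
    qed
  qed (use og V io in \<open>auto simp: is_open_graph_def\<close>)
  have rule: "rule_ZL D' D1"
    unfolding rule_ZL_def
  proof (intro exI[of _ z] bexI[of _ 0] conjI)
    show "D1 = D'\<lparr>verts := verts D' - {z}, edges := {e \<in> edges D'. z \<notin> e},
      eff := \<lambda>w. if w \<in> nbrs D' z then eff D' w v* diag1 ((- 1) ^ 0) else eff D' w\<rparr>"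
      using z ze by (auto simp: D'_def diag1_one V1 intro!: mbqc.equality)
    show "z \<notin> ins D' \<union> outs D'" using z io unfolding V' by auto
  qed (simp_all add: V' D'_def D1_def)
  have "reach D0 (inputs D') (outputs D') (verts D') (adj D') (l(z := LZ))"
  proof (rule reach_step[OF D1s is1 st1 _ same_interp_sym[OF rule_ZL_sound[OF og' og1 rule]] og'])
    show "rewrite_step D1 D'" using rule by (simp add: rewrite_step_def)
    show "is_effect (eff D' v) \<and> lab D' v = (l(z := LZ)) v" if "v \<in> verts D' - set (outputs D')" for v
      using that e[of v] l[of v] z unfolding V' lab_def by (auto simp: D'_def D1_def)
    show "\<exists>p h. pflow (verts D') (adj D') (set (inputs D')) (set (outputs D')) (l(z := LZ)) p h"
      unfolding V' adj' using pflow_ins[OF g f z io] by blast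
  qed
  then show ?thesis unfolding V' adj' .
qed

lemma distinct_map_replace: "distinct xs \<Longrightarrow> a \<notin> set xs \<Longrightarrow> distinct (map (\<lambda>v. if v = c then a else v) xs)"
  by (induction xs) auto

lemma set_map_replace: "c \<in> set xs \<Longrightarrow> set (map (\<lambda>v. if v = c then a else v) xs) = insert a (set xs - {c})"
  by (induction xs) auto

lemma reach_input:
  assumes r: "reach D0 I O' V E l" and c: "c \<in> set I" "a \<notin> V" "b \<notin> V" "a \<noteq> b"
  shows "reach D0 (map (\<lambda>v. if v = c then a else v) I) O' (V \<union> {a, b}) (path_adj E a b c) (l(a := LX, b := LX))"
  using r
proof (rule reachE)
  fix D p h
  assume D: "pauli_flow_step\<^sup>*\<^sup>* D0 D" "same_interp D0 D" "is_mbqc D" and og: "is_open_graph D" and D2: "has_pauli_flow D"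
    and V: "verts D = V" "inputs D = I" "outputs D = O'" "ins D = set I" "outs D = set O'" "adj D = E"
    and l: "\<And>v. v \<in> V - set O' \<Longrightarrow> lab D v = l v" and e: "\<And>v. v \<in> V - set O' \<Longrightarrow> is_effect (eff D v)"
    and f: "pflow V E (set I) (set O') l p h"
  note g = reach_graph(1)[OF r] and io = reach_graph(2,3)[OF r]
  define D' where "D' = D\<lparr>verts := verts D \<union> {a, b},
            edges := edges D \<union> {{a, b}, {b, c}},
            inputs := map (\<lambda>v. if v = c then a else v) (inputs D),
            eff := (eff D)(a := XY 0, b := XY 0)\<rparr>"
  have V': "verts D' = V \<union> {a, b}" "inputs D' = map (\<lambda>v. if v = c then a else v) I" "outputs D' = O'"
    using V by (simp_all add: D'_def)
  have sI: "set (map (\<lambda>v. if v = c then a else v) I) = insert a (set I - {c})" using c by (intro set_map_replace)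
  have rule: "rule_IO_input D D'"
    unfolding rule_IO_input_def using c V by (intro exI[of _ a] exI[of _ b] exI[of _ c]) (auto simp: D'_def)
  have adj': "adj D' = path_adj E a b c"
    unfolding V(6)[symmetric] by (intro ext) (auto simp: adj_def D'_def path_adj_def)
  have og': "is_open_graph D'"
    unfolding is_open_graph_def ins_def outs_def V' sI
  proof (intro conjI ballI)
    show "distinct (map (\<lambda>v. if v = c then a else v) I)" using open_graphD(6)[OF og] c io V by (intro distinct_map_replace) auto
    show "distinct O'" using open_graphD(7)[OF og] V by simp
    fix x assume "x \<in> edges D'"
    then consider "x \<in> edges D" | "x = {a, b}" | "x = {b, c}" by (auto simp: D'_def)
    then show "\<exists>u\<in>V \<union> {a, b}. \<exists>v\<in>V \<union> {a, b}. u \<noteq> v \<and> x = {u, v}"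
    proof cases
      case 1 then show ?thesis using og unfolding is_open_graph_def V by blast
    next
      case 2 then show ?thesis using c by (intro bexI[of _ a] bexI[of _ b]) auto
    next
      case 3 then show ?thesis using c io by (intro bexI[of _ b] bexI[of _ c]) auto
    qed
  qed (use g io in \<open>auto simp: graph_on_def\<close>)
  have "reach D0 (inputs D') (outputs D') (verts D') (adj D') (l(a := LX, b := LX))"
  proof (rule reach_step[OF D D2 _ rule_IO_input_sound[OF og og' rule] og'])
    show "rewrite_step D D'" using rule by (simp add: rewrite_step_def)
    show "is_effect (eff D' v) \<and> lab D' v = (l(a := LX, b := LX)) v" if "v \<in> verts D' - set (outputs D')" for v
      using that e[of v] l[of v] unfolding V' lab_def by (auto simp: D'_def)
    show "\<exists>p h. pflow (verts D') (adj D') (set (inputs D')) (set (outputs D')) (l(a := LX, b := LX)) p h"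
      unfolding V' adj' sI using pflow_input[OF g f c io] by blast
  qed
  then show ?thesis unfolding V' adj' .
qed

lemma reach_output:
  assumes r: "reach D0 I O' V E l" and c: "c \<in> set O'" "b \<notin> V" "d \<notin> V" "d \<noteq> b"
  shows "reach D0 I (map (\<lambda>v. if v = c then d else v) O') (V \<union> {d, b}) (path_adj E d b c) (l(c := LX, b := LX))"
  using r
proof (rule reachE)
  fix D p h
  assume D: "pauli_flow_step\<^sup>*\<^sup>* D0 D" "same_interp D0 D" "is_mbqc D" and og: "is_open_graph D" and D2: "has_pauli_flow D"
    and V: "verts D = V" "inputs D = I" "outputs D = O'" "ins D = set I" "outs D = set O'" "adj D = E"
    and l: "\<And>v. v \<in> V - set O' \<Longrightarrow> lab D v = l v" and e: "\<And>v. v \<in> V - set O' \<Longrightarrow> is_effect (eff D v)"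
    and f: "pflow V E (set I) (set O') l p h"
  note g = reach_graph(1)[OF r] and io = reach_graph(2,3)[OF r]
  define D' where "D' = D\<lparr>verts := verts D \<union> {b, d},
            edges := edges D \<union> {{c, b}, {b, d}},
            outputs := map (\<lambda>v. if v = c then d else v) (outputs D),
            eff := (eff D)(c := XY 0, b := XY 0)\<rparr>"
  have V': "verts D' = V \<union> {d, b}" "outputs D' = map (\<lambda>v. if v = c then d else v) O'" "inputs D' = I"
    using V by (auto simp: D'_def)
  have sO: "set (map (\<lambda>v. if v = c then d else v) O') = insert d (set O' - {c})" using c by (intro set_map_replace)
  have rule: "rule_IO_output D D'"
    unfolding rule_IO_output_def using c V by (intro exI[of _ b] exI[of _ c] exI[of _ d]) (auto simp: D'_def)
  have adj': "adj D' = path_adj E d b c"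
    unfolding V(6)[symmetric] by (intro ext) (auto simp: adj_def D'_def path_adj_def insert_commute)
  have og': "is_open_graph D'"
    unfolding is_open_graph_def ins_def outs_def V' sO
  proof (intro conjI ballI)
    show "distinct (map (\<lambda>v. if v = c then d else v) O')" using open_graphD(7)[OF og] c io V by (intro distinct_map_replace) auto
    show "distinct I" using open_graphD(6)[OF og] V by simp
    fix x assume "x \<in> edges D'"
    then consider "x \<in> edges D" | "x = {c, b}" | "x = {b, d}" by (auto simp: D'_def)
    then show "\<exists>u\<in>V \<union> {d, b}. \<exists>v\<in>V \<union> {d, b}. u \<noteq> v \<and> x = {u, v}"
    proof cases
      case 1 then show ?thesis using og unfolding is_open_graph_def V by blast
    next
      case 2 then show ?thesis using c io by (intro bexI[of _ c] bexI[of _ b]) auto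
    next
      case 3 then show ?thesis using c by (intro bexI[of _ b] bexI[of _ d]) auto
    qed
  qed (use g io in \<open>auto simp: graph_on_def\<close>)
  have H: "h v < Suc (Max (h ` V))" if "v \<in> V" for v
    using that graph_onD(1)[OF g] by (simp add: less_Suc_eq_le)
  have "reach D0 (inputs D') (outputs D') (verts D') (adj D') (l(c := LX, b := LX))"
  proof (rule reach_step[OF D D2 _ rule_IO_output_sound[OF og og' rule] og'])
    show "rewrite_step D D'" using rule by (simp add: rewrite_step_def)
    show "is_effect (eff D' v) \<and> lab D' v = (l(c := LX, b := LX)) v" if "v \<in> verts D' - set (outputs D')" for v
    proof (cases "v = c \<or> v = b")
      case True then show ?thesis by (auto simp: lab_def D'_def)
    next
      case False
      then have "v \<in> V - set O'" using that unfolding V' sO by auto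
      then show ?thesis using e[of v] l[of v] False by (simp add: lab_def D'_def)
    qed
    show "\<exists>p h. pflow (verts D') (adj D') (set (inputs D')) (set (outputs D')) (l(c := LX, b := LX)) p h"
      unfolding V' adj' sO using pflow_output[OF g f c io H] by blast
  qed
  then show ?thesis unfolding V' adj' .
qed

section \<open>Derived rewrites\<close>

text \<open>\<open>a\<close> and \<open>b\<close> exchange their neighbourhoods. Between other
  vertices an edge is toggled exactly if the ends lie in different ones of the three classes:
  neighbours of \<open>a\<close> only, of \<open>b\<close> only, of both.\<close>

definition pivot_adj :: "('v \<Rightarrow> 'v \<Rightarrow> bool) \<Rightarrow> 'v \<Rightarrow> 'v \<Rightarrow> 'v \<Rightarrow> 'v \<Rightarrow> bool" where
  "pivot_adj E a b v w \<longleftrightarrow>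
    (if v = a then (if w = a then False else if w = b then True else E b w)
     else if v = b then (if w = b then False else if w = a then True else E a w)
     else if w = a then E b v else if w = b then E a v
     else E v w \<noteq> ((E a v \<and> E b w) \<noteq> (E b v \<and> E a w)))"

text \<open>The action of a Hadamard gate, which exchanges X and Z.\<close>

fun pivot_label :: "label \<Rightarrow> label" where
  "pivot_label LX = LZ" | "pivot_label LY = LY" | "pivot_label LZ = LX"
| "pivot_label LXY = LYZ" | "pivot_label LXZ = LXZ" | "pivot_label LYZ = LXY"

lemma pivot_label_lc [simp]: "lc_self (lc_nbr (lc_self l)) = pivot_label l" "lc_nbr (lc_self (lc_nbr l)) = pivot_label l"
  "lc_nbr (lc_nbr l) = l"
  by (cases l; simp)+

lemma lc_thrice:
  assumes g: "graph_on V E" and ab: "E a b"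
  shows "lc_adj (lc_adj (lc_adj E a) b) a = pivot_adj E a b"
proof (intro ext)
  fix v w
  have s: "E v a = E a v" "E v b = E b v" "E w a = E a w" "E w b = E b w" "E w v = E v w" "E b a" "\<not> E a a" "\<not> E b b"
    "\<not> E v v" "a \<noteq> b"
    using g ab by (auto simp: graph_on_def)
  consider "v = a" | "v = b" | "v \<noteq> a" "v \<noteq> b" "w = a" | "v \<noteq> a" "v \<noteq> b" "w = b" | "v \<noteq> a" "v \<noteq> b" "w \<noteq> a" "w \<noteq> b"
    by blast
  then show "lc_adj (lc_adj (lc_adj E a) b) a v w = pivot_adj E a b v w"
    by cases (use s ab in \<open>auto simp: lc_adj_def pivot_adj_def\<close>)
qed

text \<open>A vertex other than \<open>a\<close> and \<open>b\<close> is adjacent to the centre in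
  two of the three complementations or in none, and \<open>lc_nbr\<close> is an involution.\<close>

lemma lc_lab_thrice:
  assumes g: "graph_on V E" and ab: "E a b"
  shows "lc_lab (lc_adj (lc_adj E a) b) a (lc_lab (lc_adj E a) b (lc_lab E a l)) =
    l(a := pivot_label (l a), b := pivot_label (l b))"
proof
  fix v
  have s: "E b a" "\<not> E a a" "\<not> E b b" "a \<noteq> b" using g ab by (auto simp: graph_on_def)
  show "lc_lab (lc_adj (lc_adj E a) b) a (lc_lab (lc_adj E a) b (lc_lab E a l)) v =
    (l(a := pivot_label (l a), b := pivot_label (l b))) v"
    using s ab by (cases "v = a"; cases "v = b"; cases "E a v"; cases "E b v") (auto simp: lc_lab_def lc_adj_def)
qed

lemma reach_pivot:
  assumes r: "reach D0 I O' V E l" and ab: "E a b" "a \<notin> set I" "b \<notin> set I"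
    and nO: "\<And>w. E a w \<Longrightarrow> w \<notin> set O'" "\<And>w. E b w \<Longrightarrow> w \<notin> set O'"
  shows "reach D0 I O' V (pivot_adj E a b) (l(a := pivot_label (l a), b := pivot_label (l b)))"
proof -
  note g = reach_graph(1)[OF r]
  have s: "E b a" "a \<noteq> b" "a \<in> V" "b \<in> V" "a \<notin> set O'" "b \<notin> set O'" using g ab nO by (auto simp: graph_on_def)
  have r1: "reach D0 I O' V (lc_adj E a) (lc_lab E a l)" using s ab nO by (intro reach_lc[OF r]) auto
  have r2: "reach D0 I O' V (lc_adj (lc_adj E a) b) (lc_lab (lc_adj E a) b (lc_lab E a l))"
    using s ab nO by (intro reach_lc[OF r1]) (auto simp: lc_adj_def)
  have "reach D0 I O' V (lc_adj (lc_adj (lc_adj E a) b) a)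
      (lc_lab (lc_adj (lc_adj E a) b) a (lc_lab (lc_adj E a) b (lc_lab E a l)))"
    using s ab nO by (intro reach_lc[OF r2]) (auto simp: lc_adj_def)
  then show ?thesis unfolding lc_thrice[OF g ab(1)] lc_lab_thrice[OF g ab(1)] .
qed

text \<open>The pivot turns the X-measured \<open>a\<close> into a Z-measured vertex, which can be
  deleted. What remains of \<open>b\<close> has the former neighbourhood of
  \<open>a\<close>.\<close>

lemma reach_pivot_delete:
  assumes r: "reach D0 I O' V E l" and ab: "E a b" "a \<notin> set I" "b \<notin> set I" "l a = LX"
    and nO: "\<And>w. E a w \<Longrightarrow> w \<notin> set O'" "\<And>w. E b w \<Longrightarrow> w \<notin> set O'"
  shows "reach D0 I O' (V - {a}) (del_adj (pivot_adj E a b) a) (l(b := pivot_label (l b)))"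
proof -
  note g = reach_graph(1)[OF r]
  have s: "E b a" "a \<noteq> b" "a \<in> V" "a \<notin> set O'" "b \<notin> set O'" using g ab nO by (auto simp: graph_on_def)
  have "reach D0 I O' (V - {a}) (del_adj (pivot_adj E a b) a) (l(a := pivot_label (l a), b := pivot_label (l b)))"
    using s ab nO by (intro reach_del[OF reach_pivot[OF r ab(1-3) nO]]) (auto simp: pivot_adj_def split: if_splits)
  then show ?thesis by (rule reach_cong) auto
qed

lemma reach_delete_pair:
  assumes r: "reach D0 I O' V E l" and ab: "E a b" "a \<notin> set I" "b \<notin> set I" "l a = LX" "l b = LX"
    and nO: "\<And>w. E a w \<Longrightarrow> w \<notin> set O'" "\<And>w. E b w \<Longrightarrow> w \<notin> set O'"
  shows "reach D0 I O' (V - {a} - {b}) (del_adj (del_adj (pivot_adj E a b) a) b) l"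
proof -
  note g = reach_graph(1)[OF r]
  have s: "E b a" "a \<noteq> b" "b \<in> V" "a \<notin> set O'" "b \<notin> set O'" using g ab nO by (auto simp: graph_on_def)
  have "reach D0 I O' (V - {a} - {b}) (del_adj (del_adj (pivot_adj E a b) a) b) (l(b := pivot_label (l b)))"
    using s ab nO
    by (intro reach_del[OF reach_pivot_delete[OF r ab(1-4) nO]]) (auto simp: pivot_adj_def del_adj_def split: if_splits)
  then show ?thesis by (rule reach_cong) auto
qed

text \<open>A vertex \<open>z\<close> measured in the Z basis is attached to \<open>a\<close> and \<open>M\<close>; pivoting along \<open>{a, z}\<close> lets \<open>z\<close> take
  over the role of \<open>a\<close> while the neighbourhoods of the vertices in \<open>M\<close> change by that of \<open>a\<close>.\<close>

definition replace_adj :: "('v \<Rightarrow> 'v \<Rightarrow> bool) \<Rightarrow> 'v \<Rightarrow> 'v \<Rightarrow> 'v set \<Rightarrow> 'v \<Rightarrow> 'v \<Rightarrow> bool" where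
  "replace_adj E a z M x y \<longleftrightarrow> x \<noteq> a \<and> y \<noteq> a \<and> x \<noteq> y \<and>
    (if x = z then E a y else if y = z then E a x
     else E x y \<noteq> ((x \<in> M \<and> E a y) \<noteq> (y \<in> M \<and> E a x)))"

lemma reach_replace:
  assumes r: "reach D0 I O' V E l" and a: "a \<in> V" "a \<notin> set I" "l a = LX" "a \<notin> set O'" "\<And>w. E a w \<Longrightarrow> w \<notin> set O'"
    and M: "M \<subseteq> V" "a \<notin> M" "M \<inter> set O' = {}" and z: "z \<notin> V"
  shows "reach D0 I O' (insert z (V - {a})) (replace_adj E a z M) (l(z := LX))"
proof -
  note g = reach_graph(1)[OF r] and io = reach_graph(2,3)[OF r]
  have nz: "\<not> E x z" "\<not> E z x" for x using g z by (auto simp: graph_on_def)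
  have s: "E x a = E a x" "\<not> E x x" for x using g by (auto simp: graph_on_def)
  have za: "z \<noteq> a" using a z by auto
  let ?E1 = "ins_adj E z (insert a M)"
  have r1: "reach D0 I O' (insert z V) ?E1 (l(z := LZ))" using a M z by (intro reach_ins[OF r]) auto
  have "reach D0 I O' (insert z V - {a}) (del_adj (pivot_adj ?E1 a z) a) ((l(z := LZ))(z := pivot_label ((l(z := LZ)) z)))"
    using a M z io za by (intro reach_pivot_delete[OF r1]) (auto simp: ins_adj_def nz)
  moreover have "del_adj (pivot_adj ?E1 a z) a = replace_adj E a z M"
    using za s nz z M by (intro ext) (auto simp: del_adj_def pivot_adj_def ins_adj_def replace_adj_def)
  moreover have "insert z V - {a} = insert z (V - {a})" using za by auto
  ultimately show ?thesis by simp
qed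

text \<open>A congruence of the adjacency matrix modulo 2: row and column \<open>a\<close> are added
  to row and column \<open>v\<close>. The two contributions to the diagonal entry at
  \<open>v\<close> cancel, hence \<open>x \<noteq> y\<close>.\<close>

definition rowop_adj :: "('v \<Rightarrow> 'v \<Rightarrow> bool) \<Rightarrow> 'v \<Rightarrow> 'v \<Rightarrow> 'v \<Rightarrow> 'v \<Rightarrow> bool" where
  "rowop_adj E a v x y \<longleftrightarrow> E x y \<noteq> (x \<noteq> y \<and> (x = v \<and> E a y \<or> y = v \<and> E a x))"

lemma ex_fresh: "finite V \<Longrightarrow> \<exists>z :: 'v :: infinite. z \<notin> V"
  using ex_new_if_finite infinite_UNIV by blast

text \<open>Replacing \<open>a\<close> by a fresh \<open>z\<close> with \<open>M = {v}\<close> adds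
  the neighbourhood to \<open>v\<close> but renames the vertex; a second replacement with empty
  \<open>M\<close> gives the name \<open>a\<close> back.\<close>

lemma reach_rowop:
  fixes D0 :: "'v::infinite mbqc"
  assumes r: "reach D0 I O' V E l" and a: "a \<in> V" "a \<notin> set I" "l a = LX" "a \<notin> set O'" "\<And>w. E a w \<Longrightarrow> w \<notin> set O'"
    and v: "v \<in> V" "a \<noteq> v" "v \<notin> set O'"
  shows "reach D0 I O' V (rowop_adj E a v) l"
proof -
  note g = reach_graph(1)[OF r] and io = reach_graph(2,3)[OF r]
  obtain z where z: "z \<notin> V" using ex_fresh graph_onD(1)[OF g] by blast
  have nz: "\<not> E x z" "\<not> E z x" for x using g z by (auto simp: graph_on_def)
  have s: "E x a = E a x" "\<not> E x x" for x using g by (auto simp: graph_on_def)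
  have za: "z \<noteq> a" "z \<noteq> v" using a v z by auto
  have r1: "reach D0 I O' (insert z (V - {a})) (replace_adj E a z {v}) (l(z := LX))"
    using a v z by (intro reach_replace[OF r]) auto
  have "reach D0 I O' (insert a (insert z (V - {a}) - {z})) (replace_adj (replace_adj E a z {v}) z a {}) (l(z := LX, a := LX))"
    using a v z za io by (intro reach_replace[OF r1]) (auto simp: replace_adj_def)
  moreover have "replace_adj (replace_adj E a z {v}) z a {} = rowop_adj E a v"
    using za v(2) s nz by (intro ext) (auto simp: replace_adj_def rowop_adj_def)
  moreover have "insert a (insert z (V - {a}) - {z}) = V" using a z by auto
  ultimately have "reach D0 I O' V (rowop_adj E a v) (l(z := LX, a := LX))" by simp
  then show ?thesis using a z by (elim reach_cong) auto
qed

definition split_adj :: "('v \<Rightarrow> 'v \<Rightarrow> bool) \<Rightarrow> 'v \<Rightarrow> 'v set \<Rightarrow> 'v \<Rightarrow> 'v \<Rightarrow> 'v \<Rightarrow> 'v \<Rightarrow> bool" where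
  "split_adj E q S c b x y \<longleftrightarrow> (E x y \<and> \<not> (x = q \<and> y \<in> S) \<and> \<not> (y = q \<and> x \<in> S)) \<or>
     x = c \<and> y \<in> S \<or> y = c \<and> x \<in> S \<or> {x, y} = {c, b} \<or> {x, y} = {b, q}"

text \<open>Insert a Z-measured \<open>c\<close> at \<open>q\<close> and a Z-measured
  \<open>b\<close> at \<open>c\<close> and \<open>S\<close>, then pivot along \<open>{c, b}\<close>.
  Both become X-measured, \<open>c\<close> takes over \<open>S\<close>, \<open>b\<close> takes over
  \<open>q\<close>, and the toggling between \<open>{q}\<close> and \<open>S\<close> removes the old
  edges.\<close>

lemma reach_split:
  assumes r: "reach D0 I O' V E l" and q: "q \<in> V" "q \<notin> set O'" and S: "S \<subseteq> {y. E q y}" "S \<inter> set O' = {}"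
    and cb: "c \<notin> V" "b \<notin> V" "c \<noteq> b"
  shows "reach D0 I O' (V \<union> {c, b}) (split_adj E q S c b) (l(c := LX, b := LX))"
proof -
  note g = reach_graph(1)[OF r] and io = reach_graph(2,3)[OF r]
  have SV: "S \<subseteq> V" "q \<notin> S" "c \<notin> S" "b \<notin> S" using S g cb by (auto simp: graph_on_def)
  have nz: "\<not> E x c" "\<not> E c x" "\<not> E x b" "\<not> E b x" for x using g cb by (auto simp: graph_on_def)
  have Sq: "E q y" "E y q" if "y \<in> S" for y using that S g by (auto simp: graph_on_def)
  have ir: "\<not> E x x" for x using g by (auto simp: graph_on_def)
  have neq: "c \<noteq> q" "b \<noteq> q" "c \<notin> set I" "b \<notin> set I" "c \<notin> set O'" "b \<notin> set O'" using cb q io by auto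
  have r1: "reach D0 I O' (insert c V) (ins_adj E c {q}) (l(c := LZ))" using cb q by (intro reach_ins[OF r]) auto
  let ?E2 = "ins_adj (ins_adj E c {q}) b (insert c S)"
  have r2: "reach D0 I O' (insert b (insert c V)) ?E2 (l(c := LZ, b := LZ))"
    using cb SV by (intro reach_ins[OF r1]) auto
  have "reach D0 I O' (insert b (insert c V)) (pivot_adj ?E2 c b)
      ((l(c := LZ, b := LZ))(c := pivot_label ((l(c := LZ, b := LZ)) c), b := pivot_label ((l(c := LZ, b := LZ)) b)))"
    using nz neq S q cb by (intro reach_pivot[OF r2]) (auto simp: ins_adj_def)
  moreover have "pivot_adj ?E2 c b = split_adj E q S c b"
  proof (intro ext)
    fix x y
    consider "x = c" | "x = b" | "x \<noteq> c" "x \<noteq> b" "y = c" | "x \<noteq> c" "x \<noteq> b" "y = b" | "x \<noteq> c" "x \<noteq> b" "y \<noteq> c" "y \<noteq> b"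
      by blast
    then show "pivot_adj ?E2 c b x y \<longleftrightarrow> split_adj E q S c b x y"
      by cases (use nz neq SV Sq ir cb in \<open>auto simp: pivot_adj_def ins_adj_def split_adj_def doubleton_eq_iff\<close>)
  qed
  moreover have "insert b (insert c V) = V \<union> {c, b}" by auto
  ultimately have "reach D0 I O' (V \<union> {c, b}) (split_adj E q S c b)
     ((l(c := LZ, b := LZ))(c := pivot_label ((l(c := LZ, b := LZ)) c), b := pivot_label ((l(c := LZ, b := LZ)) b)))"
    by simp
  then show ?thesis using cb by (elim reach_cong) auto
qed

section \<open>Diagrams with an extended causal flow on a tail\<close>

definition xy_class :: "label \<Rightarrow> bool" where
  "xy_class l \<longleftrightarrow> l \<in> {LX, LY, LXY}"

lemma xy_class_lc_nbr [simp]: "xy_class (lc_nbr l) = xy_class l"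
  by (cases l) (auto simp: xy_class_def)

text \<open>On the set \<open>T\<close> of vertices, which contains all outputs, \<open>f\<close> is an extended causal flow with rank
  function \<open>h\<close>. The vertices in \<open>T\<close> outside the range of \<open>f\<close> act as outputs of the rest of the diagram.\<close>

definition causal_tail ::
  "'v set \<Rightarrow> 'v set \<Rightarrow> 'v set \<Rightarrow> ('v \<Rightarrow> 'v \<Rightarrow> bool) \<Rightarrow> ('v \<Rightarrow> label) \<Rightarrow> 'v set \<Rightarrow> ('v \<Rightarrow> 'v) \<Rightarrow> ('v \<Rightarrow> nat) \<Rightarrow> bool" where
  "causal_tail I O' V E l T f h \<longleftrightarrow> O' \<subseteq> T \<and> T \<subseteq> V \<and>
     (\<forall>v \<in> T - O'. f v \<in> T - I \<and> (f v = v \<and> l v = LYZ \<or> E v (f v) \<and> xy_class (l v)) \<and>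
        (\<forall>x. E (f v) x \<longrightarrow> x \<in> T) \<and> (\<forall>x. x \<noteq> v \<longrightarrow> x = f v \<or> E (f v) x \<longrightarrow> h v < h x)) \<and>
     (\<forall>w \<in> O' \<inter> f ` (T - O'). \<forall>x. E w x \<longrightarrow> x \<in> f ` (T - O')) \<and>
     (\<forall>v \<in> I - T. l v \<in> {LX, LY})"

definition tail_reach ::
  "'v mbqc \<Rightarrow> 'v list \<Rightarrow> 'v list \<Rightarrow> 'v set \<Rightarrow> ('v \<Rightarrow> 'v \<Rightarrow> bool) \<Rightarrow> ('v \<Rightarrow> label) \<Rightarrow> 'v set \<Rightarrow> ('v \<Rightarrow> 'v) \<Rightarrow> ('v \<Rightarrow> nat) \<Rightarrow> bool" where
  "tail_reach D0 I O' V E l T f h \<longleftrightarrow> reach D0 I O' V E l \<and> causal_tail (set I) (set O') V E l T f h \<and>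
     set O' \<subseteq> f ` (T - set O')"

lemma tail_reachD:
  assumes "tail_reach D0 I O' V E l T f h"
  shows "reach D0 I O' V E l" "graph_on V E" "finite V" "set I \<subseteq> V" "set O' \<subseteq> T" "T \<subseteq> V"
    and "v \<in> T - set O' \<Longrightarrow> f v \<in> T - set I"
    and "v \<in> T - set O' \<Longrightarrow> f v = v \<and> l v = LYZ \<or> E v (f v) \<and> xy_class (l v)"
    and "v \<in> T - set O' \<Longrightarrow> x \<noteq> v \<Longrightarrow> x = f v \<or> E (f v) x \<Longrightarrow> h v < h x"
    and "y \<in> f ` (T - set O') \<Longrightarrow> E y x \<Longrightarrow> x \<in> T"
    and "y \<in> f ` (T - set O') \<Longrightarrow> y \<in> T - set I"
    and "w \<in> set O' \<Longrightarrow> w \<in> f ` (T - set O')"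
    and "w \<in> set O' \<Longrightarrow> E w x \<Longrightarrow> x \<in> f ` (T - set O')"
    and "v \<in> set I \<Longrightarrow> v \<notin> T \<Longrightarrow> l v \<in> {LX, LY}"
proof -
  from assms have R: "reach D0 I O' V E l" and sub: "set O' \<subseteq> T" "T \<subseteq> V"
    and c: "\<And>v. v \<in> T - set O' \<Longrightarrow> f v \<in> T - set I \<and> (f v = v \<and> l v = LYZ \<or> E v (f v) \<and> xy_class (l v)) \<and>
        (\<forall>x. E (f v) x \<longrightarrow> x \<in> T) \<and> (\<forall>x. x \<noteq> v \<longrightarrow> x = f v \<or> E (f v) x \<longrightarrow> h v < h x)"
    and o1: "set O' \<subseteq> f ` (T - set O')"
    and o2: "\<And>w x. w \<in> set O' \<inter> f ` (T - set O') \<Longrightarrow> E w x \<Longrightarrow> x \<in> f ` (T - set O')"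
    and i: "\<And>v. v \<in> set I - T \<Longrightarrow> l v \<in> {LX, LY}"
    unfolding tail_reach_def causal_tail_def by simp_all
  show "reach D0 I O' V E l" "set O' \<subseteq> T" "T \<subseteq> V" by fact+
  show "graph_on V E" "set I \<subseteq> V" using reach_graph[OF R] by simp_all
  then show "finite V" by (simp add: graph_on_def)
  show "f v \<in> T - set I" "f v = v \<and> l v = LYZ \<or> E v (f v) \<and> xy_class (l v)" if "v \<in> T - set O'" for v
    using c[OF that] by simp_all
  show "h v < h x" if "v \<in> T - set O'" "x \<noteq> v" "x = f v \<or> E (f v) x" for v x
    using c[OF that(1)] that(2,3) by blast
  show "x \<in> T" if y: "y \<in> f ` (T - set O')" "E y x" for y x
  proof -
    from y obtain v where "v \<in> T - set O'" "y = f v" by blast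
    then show ?thesis using c[of v] y(2) by simp
  qed
  show "y \<in> T - set I" if "y \<in> f ` (T - set O')" for y
  proof -
    from that obtain v where "v \<in> T - set O'" "y = f v" by blast
    then show ?thesis using c[of v] by simp
  qed
  show w: "w \<in> f ` (T - set O')" if "w \<in> set O'" for w using o1 that by (rule subsetD)
  show "x \<in> f ` (T - set O')" if "w \<in> set O'" "E w x" for w x using o2[of w x] w[OF that(1)] that by simp
  show "l v \<in> {LX, LY}" if "v \<in> set I" "v \<notin> T" for v using i that by simp
qed

lemma tail_reachI:
  assumes "reach D0 I O' V E l" "set O' \<subseteq> f ` (T - set O')" "T \<subseteq> V" "set O' \<subseteq> T"
    and "\<And>v. v \<in> T - set O' \<Longrightarrow> f v \<in> T - set I"
    and "\<And>v. v \<in> T - set O' \<Longrightarrow> f v = v \<and> l v = LYZ \<or> E v (f v) \<and> xy_class (l v)"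
    and "\<And>v x. v \<in> T - set O' \<Longrightarrow> E (f v) x \<Longrightarrow> x \<in> T"
    and "\<And>v x. v \<in> T - set O' \<Longrightarrow> x \<noteq> v \<Longrightarrow> x = f v \<or> E (f v) x \<Longrightarrow> h v < h x"
    and "\<And>w x. w \<in> set O' \<Longrightarrow> E w x \<Longrightarrow> x \<in> f ` (T - set O')"
    and "\<And>v. v \<in> set I \<Longrightarrow> v \<notin> T \<Longrightarrow> l v \<in> {LX, LY}"
  shows "tail_reach D0 I O' V E l T f h"
  unfolding tail_reach_def causal_tail_def
proof (intro conjI ballI allI impI)
  show "f v \<in> T - set I" "f v = v \<and> l v = LYZ \<or> E v (f v) \<and> xy_class (l v)" if "v \<in> T - set O'" for v
    using assms(5,6)[OF that] .
  show "x \<in> T" if "v \<in> T - set O'" "E (f v) x" for v x using assms(7)[OF that] .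
  show "h v < h x" if "v \<in> T - set O'" "x \<noteq> v" "x = f v \<or> E (f v) x" for v x using assms(8)[OF that] .
  show "x \<in> f ` (T - set O')" if "w \<in> set O' \<inter> f ` (T - set O')" "E w x" for w x using assms(9)[of w x] that by simp
  show "l v \<in> {LX, LY}" if "v \<in> set I - T" for v using assms(10)[of v] that by simp
qed (fact assms)+

text \<open>Both facts read a neighbourhood condition on the range of \<open>f\<close> backwards.
  The first gives the side conditions of (LC) and (ZL) outside the range; the second shows that
  rewrites at head vertices do not disturb the corrections of the tail.\<close>

lemma tail_reach_nbrs:
  assumes t: "tail_reach D0 I O' V E l T f h"
  shows "a \<notin> f ` (T - set O') \<Longrightarrow> E a w \<Longrightarrow> w \<notin> set O'"
    and "x \<notin> T \<Longrightarrow> E x y \<Longrightarrow> y \<notin> f ` (T - set O')"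
proof -
  note g = graph_onD(4)[OF tail_reachD(2)[OF t]]
  show "a \<notin> f ` (T - set O') \<Longrightarrow> E a w \<Longrightarrow> w \<notin> set O'"
    using tail_reachD(13)[OF t, of w a] g[of a w] by metis
  show "x \<notin> T \<Longrightarrow> E x y \<Longrightarrow> y \<notin> f ` (T - set O')"
    using tail_reachD(10)[OF t, of y x] g[of x y] by metis
qed

text \<open>The tail conditions speak of edges only at vertices of the range of \<open>f\<close>. A
  fixpoint of \<open>f\<close> lies in the range, so its label YZ is kept; other labels need only
  remain in the XY plane.\<close>

lemma tail_reach_edit:
  assumes t: "tail_reach D0 I O' V E l T f h" and r: "reach D0 I O' V' E' l'" and T: "T \<subseteq> V'"
    and E: "\<And>y x. y \<in> f ` (T - set O') \<Longrightarrow> E' y x \<longleftrightarrow> E y x"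
    and l: "\<And>v. v \<in> T - set O' \<Longrightarrow> l' v = l v \<or> v \<notin> f ` (T - set O') \<and> (xy_class (l v) \<longrightarrow> xy_class (l' v))"
    and I: "\<And>v. v \<in> set I \<Longrightarrow> v \<notin> T \<Longrightarrow> l' v \<in> {LX, LY}"
  shows "tail_reach D0 I O' V' E' l' T f h"
proof (rule tail_reachI[OF r _ T])
  note d = tail_reachD[OF t]
  show "set O' \<subseteq> f ` (T - set O')" using d(12) by (rule subsetI)
  show "set O' \<subseteq> T" by (rule d(5))
  fix v assume v: "v \<in> T - set O'"
  then have fv: "f v \<in> f ` (T - set O')" by (rule imageI)
  show "f v \<in> T - set I" by (rule d(7)[OF v])
  have "E' v (f v) \<longleftrightarrow> E v (f v)"
    using E[OF fv, of v] graph_on_sym[OF d(2), of v "f v"] graph_on_sym[OF reach_graph(1)[OF r], of v "f v"] by simp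
  moreover have "l' v = l v" if "f v = v" using l[OF v] fv that by auto
  ultimately show "f v = v \<and> l' v = LYZ \<or> E' v (f v) \<and> xy_class (l' v)"
    using d(8)[OF v] l[OF v] by auto
  show "x \<in> T" if "E' (f v) x" for x using d(10)[OF fv] that E[OF fv] by simp
  show "h v < h x" if "x \<noteq> v" "x = f v \<or> E' (f v) x" for x using d(9)[OF v that(1)] that(2) E[OF fv] by simp
next
  note d = tail_reachD[OF t]
  show "x \<in> f ` (T - set O')" if "w \<in> set O'" "E' w x" for w x
    using d(13)[OF that(1), of x] E[OF d(12)[OF that(1)], of x] that(2) by simp
qed (rule I)

text \<open>The new vertex \<open>w\<close> gets rank 0: apart from \<open>w\<close> itself, what
  \<open>y\<close> disturbs lies in the tail, and old correctors have no neighbour outside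
  \<open>T\<close>, so they never see \<open>w\<close>.\<close>

lemma tail_reach_grow:
  assumes t: "tail_reach D0 I O' V E l T f h" and w: "w \<in> V - T" and y: "y \<notin> set I"
    and yw: "y = w \<and> l w = LYZ \<or> y \<in> T \<and> E w y \<and> xy_class (l w)"
    and N: "\<And>x. E y x \<Longrightarrow> x \<in> insert w T"
  shows "tail_reach D0 I O' V E l (insert w T) (f(w := y)) (\<lambda>x. if x = w then 0 else Suc (h x))"
proof -
  note d = tail_reachD[OF t]
  let ?f = "f(w := y)" and ?h = "\<lambda>x. if x = w then 0 else Suc (h x)"
  have wO: "w \<notin> set O'" "w \<notin> T" using d(5) w by auto
  have img: "?f ` (insert w T - set O') = insert y (f ` (T - set O'))" using wO by auto
  show ?thesis
  proof (rule tail_reachI[OF d(1)])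
    show "set O' \<subseteq> ?f ` (insert w T - set O')" unfolding img using d(12) by blast
    show "insert w T \<subseteq> V" "set O' \<subseteq> insert w T" using w d(5,6) by auto
    fix v assume v: "v \<in> insert w T - set O'"
    show "?f v \<in> insert w T - set I" using v y yw d(7)[of v] by auto
    show "?f v = v \<and> l v = LYZ \<or> E v (?f v) \<and> xy_class (l v)" using v yw d(8)[of v] by auto
    have new: "x \<in> T" "x \<noteq> w" if "v \<noteq> w" "x = f v \<or> E (f v) x" for x
      using that d(7)[of v] d(10)[of "f v" x] v wO by auto
    show "x \<in> insert w T" if "E (?f v) x" for x using that N[of x] new(1)[of x] by (cases "v = w") auto
    show "?h v < ?h x" if x: "x \<noteq> v" "x = ?f v \<or> E (?f v) x" for x
    proof (cases "v = w")
      case True then show ?thesis using x by simp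
    next
      case False
      then have "v \<in> T - set O'" using v by auto
      then show ?thesis using d(9)[of v x] new(2)[of x] x False by simp
    qed
  next
    show "x \<in> ?f ` (insert w T - set O')" if "v \<in> set O'" "E v x" for v x
      unfolding img using d(13)[OF that] by blast
    show "l v \<in> {LX, LY}" if "v \<in> set I" "v \<notin> insert w T" for v using d(14)[of v] that by blast
  qed
qed

text \<open>The weight 2 pays for \<open>rotate_YZ\<close>, which brings one vertex into the XY
  plane at the price of one new head vertex.\<close>

definition tail_measure :: "'v set \<Rightarrow> ('v \<Rightarrow> label) \<Rightarrow> 'v set \<Rightarrow> nat" where
  "tail_measure V l T = card (V - T) + 2 * card {v \<in> V - T. \<not> xy_class (l v)}"

definition improvable :: "'v mbqc \<Rightarrow> 'v list \<Rightarrow> 'v list \<Rightarrow> 'v set \<Rightarrow> ('v \<Rightarrow> label) \<Rightarrow> 'v set \<Rightarrow> bool" where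
  "improvable D0 I O' V l T \<longleftrightarrow> (\<exists>V' E' l' T' f' h'. tail_reach D0 I O' V' E' l' T' f' h' \<and>
     tail_measure V' l' T' < tail_measure V l T)"

lemma tail_measure_less:
  assumes "finite V" "V' - T' \<subset> V - T" "\<And>v. v \<in> V' - T' \<Longrightarrow> \<not> xy_class (l' v) \<Longrightarrow> \<not> xy_class (l v)"
  shows "tail_measure V' l' T' < tail_measure V l T"
proof -
  have "card (V' - T') < card (V - T)" using assms(1,2) by (intro psubset_card_mono) auto
  moreover have "card {v \<in> V' - T'. \<not> xy_class (l' v)} \<le> card {v \<in> V - T. \<not> xy_class (l v)}"
    using assms by (intro card_mono) auto
  ultimately show ?thesis unfolding tail_measure_def by linarith
qed

section \<open>Bringing the head into the XY plane\<close>

lemma delete_Z: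
  assumes t: "tail_reach D0 I O' V E l T f h" and w: "w \<in> V - T" "l w = LZ"
  shows "improvable D0 I O' V l T"
proof -
  note d = tail_reachD[OF t] and n = tail_reach_nbrs[OF t]
  have wI: "w \<notin> set I" "w \<notin> set O'" "w \<notin> f ` (T - set O')" using d(14)[of w] d(11)[of w] d(5) w by auto
  have r: "reach D0 I O' (V - {w}) (del_adj E w) l"
    by (rule reach_del[OF d(1) _ wI(1,2) w(2) n(1)[OF wI(3)]]) (use w in simp)
  have "tail_reach D0 I O' (V - {w}) (del_adj E w) l T f h"
  proof (rule tail_reach_edit[OF t r])
    show "T \<subseteq> V - {w}" using w d(6) by auto
    show "del_adj E w y x \<longleftrightarrow> E y x" if "y \<in> f ` (T - set O')" for y x
      using that d(10)[OF that, of x] d(11)[OF that] w by (auto simp: del_adj_def)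
  qed (use d(14) in auto)
  moreover have "tail_measure (V - {w}) l T < tail_measure V l T"
    using d(3) w by (intro tail_measure_less) auto
  ultimately show ?thesis unfolding improvable_def by blast
qed

text \<open>The complemented edges join neighbours of \<open>w\<close>, none of which is in the
  range of \<open>f\<close>. Labels of frontier vertices and inputs may change, but only by
  \<open>lc_nbr\<close>, which keeps them admissible.\<close>

lemma tail_reach_lc:
  assumes t: "tail_reach D0 I O' V E l T f h" and w: "w \<in> V - T" "w \<notin> set I"
  shows "tail_reach D0 I O' V (lc_adj E w) (lc_lab E w l) T f h"
proof -
  note d = tail_reachD[OF t] and n = tail_reach_nbrs[OF t]
  have wI: "w \<notin> set O'" "w \<notin> f ` (T - set O')" using d(11)[of w] d(5) w by auto
  have r: "reach D0 I O' V (lc_adj E w) (lc_lab E w l)"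
    by (rule reach_lc[OF d(1) _ w(2) wI(1) n(1)[OF wI(2)]]) (use w in simp)
  show ?thesis
  proof (rule tail_reach_edit[OF t r d(6)])
    show "lc_adj E w y x \<longleftrightarrow> E y x" if "y \<in> f ` (T - set O')" for y x
      using n(2)[of w y] that w by (auto simp: lc_adj_def)
    show "lc_lab E w l v = l v \<or> v \<notin> f ` (T - set O') \<and> (xy_class (l v) \<longrightarrow> xy_class (lc_lab E w l v))"
      if "v \<in> T - set O'" for v
      using n(2)[of w v] that w by (auto simp: lc_lab_def)
    show "lc_lab E w l v \<in> {LX, LY}" if "v \<in> set I" "v \<notin> T" for v
      using d(14)[OF that] that w by (auto simp: lc_lab_def)
  qed
qed

lemma rotate_XZ:
  assumes t: "tail_reach D0 I O' V E l T f h" and w: "w \<in> V - T" "l w = LXZ"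
  shows "improvable D0 I O' V l T"
proof -
  note d = tail_reachD[OF t]
  have "w \<notin> set I" using d(14)[of w] w by auto
  then have t': "tail_reach D0 I O' V (lc_adj E w) (lc_lab E w l) T f h" by (rule tail_reach_lc[OF t w(1)])
  have "xy_class (lc_lab E w l v) \<longleftrightarrow> v = w \<or> xy_class (l v)" for v
    using w by (simp add: lc_lab_def xy_class_def[of LXY])
  then have e: "{v \<in> V - T. \<not> xy_class (lc_lab E w l v)} = {v \<in> V - T. \<not> xy_class (l v)} - {w}" by auto
  have "w \<in> {v \<in> V - T. \<not> xy_class (l v)}" using w by (simp add: xy_class_def)
  then have "card {v \<in> V - T. \<not> xy_class (lc_lab E w l v)} < card {v \<in> V - T. \<not> xy_class (l v)}"
    unfolding e using d(3) by (intro card_Diff1_less) simp_all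
  then have "tail_measure V (lc_lab E w l) T < tail_measure V l T" unfolding tail_measure_def by simp
  with t' show ?thesis unfolding improvable_def by blast
qed

lemma tail_reach_ins:
  assumes t: "tail_reach D0 I O' V E l T f h" and z: "z \<notin> V" "N \<subseteq> V - f ` (T - set O')"
  shows "tail_reach D0 I O' (insert z V) (ins_adj E z N) (l(z := LZ)) T f h"
proof -
  note d = tail_reachD[OF t]
  have r: "reach D0 I O' (insert z V) (ins_adj E z N) (l(z := LZ))"
    using z by (intro reach_ins[OF d(1)]) auto
  have zT: "z \<notin> T" "z \<notin> set I" using z d(4,6) by auto
  show ?thesis
  proof (rule tail_reach_edit[OF t r])
    show "T \<subseteq> insert z V" using d(6) by auto
    show "ins_adj E z N y x \<longleftrightarrow> E y x" if "y \<in> f ` (T - set O')" for y x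
      using that z zT d(11)[OF that] by (auto simp: ins_adj_def)
    show "(l(z := LZ)) v = l v \<or> v \<notin> f ` (T - set O') \<and> (xy_class (l v) \<longrightarrow> xy_class ((l(z := LZ)) v))"
      if "v \<in> T - set O'" for v using that zT by auto
    show "(l(z := LZ)) v \<in> {LX, LY}" if "v \<in> set I" "v \<notin> T" for v
      using d(14)[OF that] that zT by auto
  qed
qed

text \<open>(LC) at \<open>w\<close> keeps the label YZ, so a turn about Z is needed, and this takes
  a neighbour as centre. A fresh Z-measured \<open>z\<close> serves: (LC) at \<open>z\<close> gives
  \<open>w\<close> label XZ and \<open>z\<close> label Y, then (LC) at \<open>w\<close> gives XY and
  X.\<close>

lemma rotate_YZ:
  fixes D0 :: "'v::infinite mbqc"
  assumes t: "tail_reach D0 I O' V E l T f h" and w: "w \<in> V - T" "l w = LYZ"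
  shows "improvable D0 I O' V l T"
proof -
  note d = tail_reachD[OF t]
  have wI: "w \<notin> set I" "w \<notin> f ` (T - set O')" using d(14)[of w] d(11)[of w] w by auto
  obtain z where z: "z \<notin> V" using ex_fresh d(3) by blast
  have zw: "z \<noteq> w" "z \<notin> T" "z \<notin> set I" and nz: "\<not> E z x" "\<not> E x z" "\<not> E x x" for x
    using z w d(2,4,6) by (auto simp: graph_on_def)
  let ?E1 = "ins_adj E z {w}" and ?l1 = "l(z := LZ)"
  have t1: "tail_reach D0 I O' (insert z V) ?E1 ?l1 T f h"
    using w wI z by (intro tail_reach_ins[OF t]) auto
  let ?E2 = "lc_adj ?E1 z" and ?l2 = "lc_lab ?E1 z ?l1"
  have t2: "tail_reach D0 I O' (insert z V) ?E2 ?l2 T f h"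
    using zw by (intro tail_reach_lc[OF t1]) auto
  let ?l3 = "lc_lab ?E2 w ?l2"
  have t3: "tail_reach D0 I O' (insert z V) (lc_adj ?E2 w) ?l3 T f h"
    using w wI by (intro tail_reach_lc[OF t2]) auto
  have "xy_class (?l3 v) \<longleftrightarrow> v = z \<or> v = w \<or> xy_class (l v)" for v
    using w zw nz by (auto simp: lc_lab_def lc_adj_def ins_adj_def xy_class_def[of LX] xy_class_def[of LY] xy_class_def[of LXY])
  then have e: "{v \<in> insert z V - T. \<not> xy_class (?l3 v)} = {v \<in> V - T. \<not> xy_class (l v)} - {w}" using z by auto
  have "w \<in> {v \<in> V - T. \<not> xy_class (l v)}" using w by (simp add: xy_class_def)
  moreover have fin: "finite {v \<in> V - T. \<not> xy_class (l v)}" using d(3) by auto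
  ultimately have "card {v \<in> insert z V - T. \<not> xy_class (?l3 v)} = card {v \<in> V - T. \<not> xy_class (l v)} - 1"
    "card {v \<in> V - T. \<not> xy_class (l v)} > 0"
    unfolding e by (simp, subst card_gt_0_iff, blast)
  moreover have "card (insert z V - T) = Suc (card (V - T))"
    using z zw d(3) by (simp add: insert_Diff_if)
  ultimately have "tail_measure (insert z V) ?l3 T < tail_measure V l T" unfolding tail_measure_def by linarith
  then show ?thesis using t3 unfolding improvable_def by blast
qed

text \<open>(LC) at \<open>w\<close> makes it Z-measured. New Y-measured vertices may appear among
  its neighbours, which is harmless for the measure, as all stay in the XY plane and
  \<open>w\<close> disappears.\<close>

lemma delete_Y:
  assumes t: "tail_reach D0 I O' V E l T f h" and w: "w \<in> V - T" "w \<notin> set I" "l w = LY"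
    and xy: "\<And>v. v \<in> V - T \<Longrightarrow> xy_class (l v)"
  shows "improvable D0 I O' V l T"
proof -
  note d = tail_reachD[OF t]
  have t1: "tail_reach D0 I O' V (lc_adj E w) (lc_lab E w l) T f h" using tail_reach_lc[OF t w(1,2)] .
  note d1 = tail_reachD[OF t1] and n1 = tail_reach_nbrs[OF t1]
  have wI: "w \<notin> set O'" "w \<notin> f ` (T - set O')" using d(11)[of w] d(5) w by auto
  have r: "reach D0 I O' (V - {w}) (del_adj (lc_adj E w) w) (lc_lab E w l)"
    by (rule reach_del[OF d1(1) _ w(2) wI(1) _ n1(1)[OF wI(2)]]) (use w in \<open>simp_all add: lc_lab_def\<close>)
  have "tail_reach D0 I O' (V - {w}) (del_adj (lc_adj E w) w) (lc_lab E w l) T f h"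
  proof (rule tail_reach_edit[OF t1 r])
    show "T \<subseteq> V - {w}" using w d(6) by auto
    show "del_adj (lc_adj E w) w y x \<longleftrightarrow> lc_adj E w y x" if "y \<in> f ` (T - set O')" for y x
      using that d1(10)[OF that, of x] d1(11)[OF that] w by (auto simp: del_adj_def)
  qed (use d1(14) in auto)
  moreover have "tail_measure (V - {w}) (lc_lab E w l) T < tail_measure V l T"
  proof (rule tail_measure_less[OF d(3)])
    show "V - {w} - T \<subset> V - T" using w by auto
    show "\<not> xy_class (l v)" if "v \<in> V - {w} - T" "\<not> xy_class (lc_lab E w l v)" for v
      using that xy[of v] by (auto simp: lc_lab_def split: if_splits)
  qed
  ultimately show ?thesis unfolding improvable_def by blast
qed

section \<open>Normalising the frontier\<close>

text \<open>\<open>c\<close> becomes the frontier vertex in place of \<open>q\<close> and is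
  X-measured whatever the label of \<open>q\<close>; \<open>b\<close> and \<open>q\<close> enter the
  range of \<open>f\<close>. The two lowest ranks go to \<open>c\<close> and
  \<open>b\<close>.\<close>

lemma split_frontier:
  fixes D0 :: "'v::infinite mbqc"
  assumes t: "tail_reach D0 I O' V E l T f h" and q: "q \<in> T - f ` (T - set O') - set I"
  shows "\<exists>c b E'. c \<notin> V \<and> b \<notin> V \<and> c \<noteq> b \<and>
    tail_reach D0 I O' (V \<union> {c, b}) E' (l(c := LX, b := LX)) (T \<union> {c, b}) (f(c := b, b := q))
      (\<lambda>v. if v = c then 0 else if v = b then 1 else h v + 2)"
proof -
  note d = tail_reachD[OF t] and n = tail_reach_nbrs[OF t]
  obtain c where c: "c \<notin> V" using ex_fresh d(3) by blast
  obtain b where b: "b \<notin> insert c V" using ex_fresh d(3) finite_insert by metis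
  \<comment> \<open>All head neighbours of \<open>q\<close> move to \<open>c\<close>, so
    \<open>q\<close> sees only the tail and may correct \<open>b\<close>.\<close>
  define S where "S = {y. E q y \<and> y \<notin> T}"
  have cb: "c \<notin> V" "b \<notin> V" "c \<noteq> b" using b c by auto
  have qV: "q \<in> V" "q \<notin> set O'" "q \<in> T" "q \<notin> f ` (T - set O')" "q \<notin> set I" using q d(6,12) by auto
  have neq: "c \<noteq> q" "b \<noteq> q" "c \<notin> T" "b \<notin> T" "c \<notin> set I" "b \<notin> set I" "c \<notin> set O'" "b \<notin> set O'"
    using cb qV d(4,5,6) by auto
  have nz: "\<not> E x c" "\<not> E c x" "\<not> E x b" "\<not> E b x" "\<not> E x x" for x using d(2) cb by (auto simp: graph_on_def)
  have SO: "S \<inter> set O' = {}" "S \<inter> T = {}" using d(5) by (auto simp: S_def)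
  have cS: "c \<notin> S" "b \<notin> S" "q \<notin> S" using nz by (auto simp: S_def)
  let ?E = "split_adj E q S c b" and ?l = "l(c := LX, b := LX)" and ?T = "T \<union> {c, b}" and ?f = "f(c := b, b := q)"
  let ?h = "\<lambda>v. if v = c then 0 else if v = b then 1 else h v + 2"
  have r: "reach D0 I O' (V \<union> {c, b}) ?E ?l"
    using qV SO cb by (intro reach_split[OF d(1)]) (auto simp: S_def)
  have img: "?f ` (?T - set O') = f ` (T - set O') \<union> {b, q}"
  proof -
    have 1: "?T - set O' = (T - set O') \<union> {c, b}" using neq by auto
    have 2: "?f ` (T - set O') = f ` (T - set O')" using neq by (intro image_cong) auto
    have 3: "?f ` {c, b} = {b, q}" using cb by simp
    show ?thesis unfolding 1 image_Un 2 3 ..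
  qed
  have E_img: "?E y x \<longleftrightarrow> E y x" if y: "y \<in> f ` (T - set O')" for y x
  proof -
    have "y \<notin> S" "y \<noteq> q" "y \<noteq> c" "y \<noteq> b" using y qV SO neq d(11)[OF y] by auto
    then show ?thesis by (auto simp: split_adj_def doubleton_eq_iff)
  qed
  have symE: "?E x y \<longleftrightarrow> ?E y x" for x y using graph_on_sym[OF reach_graph(1)[OF r]] .
  have Ec: "?E c x \<longleftrightarrow> x = b \<or> x \<in> S" and Eb: "?E b x \<longleftrightarrow> x = c \<or> x = q"
    and Eq: "?E q x \<longleftrightarrow> x = b \<or> E q x \<and> x \<in> T" for x
    using nz neq cb cS d(3) graph_onD(3)[OF d(2), of q x] by (auto simp: split_adj_def doubleton_eq_iff S_def)
  have "tail_reach D0 I O' (V \<union> {c, b}) ?E ?l ?T ?f ?h"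
  proof (rule tail_reachI[OF r])
    show "set O' \<subseteq> ?f ` (?T - set O')" unfolding img using d(12) by blast
    show "?T \<subseteq> V \<union> {c, b}" "set O' \<subseteq> ?T" using d(5,6) by auto
    fix v assume "v \<in> ?T - set O'"
    then consider "v = c" | "v = b" | "v \<in> T - set O'" "v \<noteq> c" "v \<noteq> b" using neq by auto
    then have "?f v \<in> ?T - set I \<and> (?f v = v \<and> ?l v = LYZ \<or> ?E v (?f v) \<and> xy_class (?l v)) \<and>
      (\<forall>x. ?E (?f v) x \<longrightarrow> x \<in> ?T) \<and> (\<forall>x. x \<noteq> v \<longrightarrow> x = ?f v \<or> ?E (?f v) x \<longrightarrow> ?h v < ?h x)"
    proof cases
      case 1
      then show ?thesis using cb qV neq by (auto simp: Ec Eb xy_class_def)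
    next
      case 2
      then show ?thesis using cb qV neq by (auto simp: Eq Eb xy_class_def)
    next
      case 3
      have fv: "?f v = f v" "f v \<in> f ` (T - set O')" using 3 by auto
      have "?E v (f v) \<longleftrightarrow> E v (f v)"
        using symE[of v "f v"] E_img[OF fv(2), of v] graph_on_sym[OF d(2), of v "f v"] by simp
      moreover have "?h v < ?h x" if "x \<noteq> v" "x = f v \<or> E (f v) x" for x
      proof -
        have "x \<in> T" using that(2) d(7)[OF 3(1)] d(10)[OF fv(2)] by auto
        then show ?thesis using d(9)[OF 3(1) that] 3 neq by auto
      qed
      ultimately show ?thesis
        using d(7,8)[OF 3(1)] d(10)[OF fv(2)] 3 unfolding fv(1) E_img[OF fv(2)] by auto
    qed
    then show "?f v \<in> ?T - set I" "?f v = v \<and> ?l v = LYZ \<or> ?E v (?f v) \<and> xy_class (?l v)"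
      "\<And>x. ?E (?f v) x \<Longrightarrow> x \<in> ?T" "\<And>x. x \<noteq> v \<Longrightarrow> x = ?f v \<or> ?E (?f v) x \<Longrightarrow> ?h v < ?h x"
      by blast+
  next
    show "x \<in> ?f ` (?T - set O')" if "w \<in> set O'" "?E w x" for w x
      using d(13)[OF that(1), of x] that(2) unfolding img E_img[OF d(12)[OF that(1)]] by blast
    show "?l v \<in> {LX, LY}" if "v \<in> set I" "v \<notin> ?T" for v using d(14)[of v] that neq by auto
  qed
  then show ?thesis using cb by blast
qed

text \<open>Row operations act with X-measured vertices, so the members of a correction set on the
  frontier need label X. The head and its labels are not touched.\<close>

lemma normalise_frontier:
  fixes D0 :: "'v::infinite mbqc"
  assumes "tail_reach D0 I O' V E l T f h"
  shows "\<exists>V' E' l' T' f' h'. tail_reach D0 I O' V' E' l' T' f' h' \<and> V' - T' = V - T \<and> (\<forall>v\<in>V - T. l' v = l v) \<and>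
    (\<forall>q \<in> T' - f' ` (T' - set O') - set I. l' q = LX)"
  using assms
proof (induction "card {q \<in> T - f ` (T - set O') - set I. l q \<noteq> LX}" arbitrary: V E l T f h rule: less_induct)
  case less
  note t = less.prems
  note d = tail_reachD[OF t]
  show ?case
  proof (cases "\<forall>q \<in> T - f ` (T - set O') - set I. l q = LX")
    case True then show ?thesis using t by blast
  next
    case False
    then obtain q where q: "q \<in> T - f ` (T - set O') - set I" "l q \<noteq> LX" by blast
    obtain c b E' where cb: "c \<notin> V" "b \<notin> V" "c \<noteq> b" and
      t': "tail_reach D0 I O' (V \<union> {c, b}) E' (l(c := LX, b := LX)) (T \<union> {c, b}) (f(c := b, b := q))
        (\<lambda>v. if v = c then 0 else if v = b then 1 else h v + 2)"
      using split_frontier[OF t q(1)] by blast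
    let ?T = "T \<union> {c, b}" and ?f = "f(c := b, b := q)" and ?l = "l(c := LX, b := LX)"
    have neq: "c \<notin> T" "b \<notin> T" "c \<notin> set O'" "b \<notin> set O'" using cb d(5,6) by auto
    have "f ` (T - set O') \<union> {b, q} \<subseteq> ?f ` (?T - set O')"
    proof -
      have "?f ` (T - set O') = f ` (T - set O')" using neq by (intro image_cong) auto
      moreover have "?f c = b" "?f b = q" using cb by auto
      moreover have "?f ` (T - set O') \<subseteq> ?f ` (?T - set O')" by (rule image_mono) auto
      moreover have "b \<in> ?f ` (?T - set O')" "q \<in> ?f ` (?T - set O')"
        using neq \<open>?f c = b\<close> \<open>?f b = q\<close> by (force intro: image_eqI[where x = c], force intro: image_eqI[where x = b])
      ultimately show ?thesis by blast
    qed
    then have sub: "{r \<in> ?T - ?f ` (?T - set O') - set I. ?l r \<noteq> LX} \<subset> {r \<in> T - f ` (T - set O') - set I. l r \<noteq> LX}"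
      using q neq by auto
    have "finite {r \<in> T - f ` (T - set O') - set I. l r \<noteq> LX}" 
      by (rule finite_subset[OF _ d(3)]) (use d(6) in auto)
    then have lt: "card {r \<in> ?T - ?f ` (?T - set O') - set I. ?l r \<noteq> LX} < card {r \<in> T - f ` (T - set O') - set I. l r \<noteq> LX}"
      using sub by (rule psubset_card_mono)
    have VT: "V \<union> {c, b} - ?T = V - T" using cb by auto
    have "\<forall>v\<in>V - T. ?l v = l v" using cb by auto
    then show ?thesis using less.hyps[OF lt t'] unfolding VT by metis
  qed
qed

section \<open>Moving vertices from the head to the tail\<close>

text \<open>For a corrector in the range of \<open>f\<close>, the only change is that it sees or
  ceases to see \<open>v\<close> if it is adjacent to \<open>a\<close>. As \<open>v\<close> ranks
  above \<open>a\<close>, a new neighbour \<open>v\<close> respects the order.\<close>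

lemma tail_reach_rowop:
  fixes D0 :: "'v::infinite mbqc"
  assumes t: "tail_reach D0 I O' V E l T f h"
    and a: "a \<in> V - f ` (T - set O') - set I" "l a = LX" and v: "v \<in> V - f ` (T - set O')" "a \<noteq> v"
    and av: "a \<in> T \<Longrightarrow> v \<in> T \<and> h a < h v"
  shows "tail_reach D0 I O' V (rowop_adj E a v) l T f h"
proof -
  note d = tail_reachD[OF t] and n = tail_reach_nbrs[OF t]
  have aO: "a \<notin> set O'" "v \<notin> set O'" using a v d(12) by auto
  have aI: "a \<in> V" "a \<notin> f ` (T - set O')" "a \<notin> set I" and vi: "v \<notin> f ` (T - set O')" "v \<in> V" using a v by auto
  have r: "reach D0 I O' V (rowop_adj E a v) l"
    by (rule reach_rowop[OF d(1) aI(1,3) a(2) aO(1) n(1)[OF aI(2)] vi(2) v(2) aO(2)])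
  have E_img: "rowop_adj E a v y x \<longleftrightarrow> E y x \<noteq> (x = v \<and> E a y)" if "y \<in> f ` (T - set O')" for y x
    using that vi by (auto simp: rowop_adj_def)
  have old: "x \<in> T \<and> x = v \<and> a \<in> T" if y: "y \<in> f ` (T - set O')" and "rowop_adj E a v y x" "\<not> E y x" for y x
  proof -
    have x: "x = v" "E a y" using E_img[OF y] that by auto
    then have "a \<in> T" using n(2)[of a y] y by auto
    then show ?thesis using av x by simp
  qed
  show ?thesis
  proof (rule tail_reachI[OF r])
    show "set O' \<subseteq> f ` (T - set O')" using d(12) by (rule subsetI)
    show "set O' \<subseteq> T" "T \<subseteq> V" by (rule d(5), rule d(6))
    fix u assume u: "u \<in> T - set O'"
    then have fu: "f u \<in> f ` (T - set O')" by (rule imageI)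
    show "f u \<in> T - set I" by (rule d(7)[OF u])
    \<comment> \<open>If \<open>f u\<close> is adjacent to \<open>a\<close>, then \<open>u\<close>
      is \<open>a\<close> or ranks below it, hence below \<open>v\<close>.\<close>
    have tgt: "h u < h v" if "E a (f u)" "u \<noteq> v"
    proof -
      have aT: "a \<in> T" using that n(2)[of a "f u"] fu by auto
      have "u = a \<or> h u < h a" using d(9)[OF u, of a] that graph_onD(4)[OF d(2) that(1)] by auto
      then show ?thesis using av[OF aT] by auto
    qed
    show "f u = u \<and> l u = LYZ \<or> rowop_adj E a v u (f u) \<and> xy_class (l u)"
    proof (cases "f u = u")
      case True then show ?thesis using d(8)[OF u] graph_onD(5)[OF d(2)] by auto
    next
      case False
      \<comment> \<open>The edge from \<open>v\<close> to its own corrector cannot be toggled: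
        adjacency of \<open>f v\<close> to \<open>a\<close> would put \<open>v\<close> below
        \<open>a\<close>.\<close>
      have "\<not> (u = v \<and> E a (f u))"
      proof
        assume *: "u = v \<and> E a (f u)"
        then have aT: "a \<in> T" using n(2)[of a "f u"] fu by auto
        have "h u < h a" using d(9)[OF u, of a] * v(2) graph_onD(4)[OF d(2), of a "f u"] by auto
        then show False using av[OF aT] * by simp
      qed
      then have "rowop_adj E a v u (f u) \<longleftrightarrow> E u (f u)" using fu vi by (auto simp: rowop_adj_def)
      then show ?thesis using d(8)[OF u] False by simp
    qed
    show "x \<in> T" if "rowop_adj E a v (f u) x" for x
      using d(10)[OF fu, of x] old[OF fu that] by auto
    show "h u < h x" if "x \<noteq> u" "x = f u \<or> rowop_adj E a v (f u) x" for x
    proof (cases "x = f u \<or> E (f u) x")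
      case True then show ?thesis using d(9)[OF u that(1)] by simp
    next
      case False
      then have "x = v" "E a (f u)" using that E_img[OF fu, of x] by auto
      then show ?thesis using tgt that by simp
    qed
  next
    show "x \<in> f ` (T - set O')" if w: "w \<in> set O'" "rowop_adj E a v w x" for w x
    proof -
      have "\<not> E a w" using n(1)[OF aI(2), of w] w(1) by auto
      then have "E w x" using w(2) E_img[OF d(12)[OF w(1)], of x] by simp
      then show ?thesis using d(13)[OF w(1)] by simp
    qed
  qed (rule d(14))
qed

lemma par_remove: "finite A \<Longrightarrow> a \<in> A \<Longrightarrow> par E (A - {a}) x \<longleftrightarrow> par E A x \<noteq> E x a"
proof -
  assume "finite A" "a \<in> A"
  moreover from this have "sym_diff A {a} = A - {a}" by auto
  ultimately show ?thesis using par_sym_diff[of A "{a}" E x] by simp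
qed

text \<open>Column \<open>v\<close> absorbs column \<open>a\<close>, so dropping \<open>a\<close>
  from \<open>A\<close> loses nothing. Only row \<open>v\<close> also changes, and picks up the
  parity at \<open>a\<close>.\<close>

lemma par_rowop:
  assumes g: "graph_on V E" and A: "finite A" "a \<in> A" "v \<in> A" "a \<noteq> v"
  shows "par (rowop_adj E a v) (A - {a}) x \<longleftrightarrow> (if x = v then par E A v \<noteq> par E A a else par E A x)"
proof (cases "x = v")
  case False
  have "par (rowop_adj E a v) (A - {a}) x \<longleftrightarrow> par E (A - {a}) x \<noteq> par (\<lambda>x y. y = v \<and> E a x) (A - {a}) x"
    unfolding par_def[of "rowop_adj E a v"] using A False by (intro par_neq) (auto simp: rowop_adj_def)
  also have "par (\<lambda>x y. y = v \<and> E a x) (A - {a}) x \<longleftrightarrow> E a x"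
  proof -
    have "{y \<in> A - {a}. y = v \<and> E a x} = (if E a x then {v} else {})" using A by auto
    then show ?thesis by (simp add: par_def)
  qed
  finally show ?thesis using False par_remove[OF A(1,2), of E x] graph_on_sym[OF g, of a x] by auto
next
  case True
  have "par (rowop_adj E a v) (A - {a}) v \<longleftrightarrow> par E (A - {a}) v \<noteq> par (\<lambda>x y. y \<noteq> v \<and> E a y) (A - {a}) v"
    unfolding par_def[of "rowop_adj E a v"] using A graph_onD(5)[OF g] by (intro par_neq) (auto simp: rowop_adj_def)
  also have "par (\<lambda>x y. y \<noteq> v \<and> E a y) (A - {a}) v \<longleftrightarrow> par E (A - {a} - {v}) a"
  proof -
    have "{y \<in> A - {a}. y \<noteq> v \<and> E a y} = {y \<in> A - {a} - {v}. E a y}" by auto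
    then show ?thesis by (simp add: par_def)
  qed
  finally show ?thesis
    using True par_remove[OF A(1,2), of E v] par_remove[OF A(1,2), of E a] par_remove[of "A - {a}" v E a] A
      graph_on_sym[OF g, of a v] graph_onD(5)[OF g, of a] by auto
qed

text \<open>Row operations add the neighbourhoods of the other members of \<open>A\<close> to that of \<open>v\<close>. They keep the tail
  causal because \<open>v\<close> has the highest rank.\<close>

lemma merge_correction:
  fixes D0 :: "'v::infinite mbqc"
  assumes "tail_reach D0 I O' V E l T f h" and "A \<subseteq> V - f ` (T - set O') - set I" "\<And>a. a \<in> A \<Longrightarrow> l a = LX"
    and "v \<in> A" "\<And>a. a \<in> A \<Longrightarrow> a \<in> T \<Longrightarrow> a \<noteq> v \<Longrightarrow> v \<in> T \<and> h a < h v"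
    and "\<And>x. x \<in> V - T \<Longrightarrow> par E A x \<longleftrightarrow> x = w" and "v \<notin> T \<Longrightarrow> w \<notin> A"
  shows "\<exists>E'. tail_reach D0 I O' V E' l T f h \<and> (\<forall>x\<in>V - T. E' x v \<longleftrightarrow> x = w)"
  using assms
proof (induction "card A" arbitrary: A E rule: less_induct)
  case less
  note t = less.prems(1) and A = less.prems(2) and par = less.prems(6)
  note d = tail_reachD[OF t]
  have fin: "finite A" using A d(3) by (meson Diff_subset finite_subset order_trans)
  show ?case
  proof (cases "A = {v}")
    case True
    then show ?thesis using t par by auto
  next
    case False
    then obtain a where a: "a \<in> A" "a \<noteq> v" using less.prems(4) by auto
    let ?E = "rowop_adj E a v"
    have t': "tail_reach D0 I O' V ?E l T f h"
      using a A less.prems by (intro tail_reach_rowop[OF t]) auto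
    have par': "par ?E (A - {a}) x \<longleftrightarrow> x = w" if x: "x \<in> V - T" for x
    proof (cases "x = v")
      case False
      then show ?thesis using par_rowop[OF d(2) fin a(1) less.prems(4) a(2), of x] par[OF x] by simp
    next
      case True
      then have vT: "v \<notin> T" using x by auto
      \<comment> \<open>The parity picked up at \<open>v\<close> is that of \<open>a\<close>, which
        vanishes: \<open>a\<close> lies in the head and differs from \<open>w\<close>, as
        \<open>w\<close> is not in \<open>A\<close>.\<close>
      then have aT: "a \<in> V - T" using less.prems(5)[OF a(1)] a A by auto
      have "w \<notin> A" using less.prems(7) vT by simp
      then show ?thesis
        using par_rowop[OF d(2) fin a(1) less.prems(4) a(2), of x] par[OF x] par[OF aT] True a less.prems(4) by auto
    qed
    have lt: "card (A - {a}) < card A" using fin a by (intro card_Diff1_less)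
    show ?thesis
    proof (rule less.hyps[OF lt t' _ _ _ _ par'])
      show "A - {a} \<subseteq> V - f ` (T - set O') - set I" using A by blast
      show "l b = LX" if "b \<in> A - {a}" for b using less.prems(3) that by simp
      show "v \<in> A - {a}" using less.prems(4) a by simp
      show "v \<in> T \<and> h b < h v" if "b \<in> A - {a}" "b \<in> T" "b \<noteq> v" for b
        using less.prems(5)[of b] that by blast
      show "w \<notin> A - {a}" if "v \<notin> T" using less.prems(7) that by simp
    qed
  qed
qed

lemma absorb_wire:
  assumes t: "tail_reach D0 I O' V E l T f h" and w: "w \<in> V - T" "xy_class (l w)"
    and v: "v \<in> T" "v \<notin> set I" and N: "\<And>x. x \<in> V - T \<Longrightarrow> E x v \<longleftrightarrow> x = w"
  shows "improvable D0 I O' V l T"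
proof -
  note d = tail_reachD[OF t]
  have "x \<in> insert w T" if "E v x" for x
    using N[of x] that graph_onD(3,4)[OF d(2) that] by auto
  then have "tail_reach D0 I O' V E l (insert w T) (f(w := v)) (\<lambda>x. if x = w then 0 else Suc (h x))"
    using w v N[of w] by (intro tail_reach_grow[OF t]) auto
  moreover have "tail_measure V l (insert w T) < tail_measure V l T"
    using w d(3) by (intro tail_measure_less) auto
  ultimately show ?thesis unfolding improvable_def by blast
qed

lemma delete_pair:
  assumes t: "tail_reach D0 I O' V E l T f h"
    and ab: "a \<in> V - T" "b \<in> V - T" "E a b" "a \<notin> set I" "b \<notin> set I" "l a = LX" "l b = LX"
  shows "improvable D0 I O' V l T"
proof -
  note d = tail_reachD[OF t] and n = tail_reach_nbrs[OF t]
  have img: "a \<notin> f ` (T - set O')" "b \<notin> f ` (T - set O')" using ab d(11)[of a] d(11)[of b] by auto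
  let ?E = "del_adj (del_adj (pivot_adj E a b) a) b"
  have r: "reach D0 I O' (V - {a} - {b}) ?E l"
    by (rule reach_delete_pair[OF d(1) ab(3-7) n(1)[OF img(1)] n(1)[OF img(2)]])
  have "tail_reach D0 I O' (V - {a} - {b}) ?E l T f h"
  proof (rule tail_reach_edit[OF t r])
    show "T \<subseteq> V - {a} - {b}" using ab d(6) by auto
    show "?E y x \<longleftrightarrow> E y x" if y: "y \<in> f ` (T - set O')" for y x
    proof -
      have "\<not> E a y" "\<not> E b y" "\<not> E y a" "\<not> E y b" "y \<noteq> a" "y \<noteq> b"
        using y n(2)[of a y] n(2)[of b y] d(10)[OF y] img ab by auto
      then show ?thesis by (auto simp: del_adj_def pivot_adj_def)
    qed
  qed (use d(14) in auto)
  moreover have "tail_measure (V - {a} - {b}) l T < tail_measure V l T"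
    using ab d(3) by (intro tail_measure_less) auto
  ultimately show ?thesis unfolding improvable_def by blast
qed

text \<open>Pivoting along \<open>{v, w}\<close> turns \<open>w\<close> into a phase gadget on the tail and \<open>v\<close> into a Z-measured vertex.\<close>

lemma absorb_gadget:
  assumes t: "tail_reach D0 I O' V E l T f h"
    and w: "w \<in> V - T" "w \<notin> set I" "l w = LXY" and v: "v \<in> V - T" "v \<notin> set I" "l v = LX"
    and N: "\<And>x. x \<in> V - T \<Longrightarrow> E x v \<longleftrightarrow> x = w"
  shows "improvable D0 I O' V l T"
proof -
  note d = tail_reachD[OF t] and n = tail_reach_nbrs[OF t]
  have img: "v \<notin> f ` (T - set O')" "w \<notin> f ` (T - set O')" using v w d(11)[of v] d(11)[of w] by auto
  have wv: "E v w" "v \<noteq> w" using N[OF w(1)] graph_onD(4,5)[OF d(2)] by auto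
  let ?E = "del_adj (pivot_adj E v w) v" and ?l = "l(w := LYZ)"
  have r: "reach D0 I O' (V - {v}) ?E ?l"
    using reach_pivot_delete[OF d(1) wv(1) v(2) w(2) v(3) n(1)[OF img(1)] n(1)[OF img(2)]] w(3) by simp
  have t': "tail_reach D0 I O' (V - {v}) ?E ?l T f h"
  proof (rule tail_reach_edit[OF t r])
    show "T \<subseteq> V - {v}" using v d(6) by auto
    show "?E y x \<longleftrightarrow> E y x" if y: "y \<in> f ` (T - set O')" for y x
    proof -
      have "\<not> E v y" "\<not> E w y" "\<not> E y v" "\<not> E y w" "y \<noteq> v" "y \<noteq> w"
        using y n(2)[of v y] n(2)[of w y] d(10)[OF y] img v w by auto
      then show ?thesis by (auto simp: del_adj_def pivot_adj_def)
    qed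
    show "?l u = l u \<or> u \<notin> f ` (T - set O') \<and> (xy_class (l u) \<longrightarrow> xy_class (?l u))" if "u \<in> T - set O'" for u
      using that w by auto
    show "?l u \<in> {LX, LY}" if "u \<in> set I" "u \<notin> T" for u using d(14)[OF that] that w by auto
  qed
  \<comment> \<open>After the pivot \<open>w\<close> has the neighbours that \<open>v\<close> had,
    and \<open>w\<close> was the only one of them in the head.\<close>
  have "x \<in> insert w T" if x: "?E w x" for x
  proof -
    have "E v x" "x \<noteq> w" "x \<noteq> v" using x wv by (auto simp: del_adj_def pivot_adj_def split: if_splits)
    then show ?thesis using N[of x] graph_onD(3,4)[OF d(2)] by blast
  qed
  then have "tail_reach D0 I O' (V - {v}) ?E ?l (insert w T) (f(w := w)) (\<lambda>x. if x = w then 0 else Suc (h x))"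
    using w wv by (intro tail_reach_grow[OF t']) auto
  moreover have "tail_measure (V - {v}) ?l (insert w T) < tail_measure V l T"
    using w wv d(3) by (intro tail_measure_less) auto
  ultimately show ?thesis unfolding improvable_def by blast
qed

text \<open>Once the flow is focused on the Pauli-measured vertices, the correction set of the last vertex
  of the head that is not of this kind acts on the head only through this vertex. If all vertices of
  the head are Pauli-measured, this holds for each of them.\<close>

lemma correction_in_head:
  assumes t: "tail_reach D0 I O' V E l T f h" and ne: "V - T \<noteq> {}"
    and xy: "\<And>v. v \<in> V - T \<Longrightarrow> xy_class (l v)" and nY: "\<And>v. v \<in> V - T \<Longrightarrow> v \<notin> set I \<Longrightarrow> l v \<noteq> LY"
  shows "(\<exists>a b. a \<in> V - T \<and> b \<in> V - T \<and> E a b \<and> a \<notin> set I \<and> b \<notin> set I \<and> l a = LX \<and> l b = LX) \<or>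
    (\<exists>w\<in>V - T. \<exists>A. A \<subseteq> V - f ` (T - set O') - set I \<and> (\<forall>a\<in>A - T. l a = LX) \<and>
      (\<forall>x\<in>V - T. par E A x \<longleftrightarrow> x = w) \<and> (A \<inter> T \<noteq> {} \<or> l w = LXY \<and> w \<notin> set I \<and> w \<notin> A))"
proof -
  note d = tail_reachD[OF t] and n = tail_reach_nbrs[OF t]
  define P where "P = {v \<in> V - set O'. l v \<in> {LX, LY, LZ}}"
  obtain p0 r where "pflow V E (set I) (set O') l p0 r" using reach_graph(4)[OF d(1)] by blast
  then have "\<exists>p. pflow V E (set I) (set O') l p r \<and>
    (\<forall>a\<in>P. \<forall>u\<in>V - set O'. u \<noteq> a \<longrightarrow> \<not> detects (l a) (a \<in> p u) (par E (p u) a))"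
    using d(3) by (intro pflow_focus[OF d(2)]) (auto simp: P_def)
  then obtain p where p: "pflow V E (set I) (set O') l p r"
    and foc: "\<And>a u. a \<in> P \<Longrightarrow> u \<in> V - set O' \<Longrightarrow> u \<noteq> a \<Longrightarrow> \<not> detects (l a) (a \<in> p u) (par E (p u) a)"
    by blast
  have hO: "u \<in> V - set O'" if "u \<in> V - T" for u using that d(5) by auto
  have pu: "p u \<subseteq> V - set I" "flips (l u) (u \<in> p u) (par E (p u) u)" if "u \<in> V - T" for u
    using p hO[OF that] by (auto simp: pflow_def)
  have lab: "l v = LX \<or> l v = LXY \<and> v \<notin> set I \<or> l v = LY \<and> v \<in> set I" if "v \<in> V - T" for v
    using xy[OF that] nY[OF that] d(14)[of v] that by (auto simp: xy_class_def)
  define B where "B u = p u - f ` (T - set O')" for u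
  have parB: "par E (B u) x \<longleftrightarrow> par E (p u) x" if "x \<in> V - T" for u x
  proof -
    have "{y \<in> B u. E x y} = {y \<in> p u. E x y}" using n(2)[of x] that by (auto simp: B_def)
    then show ?thesis by (simp add: par_def)
  qed
  have Bsub: "B u \<subseteq> V - f ` (T - set O') - set I" if "u \<in> V - T" for u
    using pu(1)[OF that] by (auto simp: B_def)
  \<comment> \<open>Label X detects the parity directly. The only Y-measured head vertices are
    inputs, which no correction set contains, so there too detection is parity.\<close>
  have pauli: "\<not> par E (p u) x" if "u \<in> V - T" "x \<in> V - T" "x \<noteq> u" "l x \<noteq> LXY" for u x
  proof -
    have "x \<in> P" using lab[OF that(2)] that hO by (auto simp: P_def)
    then have nd: "\<not> detects (l x) (x \<in> p u) (par E (p u) x)" using foc hO that by blast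
    show ?thesis
    proof (cases "l x = LX")
      case True then show ?thesis using nd by simp
    next
      case False
      then have "l x = LY" "x \<notin> p u" using lab[OF that(2)] that pu(1)[OF that(1)] by auto
      then show ?thesis using nd by (simp add: detects_def)
    qed
  qed
  have fin: "finite (V - T)" using d(3) by auto
  show ?thesis
  proof (cases "\<exists>v\<in>V - T. l v = LXY")
    case True
    define M where "M = {v \<in> V - T. l v = LXY}"
    have M: "finite M" "M \<noteq> {}"
      by (rule finite_subset[OF _ fin]) (use True in \<open>auto simp: M_def\<close>)
    then have "Max (r ` M) \<in> r ` M" by (intro Max_in) auto
    then obtain w where w: "w \<in> M" "r w = Max (r ` M)" by auto
    have max: "r x \<le> r w" if "x \<in> M" for x using M that unfolding w(2) by simp
    have wV: "w \<in> V - T" "l w = LXY" using w by (auto simp: M_def)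
    have wp: "w \<notin> p w" "par E (p w) w" using pu(2)[OF wV(1)] wV(2) by (auto simp: flips_def)
    \<comment> \<open>By maximality of the rank of \<open>w\<close>, its correction set hits no
      other XY-labelled head vertex.\<close>
    have last: "x \<notin> p w \<and> \<not> par E (p w) x" if x: "x \<in> M" "x \<noteq> w" for x
    proof -
      have "x \<in> V" "x \<notin> set O'" "l x = LXY" using x hO by (auto simp: M_def)
      moreover have "\<not> r w < r x" using max[OF x(1)] by simp
      ultimately have "\<not> hit (set O') l x (x \<in> p w) (par E (p w) x)"
        using p hO[OF wV(1)] x(2) unfolding pflow_def by blast
      then show ?thesis using \<open>x \<notin> set O'\<close> \<open>l x = LXY\<close> by (simp add: hit_def detects_def)
    qed
    have "par E (B w) x \<longleftrightarrow> x = w" if "x \<in> V - T" for x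
      unfolding parB[OF that] using wp last[of x] pauli[OF wV(1) that] that by (auto simp: M_def)
    moreover have "l a = LX" if "a \<in> B w - T" for a
    proof -
      have "a \<in> V - T" "a \<notin> set I" "a \<in> p w" using that Bsub[OF wV(1)] by (auto simp: B_def)
      then show ?thesis using lab[of a] last[of a] wp by (auto simp: M_def)
    qed
    moreover have "w \<notin> set I" using lab[OF wV(1)] wV(2) by auto
    moreover have "w \<notin> B w" using wp by (simp add: B_def)
    ultimately show ?thesis using wV Bsub[OF wV(1)] by blast
  next
    case False
    have parB': "par E (B u) x \<longleftrightarrow> x = u" if u: "u \<in> V - T" and x: "x \<in> V - T" for u x
    proof (cases "x = u")
      case True
      have "par E (p u) u"
        using pu[OF u] lab[OF u] False u by (auto simp: flips_def)
      then show ?thesis using parB[OF x] True by simp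
    next
      case neq: False
      then show ?thesis using parB[OF x] pauli[OF u x neq] False x by auto
    qed
    have LX: "l a = LX" if "u \<in> V - T" "a \<in> B u - T" for a u
      using lab[of a] that Bsub[OF that(1)] False by auto
    show ?thesis
    proof (cases "\<exists>u\<in>V - T. B u \<inter> T \<noteq> {}")
      case True then show ?thesis using parB' LX Bsub by metis
    next
      case disj: False
      \<comment> \<open>If all these sets stay inside the head, every head vertex has an X-measured
        neighbour there that is no input. Applying this twice gives an adjacent pair.\<close>
      have step: "\<exists>a. a \<in> V - T \<and> E u a \<and> a \<notin> set I \<and> l a = LX" if u: "u \<in> V - T" for u
      proof -
        have "{a \<in> B u. E u a} \<noteq> {}" using parB'[OF u u] by (metis par_def card.empty even_zero)
        then obtain a where "a \<in> B u" "E u a" by blast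
        then show ?thesis using Bsub[OF u] disj LX[OF u] u by blast
      qed
      obtain u where "u \<in> V - T" using ne by blast
      then obtain a where a: "a \<in> V - T" "a \<notin> set I" "l a = LX" using step by blast
      then show ?thesis using step[OF a(1)] by blast
    qed
  qed
qed

text \<open>Breaks ties in favour of \<open>v\<close>: doubling leaves room to lift \<open>v\<close>
  above vertices of equal rank without passing any of higher rank.\<close>

lemma raise_rank:
  assumes t: "tail_reach D0 I O' V E l T f h"
  shows "tail_reach D0 I O' V E l T f (\<lambda>x. 2 * h x + (if x = v then 1 else 0))"
proof -
  note d = tail_reachD[OF t]
  have "2 * h u + (if u = v then 1 else 0) < 2 * h x + (if x = v then 1 else (0::nat))"
    if "u \<in> T - set O'" "x \<noteq> u" "x = f u \<or> E (f u) x" for u x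
    using d(9)[OF that] that(2) by auto
  moreover have "set O' \<subseteq> f ` (T - set O')" using d(12) by (rule subsetI)
  ultimately show ?thesis using d(10)[OF imageI] by (intro tail_reachI[OF d(1) _ d(6,5,7,8) _ _ d(13,14)])
qed

lemma improve:
  fixes D0 :: "'v::infinite mbqc"
  assumes t: "tail_reach D0 I O' V E l T f h" and ne: "V - T \<noteq> {}"
  shows "improvable D0 I O' V l T"
proof -
  consider w where "w \<in> V - T" "\<not> xy_class (l w)"
    | w where "w \<in> V - T" "w \<notin> set I" "l w = LY" "\<And>v. v \<in> V - T \<Longrightarrow> xy_class (l v)"
    | "\<And>v. v \<in> V - T \<Longrightarrow> xy_class (l v)" "\<And>v. v \<in> V - T \<Longrightarrow> v \<notin> set I \<Longrightarrow> l v \<noteq> LY" by blast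
  then show ?thesis
  proof cases
    case (1 w)
    then consider "l w = LZ" | "l w = LXZ" | "l w = LYZ" by (cases "l w") (auto simp: xy_class_def)
    then show ?thesis using delete_Z[OF t 1(1)] rotate_XZ[OF t 1(1)] rotate_YZ[OF t 1(1)] by cases auto
  next
    case (2 w) then show ?thesis using delete_Y[OF t] by blast
  next
    case 3
    obtain V' E' l' T' f' h' where t': "tail_reach D0 I O' V' E' l' T' f' h'" and VT: "V' - T' = V - T"
      and l': "\<forall>v\<in>V - T. l' v = l v" and X: "\<forall>q \<in> T' - f' ` (T' - set O') - set I. l' q = LX"
      using normalise_frontier[OF t] by blast
    note d = tail_reachD[OF t']
    \<comment> \<open>Normalising the frontier costs nothing, since the measure depends only on the
      head and its labels.\<close>
    have "tail_measure V' l' T' = tail_measure V l T"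
      unfolding tail_measure_def VT using l' by (metis (mono_tags, lifting) Collect_cong)
    then have imp: "improvable D0 I O' V' l' T' \<Longrightarrow> ?thesis" unfolding improvable_def by simp
    have ne': "V' - T' \<noteq> {}" and xy': "\<And>v. v \<in> V' - T' \<Longrightarrow> xy_class (l' v)"
      and nY': "\<And>v. v \<in> V' - T' \<Longrightarrow> v \<notin> set I \<Longrightarrow> l' v \<noteq> LY"
      unfolding VT using ne 3 l' by auto
    from correction_in_head[OF t' ne' xy' nY'] show ?thesis
    proof
      assume "\<exists>a b. a \<in> V' - T' \<and> b \<in> V' - T' \<and> E' a b \<and> a \<notin> set I \<and> b \<notin> set I \<and> l' a = LX \<and> l' b = LX"
      then show ?thesis using delete_pair[OF t'] imp by blast
    next
      assume "\<exists>w\<in>V' - T'. \<exists>A. A \<subseteq> V' - f' ` (T' - set O') - set I \<and> (\<forall>a\<in>A - T'. l' a = LX) \<and>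
        (\<forall>x\<in>V' - T'. par E' A x \<longleftrightarrow> x = w) \<and> (A \<inter> T' \<noteq> {} \<or> l' w = LXY \<and> w \<notin> set I \<and> w \<notin> A)"
      then obtain w A where w: "w \<in> V' - T'" and A: "A \<subseteq> V' - f' ` (T' - set O') - set I" "\<forall>a\<in>A - T'. l' a = LX"
        and par: "\<And>x. x \<in> V' - T' \<Longrightarrow> par E' A x \<longleftrightarrow> x = w"
        and c: "A \<inter> T' \<noteq> {} \<or> l' w = LXY \<and> w \<notin> set I \<and> w \<notin> A" by blast
      have AX: "l' a = LX" if "a \<in> A" for a using A X that by (cases "a \<in> T'") auto
      have finA: "finite A" by (rule finite_subset[OF A(1)]) (simp add: d(3))
      show ?thesis
      proof (cases "A \<inter> T' = {}")
        case False
        then have M: "finite (h' ` (A \<inter> T'))" "h' ` (A \<inter> T') \<noteq> {}" using finA by auto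
        then obtain v where v: "v \<in> A \<inter> T'" "h' v = Max (h' ` (A \<inter> T'))" using Max_in by (metis imageE)
        have max: "h' a \<le> h' v" if "a \<in> A" "a \<in> T'" for a unfolding v(2) using M that by (intro Max_ge) auto
        let ?h = "\<lambda>x. 2 * h' x + (if x = v then 1 else 0)"
        have "\<exists>E''. tail_reach D0 I O' V' E'' l' T' f' ?h \<and> (\<forall>x\<in>V' - T'. E'' x v \<longleftrightarrow> x = w)"
        proof (rule merge_correction[OF raise_rank[OF t'] A(1) AX _ _ par])
          show "v \<in> A" using v by simp
          show "v \<in> T' \<and> ?h a < ?h v" if "a \<in> A" "a \<in> T'" "a \<noteq> v" for a
            using v max[OF that(1,2)] that by simp
          show "v \<notin> T' \<Longrightarrow> w \<notin> A" using v by simp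
        qed
        then obtain E'' where E'': "tail_reach D0 I O' V' E'' l' T' f' ?h" "\<And>x. x \<in> V' - T' \<Longrightarrow> E'' x v \<longleftrightarrow> x = w" by blast
        have "v \<in> T'" "v \<notin> set I" using v A(1) by auto
        then show ?thesis using imp absorb_wire[OF E''(1) w xy'[OF w] _ _ E''(2)] by blast
      next
        case True
        then have cw: "l' w = LXY" "w \<notin> set I" "w \<notin> A" using c by auto
        have "A \<noteq> {}" using par[OF w] by auto
        then obtain v where v: "v \<in> A" by blast
        have vT: "v \<in> V' - T'" "v \<notin> set I" "l' v = LX" using v True A(1) AX by auto
        have "\<exists>E''. tail_reach D0 I O' V' E'' l' T' f' h' \<and> (\<forall>x\<in>V' - T'. E'' x v \<longleftrightarrow> x = w)"
          by (rule merge_correction[OF t' A(1) AX v _ par]) (use True cw in auto)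
        then obtain E'' where E'': "tail_reach D0 I O' V' E'' l' T' f' h'" "\<And>x. x \<in> V' - T' \<Longrightarrow> E'' x v \<longleftrightarrow> x = w" by blast
        show ?thesis using imp absorb_gadget[OF E''(1) w cw(2,1) vT E''(2)] by blast
      qed
    qed
  qed
qed

lemma reach_causal:
  fixes D0 :: "'v::infinite mbqc"
  assumes "tail_reach D0 I O' V E l T f h"
  shows "\<exists>V' E' l' f' h'. tail_reach D0 I O' V' E' l' V' f' h'"
  using assms
proof (induction "tail_measure V l T" arbitrary: V E l T f h rule: less_induct)
  case less
  show ?case
  proof (cases "V - T = {}")
    case True
    then have "T = V" using tail_reachD(6)[OF less.prems] by auto
    then show ?thesis using less.prems by blast
  next
    case False
    then show ?thesis using improve[OF less.prems] less.hyps unfolding improvable_def by blast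
  qed
qed

section \<open>Preparing inputs and outputs\<close>

text \<open>(LC) cannot be applied at inputs, so their labels must be suitable from the start. (IO)
  puts an X-measured vertex in front of a bad input, which becomes an interior vertex.\<close>

lemma normalise_inputs:
  fixes D0 :: "'v::infinite mbqc"
  assumes "reach D0 I O' V E l"
  shows "\<exists>I' V' E' l'. reach D0 I' O' V' E' l' \<and> (\<forall>c \<in> set I' - set O'. l' c \<in> {LX, LY})"
  using assms
proof (induction "card {c \<in> set I - set O'. l c \<notin> {LX, LY}}" arbitrary: I V E l rule: less_induct)
  case less
  note r = less.prems
  note io = reach_graph(2,3)[OF r] and g = reach_graph(1)[OF r]
  show ?case
  proof (cases "\<forall>c \<in> set I - set O'. l c \<in> {LX, LY}")
    case True then show ?thesis using r by blast
  next
    case False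
    then obtain c where c: "c \<in> set I" "c \<notin> set O'" "l c \<notin> {LX, LY}" by blast
    obtain a where a: "a \<notin> V" using ex_fresh graph_onD(1)[OF g] by blast
    obtain b where b: "b \<notin> insert a V" using ex_fresh graph_onD(1)[OF g] finite_insert by metis
    let ?I = "map (\<lambda>v. if v = c then a else v) I" and ?l = "l(a := LX, b := LX)"
    have sI: "set ?I = insert a (set I - {c})" using c by (intro set_map_replace)
    have r': "reach D0 ?I O' (V \<union> {a, b}) (path_adj E a b c) ?l"
      using a b by (intro reach_input[OF r c(1)]) auto
    have sub: "{x \<in> set ?I - set O'. ?l x \<notin> {LX, LY}} \<subseteq> {x \<in> set I - set O'. l x \<notin> {LX, LY}} - {c}"
    proof
      fix x assume x: "x \<in> {x \<in> set ?I - set O'. ?l x \<notin> {LX, LY}}"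
      then have "x \<noteq> a" "x \<noteq> b" using b by auto
      then show "x \<in> {x \<in> set I - set O'. l x \<notin> {LX, LY}} - {c}" using x unfolding sI by auto
    qed
    have "c \<in> {x \<in> set I - set O'. l x \<notin> {LX, LY}}" using c by simp
    then have lt: "card ({x \<in> set I - set O'. l x \<notin> {LX, LY}} - {c}) < card {x \<in> set I - set O'. l x \<notin> {LX, LY}}"
      by (intro card_Diff1_less) auto
    have le: "card {x \<in> set ?I - set O'. ?l x \<notin> {LX, LY}} \<le> card ({x \<in> set I - set O'. l x \<notin> {LX, LY}} - {c})"
      by (rule card_mono[OF _ sub]) auto
    show ?thesis by (rule less.hyps[OF le_less_trans[OF le lt] r'])
  qed
qed

text \<open>With \<open>f c = b\<close> and \<open>f b = d\<close>, the new output \<open>d\<close>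
  and its only neighbour \<open>b\<close> both enter the range of \<open>f\<close>. They rank above
  everything else because they correct \<open>c\<close> and \<open>b\<close>.\<close>

lemma extend_output:
  fixes D0 :: "'v::infinite mbqc"
  assumes r: "reach D0 I O' V E l" and t: "causal_tail (set I) (set O') V E l T f h"
    and c: "c \<in> set O'" "c \<notin> f ` (T - set O')"
  shows "\<exists>O'' V' E' l' T' f' h'. reach D0 I O'' V' E' l' \<and> causal_tail (set I) (set O'') V' E' l' T' f' h' \<and>
    set O'' - f' ` (T' - set O'') = set O' - f ` (T - set O') - {c}"
proof -
  note io = reach_graph(2,3)[OF r] and g = reach_graph(1)[OF r]
  obtain b where b: "b \<notin> V" using ex_fresh graph_onD(1)[OF g] by blast
  obtain d where d: "d \<notin> insert b V" using ex_fresh graph_onD(1)[OF g] finite_insert by metis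
  let ?O = "map (\<lambda>v. if v = c then d else v) O'" and ?l = "l(c := LX, b := LX)" and ?E = "path_adj E d b c"
  let ?f = "f(c := b, b := d)" and ?T = "T \<union> {d, b}"
  define H where "H = Suc (Max (h ` V))"
  let ?h = "h(b := H, d := Suc H)"
  have H: "h v < H" if "v \<in> V" for v
    using that graph_onD(1)[OF g] by (simp add: H_def less_Suc_eq_le)
  have bd: "b \<notin> V" "d \<notin> V" "d \<noteq> b" using b d by auto
  have sO: "set ?O = insert d (set O' - {c})" using c by (intro set_map_replace)
  have r': "reach D0 I ?O (V \<union> {d, b}) ?E ?l" by (rule reach_output[OF r c(1) bd])
  have TV: "set O' \<subseteq> T" "T \<subseteq> V" using t by (simp_all add: causal_tail_def)
  have tl: "f v \<in> T - set I \<and> (f v = v \<and> l v = LYZ \<or> E v (f v) \<and> xy_class (l v)) \<and>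
        (\<forall>x. E (f v) x \<longrightarrow> x \<in> T) \<and> (\<forall>x. x \<noteq> v \<longrightarrow> x = f v \<or> E (f v) x \<longrightarrow> h v < h x)"
    if "v \<in> T - set O'" for v using t that unfolding causal_tail_def by blast
  have neq: "b \<notin> T" "d \<notin> T" "b \<notin> set I" "d \<notin> set I" "b \<notin> set O'" "d \<notin> set O'" "c \<in> T" "c \<in> V" "c \<noteq> b" "c \<noteq> d"
    using bd TV io c by auto
  have TO: "?T - set ?O = (T - set O') \<union> {c, b}" unfolding sO using neq bd by auto
  have img: "?f ` (?T - set ?O) = f ` (T - set O') \<union> {b, d}"
  proof -
    have 1: "?f ` (T - set O') = f ` (T - set O')" using neq c by (intro image_cong) auto
    have 2: "?f ` {c, b} = {b, d}" using neq by simp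
    show ?thesis unfolding TO image_Un 1 2 ..
  qed
  have nz: "\<not> E x b" "\<not> E b x" "\<not> E x d" "\<not> E d x" for x using g bd by (auto simp: graph_on_def)
  have Eb: "?E b x \<longleftrightarrow> x = d \<or> x = c" and Ed: "?E d x \<longleftrightarrow> x = b" for x
    using nz neq bd by (auto simp: path_adj_def doubleton_eq_iff)
  have E_old: "?E v x \<longleftrightarrow> E v x" if "v \<noteq> b" "v \<noteq> c" "v \<noteq> d" for v x
    using that by (auto simp: path_adj_def doubleton_eq_iff)
  have new: "?f v \<in> ?T - set I \<and> (?f v = v \<and> ?l v = LYZ \<or> ?E v (?f v) \<and> xy_class (?l v)) \<and>
        (\<forall>x. ?E (?f v) x \<longrightarrow> x \<in> ?T) \<and> (\<forall>x. x \<noteq> v \<longrightarrow> x = ?f v \<or> ?E (?f v) x \<longrightarrow> ?h v < ?h x)"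
    if v: "v \<in> ?T - set ?O" for v
  proof -
    consider "v = c" | "v = b" | "v \<in> T - set O'" "v \<noteq> c" "v \<noteq> b" "v \<noteq> d" using v neq c unfolding TO by auto
    then show ?thesis
    proof cases
      case 1
      then show ?thesis using neq bd H[of c] by (auto simp: Eb xy_class_def) (auto simp: path_adj_def)
    next
      case 2
      then show ?thesis using neq bd by (auto simp: Ed Eb xy_class_def)
    next
      case 3
      have fv: "f v \<noteq> b" "f v \<noteq> c" "f v \<noteq> d" using tl[OF 3(1)] 3(1) neq c(2) by auto
      have f': "?f v = f v" using 3 by simp
      have old: "?h v < ?h x" if "x \<noteq> v" "x = f v \<or> E (f v) x" for x
      proof -
        have "x \<in> T" using tl[OF 3(1)] that(2) by auto
        then show ?thesis using tl[OF 3(1)] that 3 neq by auto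
      qed
      show ?thesis unfolding f' E_old[OF fv] E_old[OF 3(3,2,4), of "f v"]
        using tl[OF 3(1)] 3 old by auto
    qed
  qed
  have outs: "x \<in> f ` (T - set O') \<union> {b, d}" if w: "w \<in> set ?O" "w \<in> f ` (T - set O') \<union> {b, d}" "?E w x" for w x
  proof (cases "w = d")
    case True then show ?thesis using w Ed by auto
  next
    case False
    then have "w \<in> set O'" "w \<noteq> c" "w \<noteq> b" "w \<in> f ` (T - set O')" using w neq unfolding sO by auto
    then show ?thesis using w(3) False t E_old[of w x] unfolding causal_tail_def by blast
  qed
  have inps: "?l v \<in> {LX, LY}" if "v \<in> set I - ?T" for v
  proof -
    have "v \<noteq> c" "v \<noteq> b" "v \<in> set I - T" using that neq by auto
    then show ?thesis using t unfolding causal_tail_def by simp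
  qed
  have sub: "set ?O \<subseteq> ?T" "?T \<subseteq> V \<union> {d, b}" unfolding sO using TV by auto
  have ct: "causal_tail (set I) (set ?O) (V \<union> {d, b}) ?E ?l ?T ?f ?h"
    unfolding causal_tail_def img
    by (rule conjI[OF sub(1)], rule conjI[OF sub(2)], rule conjI, rule ballI, erule new,
        rule conjI, intro ballI allI impI, erule IntE, erule (2) outs, rule ballI, erule inps)
  have "set ?O - ?f ` (?T - set ?O) = set O' - f ` (T - set O') - {c}"
    unfolding img unfolding sO using neq by auto
  then show ?thesis by (intro exI conjI) (rule r', rule ct)
qed

lemma extend_outputs:
  fixes D0 :: "'v::infinite mbqc"
  assumes "reach D0 I O' V E l" and "causal_tail (set I) (set O') V E l T f h"
  shows "\<exists>O'' V' E' l' T' f' h'. tail_reach D0 I O'' V' E' l' T' f' h'"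
  using assms
proof (induction "card (set O' - f ` (T - set O'))" arbitrary: O' V E l T f h rule: less_induct)
  case less
  show ?case
  proof (cases "set O' \<subseteq> f ` (T - set O')")
    case True then show ?thesis using less.prems unfolding tail_reach_def by blast
  next
    case False
    then obtain c where c: "c \<in> set O'" "c \<notin> f ` (T - set O')" by blast
    obtain O'' V' E' l' T' f' h' where r': "reach D0 I O'' V' E' l'" "causal_tail (set I) (set O'') V' E' l' T' f' h'"
      and e: "set O'' - f' ` (T' - set O'') = set O' - f ` (T - set O') - {c}"
      using extend_output[OF less.prems c] by blast
    have "card (set O'' - f' ` (T' - set O'')) < card (set O' - f ` (T - set O'))"
      unfolding e using c by (intro card_Diff1_less) auto
    then show ?thesis using less.hyps r' by blast
  qed
qed

text \<open>Without the exceptions for Pauli labels, a vertex disturbs at most \<open>f v\<close>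
  and its neighbours, and the rank of \<open>causal_tail\<close> bounds all of these.\<close>

lemma ext_causal_flow_of_causal_tail:
  assumes D: "is_mbqc D" and t: "causal_tail (ins D) (outs D) (verts D) (adj D) l (verts D) f h"
    and l: "\<And>v. v \<in> verts D - outs D \<Longrightarrow> lab D v = l v"
  shows "has_ext_causal_flow D"
proof -
  have og: "is_open_graph D" using D by (simp add: is_mbqc_def)
  note g = graph_on_adj[OF og]
  \<comment> \<open>The plane is read off from \<open>f\<close>, since a Pauli effect lies in two
    planes and its label does not choose one.\<close>
  define L where "L v = (if f v = v then LYZ else LXY)" for v
  have tl: "f v \<in> verts D - ins D" "f v = v \<and> l v = LYZ \<or> adj D v (f v) \<and> xy_class (l v)"
    "\<And>x. x \<noteq> v \<Longrightarrow> x = f v \<or> adj D (f v) x \<Longrightarrow> h v < h x"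
    if "v \<in> verts D - outs D" for v
    using t that unfolding causal_tail_def by blast+
  have "planar_labelling D L"
    unfolding planar_labelling_def
  proof
    fix v assume v: "v \<in> verts D - outs D"
    then have e: "is_effect (eff D v)" using D by (simp add: is_mbqc_def)
    note pl = pauli_label_planes[OF e, folded lab_def, unfolded l[OF v]]
    show "L v = LXY \<and> (\<exists>\<alpha>. eff D v \<propto> XY \<alpha>) \<or> L v = LYZ \<and> (\<exists>\<alpha>. eff D v \<propto> YZ \<alpha>)"
    proof (cases "f v = v")
      case True
      then have "l v = LYZ" using tl(2)[OF v] graph_onD(5)[OF g] by auto
      then show ?thesis using pl(2) True by (simp add: L_def)
    next
      case False
      then have "l v \<in> {LX, LY, LXY}" using tl(2)[OF v] by (simp add: xy_class_def)
      then show ?thesis using pl(1) False by (simp add: L_def)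
    qed
  qed
  moreover have "ext_causal_flow D L f"
    unfolding ext_causal_flow_def
  proof (intro conjI ballI impI)
    fix v assume v: "v \<in> verts D - outs D"
    show "L v \<in> {LXY, LYZ}" by (simp add: L_def)
    show "f v \<in> verts D - ins D" by (rule tl(1)[OF v])
    show "f v = v" if "L v = LYZ" using that by (simp add: L_def split: if_splits)
    show "f v \<in> nbrs D v" if "L v = LXY"
      using that tl(1,2)[OF v] by (auto simp: L_def nbrs_def adj_def split: if_splits)
  next
    let ?R = "flow_rel D L (\<lambda>v. {f v})"
    have "?R \<subseteq> verts D \<times> verts D" by (auto simp: flow_rel_def)
    then have fin: "finite ?R" using open_graphD(1)[OF og] by (meson finite_SigmaI finite_subset)
    have "h u < h v" if uv: "(u, v) \<in> ?R" for u v
    proof -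
      have *: "u \<in> verts D - outs D" "v \<noteq> u" and "hit (outs D) L v (v \<in> {f u}) (adj D v (f u))"
        using uv unfolding flow_rel_hit[OF og] by simp_all
      then have "v = f u \<or> adj D v (f u)"
        by (auto simp: hit_def detects_def L_def split: if_splits)
      then show ?thesis using tl(3)[OF *] graph_onD(4)[OF g] by blast
    qed
    then show "flow_ordered D L (\<lambda>v. {f v})"
      unfolding flow_ordered_def irrefl_trancl_iff_rank[OF fin] by auto
  qed
  ultimately show ?thesis unfolding has_ext_causal_flow_def by blast
qed

theorem mainTheorem2:
  fixes D :: "'v::infinite mbqc"
  assumes "is_mbqc D" and "has_pauli_flow D"
  shows "\<exists>D'. pauli_flow_step\<^sup>*\<^sup>* D D' \<and> is_mbqc D' \<and> has_ext_causal_flow D' \<and> same_interp D D'"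
proof -
  obtain I V E l where r: "reach D I (outputs D) V E l" and I: "\<forall>c \<in> set I - set (outputs D). l c \<in> {LX, LY}"
    using normalise_inputs[OF reach_start[OF assms]] by blast
  \<comment> \<open>The initial tail consists of the outputs alone; it has no measured vertex, so
    \<open>id\<close> and the zero rank are arbitrary.\<close>
  have "causal_tail (set I) (set (outputs D)) V E l (set (outputs D)) id (\<lambda>_. 0)"
    using I reach_graph(3)[OF r] by (simp add: causal_tail_def)
  then obtain O' V1 E1 l1 T f h where "tail_reach D I O' V1 E1 l1 T f h"
    using extend_outputs[OF r] by blast
  then obtain V2 E2 l2 f2 h2 where t: "tail_reach D I O' V2 E2 l2 V2 f2 h2"
    using reach_causal by blast
  then have "reach D I O' V2 E2 l2" by (rule tail_reachD(1))
  then show ?thesis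
  proof (rule reachE)
    fix D' p r
    assume D': "pauli_flow_step\<^sup>*\<^sup>* D D'" "same_interp D D'" "is_mbqc D'"
      and e: "verts D' = V2" "ins D' = set I" "outs D' = set O'" "adj D' = E2"
        "\<And>v. v \<in> V2 - set O' \<Longrightarrow> lab D' v = l2 v"
    have "has_ext_causal_flow D'"
      using t e by (intro ext_causal_flow_of_causal_tail[OF D'(3), of l2 f2 h2]) (auto simp: tail_reach_def)
    then show ?thesis using D' by blast
  qed
qed

end
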